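(* For $n\ge2$ let $$\lambda_n=\inf\{\operatorname{Lip}(h): h:S_{\ell_\infty^n}\to S_{\ell_2^n}\text{ is a Lipschitz homeomorphism}\},$$ $$C_n=\inf\{\operatorname{Lip}(g): g:B_{\ell_\infty^n}\to B_{\ell_2^n}\text{ is a Lipschitz homeomorphism onto }B_{\ell_2^n}\}.$$ Then $$\lim_{n\to\infty}\frac{\lambda_n}{\log n}=\lim_{n\to\infty}\frac{C_n}{\log n}=\frac12.$$ More precisely, for every $n\ge2$, $$\lambda_n\le C_n\le 1+\operatorname{arsinh}\sqrt{n-1}+\left(1+\frac{n}{2(n-1)}\right)\sqrt{1+\operatorname{arsinh}\sqrt{n-1}}.$$
   Context: $\ell_p^n$ is $\mathbb R^n$ with the $\ell_p$ norm. For a normed space $E$, $B_E$ and $S_E$ denote the closed unit ball and the unit sphere, with the distances induced by the norm. For a map $f$ between metric spaces, $\operatorname{Lip}(f)=\sup_{x\ne y}d(f(x),f(y))/d(x,y)$. No Lipschitz control of inverses is required. $\log$ is the natural logarithm. *)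

theory Defs
  imports "HOL-Analysis.Analysis"
begin

section \<open>The spaces \<open>l_2^n\<close> and \<open>l_infinity^n\<close>\<close>

text \<open>
  The statement takes a limit in the dimension, so $\mathbb{R}^n$ is an explicit carrier: the
  real sequences vanishing from index \<open>n\<close> on, as in \<^const>\<open>Euclidean_space\<close>.
\<close>

definition Rn :: "nat \<Rightarrow> (nat \<Rightarrow> real) set"
  where "Rn n = {x. \<forall>i\<ge>n. x i = 0}"

definition l2_norm :: "nat \<Rightarrow> (nat \<Rightarrow> real) \<Rightarrow> real"
  where "l2_norm n x = L2_set x {..<n}"

text \<open>Only meaningful for \<open>n \<ge> 1\<close>.\<close>

definition linf_norm :: "nat \<Rightarrow> (nat \<Rightarrow> real) \<Rightarrow> real"
  where "linf_norm n x = Max ((\<lambda>i. \<bar>x i\<bar>) ` {..<n})"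

definition l2_metric :: "nat \<Rightarrow> (nat \<Rightarrow> real) metric"
  where "l2_metric n = metric (Rn n, \<lambda>x y. l2_norm n (\<lambda>i. x i - y i))"

definition linf_metric :: "nat \<Rightarrow> (nat \<Rightarrow> real) metric"
  where "linf_metric n = metric (Rn n, \<lambda>x y. linf_norm n (\<lambda>i. x i - y i))"

definition l2_ball :: "nat \<Rightarrow> (nat \<Rightarrow> real) metric"
  where "l2_ball n = submetric (l2_metric n) {x. l2_norm n x \<le> 1}"

definition l2_sphere :: "nat \<Rightarrow> (nat \<Rightarrow> real) metric"
  where "l2_sphere n = submetric (l2_metric n) {x. l2_norm n x = 1}"

definition linf_ball :: "nat \<Rightarrow> (nat \<Rightarrow> real) metric"
  where "linf_ball n = submetric (linf_metric n) {x. linf_norm n x \<le> 1}"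

definition linf_sphere :: "nat \<Rightarrow> (nat \<Rightarrow> real) metric"
  where "linf_sphere n = submetric (linf_metric n) {x. linf_norm n x = 1}"

text \<open>
  The abstract type of metrics is only characterised on genuine metric spaces, so we check that
  the above are such.
\<close>

lemma Rn_eq_iff:
  assumes "x \<in> Rn n" "y \<in> Rn n"
  shows "x = y \<longleftrightarrow> (\<forall>i<n. x i = y i)"
proof
  assume eq: "\<forall>i<n. x i = y i"
  show "x = y"
  proof
    fix i
    show "x i = y i"
      using assms eq by (cases "i < n") (simp_all add: Rn_def)
  qed
qed simp

lemma Metric_space_l2: "Metric_space (Rn n) (\<lambda>x y. l2_norm n (\<lambda>i. x i - y i))"
proof
  fix x y :: "nat \<Rightarrow> real"
  show "0 \<le> l2_norm n (\<lambda>i. x i - y i)"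
    by (simp add: l2_norm_def)
  show "l2_norm n (\<lambda>i. x i - y i) = l2_norm n (\<lambda>i. y i - x i)"
    by (simp add: l2_norm_def L2_set_def power2_commute)
next
  fix x y :: "nat \<Rightarrow> real"
  assume "x \<in> Rn n" "y \<in> Rn n"
  then have "x = y \<longleftrightarrow> (\<forall>i<n. x i = y i)"
    by (rule Rn_eq_iff)
  then show "l2_norm n (\<lambda>i. x i - y i) = 0 \<longleftrightarrow> x = y"
    by (auto simp: l2_norm_def L2_set_eq_0_iff)
next
  fix x y z :: "nat \<Rightarrow> real"
  have "l2_norm n (\<lambda>i. (x i - y i) + (y i - z i))
        \<le> l2_norm n (\<lambda>i. x i - y i) + l2_norm n (\<lambda>i. y i - z i)"
    unfolding l2_norm_def by (rule L2_set_triangle_ineq)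
  then show "l2_norm n (\<lambda>i. x i - z i)
        \<le> l2_norm n (\<lambda>i. x i - y i) + l2_norm n (\<lambda>i. y i - z i)"
    by simp
qed

lemma linf_norm_le_iff: "n \<ge> 1 \<Longrightarrow> linf_norm n x \<le> c \<longleftrightarrow> (\<forall>i<n. \<bar>x i\<bar> \<le> c)"
  unfolding linf_norm_def by (subst Max_le_iff) (auto simp: lessThan_empty_iff)

lemma abs_le_linf_norm: "i < n \<Longrightarrow> \<bar>x i\<bar> \<le> linf_norm n x"
  unfolding linf_norm_def by (rule Max_ge) auto

lemma Metric_space_linf:
  assumes n: "n \<ge> 1"
  shows "Metric_space (Rn n) (\<lambda>x y. linf_norm n (\<lambda>i. x i - y i))"
proof
  fix x y :: "nat \<Rightarrow> real"
  show nonneg: "0 \<le> linf_norm n (\<lambda>i. x i - y i)"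
    using abs_le_linf_norm[of 0 n "\<lambda>i. x i - y i"] n by linarith
  show "linf_norm n (\<lambda>i. x i - y i) = linf_norm n (\<lambda>i. y i - x i)"
    by (simp add: linf_norm_def abs_minus_commute)
next
  fix x y :: "nat \<Rightarrow> real"
  assume "x \<in> Rn n" "y \<in> Rn n"
  then have "x = y \<longleftrightarrow> (\<forall>i<n. x i = y i)"
    by (rule Rn_eq_iff)
  also have "\<dots> \<longleftrightarrow> linf_norm n (\<lambda>i. x i - y i) \<le> 0"
    by (simp add: linf_norm_le_iff[OF n])
  also have "\<dots> \<longleftrightarrow> linf_norm n (\<lambda>i. x i - y i) = 0"
    using abs_le_linf_norm[of 0 n "\<lambda>i. x i - y i"] n by linarith
  finally show "linf_norm n (\<lambda>i. x i - y i) = 0 \<longleftrightarrow> x = y"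
    by simp
next
  fix x y z :: "nat \<Rightarrow> real"
  have "\<bar>x i - z i\<bar> \<le> linf_norm n (\<lambda>i. x i - y i) + linf_norm n (\<lambda>i. y i - z i)"
    if "i < n" for i
    using abs_le_linf_norm[OF that, of "\<lambda>i. x i - y i"]
      abs_le_linf_norm[OF that, of "\<lambda>i. y i - z i"] by linarith
  then show "linf_norm n (\<lambda>i. x i - z i)
        \<le> linf_norm n (\<lambda>i. x i - y i) + linf_norm n (\<lambda>i. y i - z i)"
    by (simp add: linf_norm_le_iff[OF n])
qed

lemma mspace_l2 [simp]:
  "mspace (l2_ball n) = {x \<in> Rn n. l2_norm n x \<le> 1}"
  "mspace (l2_sphere n) = {x \<in> Rn n. l2_norm n x = 1}"
  using Metric_space.mspace_metric[OF Metric_space_l2[of n]]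
  by (auto simp: l2_ball_def l2_sphere_def l2_metric_def)

lemma mdist_l2 [simp]:
  "mdist (l2_ball n) x y = l2_norm n (\<lambda>i. x i - y i)"
  "mdist (l2_sphere n) x y = l2_norm n (\<lambda>i. x i - y i)"
  using Metric_space.mdist_metric[OF Metric_space_l2[of n]]
  by (simp_all add: l2_ball_def l2_sphere_def l2_metric_def)

lemma mspace_linf [simp]:
  assumes "n \<ge> 1"
  shows "mspace (linf_ball n) = {x \<in> Rn n. linf_norm n x \<le> 1}"
    and "mspace (linf_sphere n) = {x \<in> Rn n. linf_norm n x = 1}"
  using Metric_space.mspace_metric[OF Metric_space_linf[OF assms]]
  by (auto simp: linf_ball_def linf_sphere_def linf_metric_def)

lemma mdist_linf [simp]:
  assumes "n \<ge> 1"
  shows "mdist (linf_ball n) x y = linf_norm n (\<lambda>i. x i - y i)"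
    and "mdist (linf_sphere n) x y = linf_norm n (\<lambda>i. x i - y i)"
  using Metric_space.mdist_metric[OF Metric_space_linf[OF assms]]
  by (simp_all add: linf_ball_def linf_sphere_def linf_metric_def)


section \<open>Lipschitz homeomorphisms\<close>

text \<open>
  Being a real supremum, \<open>Lip\<close> has its intended value for Lipschitz maps on a space with at least
  two points; it is only used for these.
\<close>

definition Lip :: "'a metric \<Rightarrow> 'b metric \<Rightarrow> ('a \<Rightarrow> 'b) \<Rightarrow> real"
  where "Lip X Y f =
    (SUP (x, y) \<in> {(x, y). x \<in> mspace X \<and> y \<in> mspace X \<and> x \<noteq> y}.
       mdist Y (f x) (f y) / mdist X x y)"

text \<open>The inverse is only required to be continuous, not Lipschitz.\<close>

definition Lipschitz_homeomorphism :: "'a metric \<Rightarrow> 'b metric \<Rightarrow> ('a \<Rightarrow> 'b) \<Rightarrow> bool"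
  where "Lipschitz_homeomorphism X Y f \<longleftrightarrow>
    Lipschitz_continuous_map X Y f \<and> homeomorphic_map (mtopology_of X) (mtopology_of Y) f"

text \<open>
  The real infima below are over sets bounded below by \<open>0\<close> that are nonempty for \<open>n \<ge> 1\<close>
  (radial maps), so they are the true infima.
\<close>

definition sphere_const :: "nat \<Rightarrow> real"
  where "sphere_const n =
    Inf {Lip (linf_sphere n) (l2_sphere n) h | h.
           Lipschitz_homeomorphism (linf_sphere n) (l2_sphere n) h}"

definition ball_const :: "nat \<Rightarrow> real"
  where "ball_const n =
    Inf {Lip (linf_ball n) (l2_ball n) g | g.
           Lipschitz_homeomorphism (linf_ball n) (l2_ball n) g}"

end

(*
Upper bound.  Put phi(t) = sinh(a t).  The norm of diag(phi'(x_i)) from l_infinity to l_2 is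
a sqrt(n + |phi(x)|^2), so x |-> phi(x) / sqrt(n + |phi(x)|^2), with phi applied to each coordinate,
is a-Lipschitz into the Euclidean ball.  Replacing n + |phi(x)|^2 by
n + |phi(x)|^2 - kappa |phi(x)|_infinity^2 with kappa = n / sinh(a)^2 carries the boundary of the cube
onto the sphere and costs only a factor 1 + 7 kappa / 4; the choice of a slightly larger than
arsinh(sqrt(n - 1)) makes kappa small.  A homeomorphism between the balls restricts to the spheres by
invariance of domain, whence lambda_n <= C_n.

Lower bound.  Let h be an L-Lipschitz homeomorphism of the spheres, extended to R^n by clipping
coordinates outside the cube and conically inside.  Let xi have independent two-sided exponential
coordinates of rate lam = ln n - ln ln n.  If E h(x + xi) = 0 for some x, then h(x + xi) has
variance about 1, because x + xi lies outside the cube with probability close to 1.  The Poincare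
inequality with constant 4 / lam^2 and the bound sum_i |d_i h|^2 <= L^2 (choose signs suitably) give
1 <= (4 / lam^2) L^2 up to o(1), that is L >= (1/2 - o(1)) ln n.  If E h(x + xi) never vanishes, this
map and the rescaling of the noise contract the sphere.  To avoid a differentiability theorem, xi is
a truncated two-sided geometric variable on a fine grid, and h is first averaged over small boxes.
*)
theory Submission
  imports Defs "HOL-Homology.Homology" "HOL-Real_Asymp.Real_Asymp"
begin

section \<open>Norms and topologies on \<open>Rn n\<close>\<close>

text \<open>Both halves meet at (ln n)/2 for a common reason: one coordinate of size 1 has to stand
  out among n. In the construction this asks for sinh(a)^2 of order n, so a is near (ln n)/2.
  Dually, a rate near ln n is the largest at which the maximum of n exponential coordinates still
  exceeds 1 with high probability, and a Poincare constant 4 / lam^2 turns into a bound of lam / 2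
  on L. The correction term of the upper bound uses the sup norm because that is constant on the
  boundary of the cube. The price is non-smoothness, so the Lipschitz estimate has to be made
  piecewise. In the lower bound the delicate point is the sum of squared partial differences. On a
  grid, moving n coordinates at once is a path of n single steps whose differences are based at
  different vertices. Box averages make these differences vary by a fraction of order 1/N only, so
  the total error is of order n/N. Truncation of the noise serves the topology: around centres far
  from the cube the noise never meets it, and the same variance inequality then excludes zeros at
  every noise level, not only at the full one.\<close>

lemma linf_norm_nonneg: "n \<ge> 1 \<Longrightarrow> 0 \<le> linf_norm n x"
  using abs_le_linf_norm[of 0 n x] by linarith

lemma linf_norm_attained:
  assumes "n \<ge> 1"
  obtains i where "i < n" "linf_norm n x = \<bar>x i\<bar>"
proof -
  have "linf_norm n x \<in> (\<lambda>i. \<bar>x i\<bar>) ` {..<n}"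
    unfolding linf_norm_def using assms by (intro Max_in) (auto simp: lessThan_empty_iff)
  then show thesis using that by auto
qed

lemma linf_norm_eqI:
  assumes "i < n" "\<bar>x i\<bar> = c" "\<And>j. j < n \<Longrightarrow> \<bar>x j\<bar> \<le> c"
  shows "linf_norm n x = c"
proof (rule antisym)
  show "linf_norm n x \<le> c" using assms linf_norm_le_iff[of n x c] by auto
  show "c \<le> linf_norm n x" using abs_le_linf_norm[of i n x] assms by auto
qed

lemma linf_norm_scale:
  assumes "n \<ge> 1"
  shows "linf_norm n (\<lambda>i. c * x i) = \<bar>c\<bar> * linf_norm n x"
proof -
  obtain i where "i < n" "linf_norm n x = \<bar>x i\<bar>" using linf_norm_attained assms by blast
  then show ?thesis
    using abs_le_linf_norm[of _ n x]
    by (intro linf_norm_eqI[of i]) (auto simp: abs_mult intro!: mult_left_mono)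
qed

lemma linf_norm_minus_commute: "linf_norm n (\<lambda>i. x i - y i) = linf_norm n (\<lambda>i. y i - x i)"
  by (simp add: linf_norm_def abs_minus_commute)

lemma linf_norm_triangle:
  assumes "n \<ge> 1"
  shows "linf_norm n x \<le> linf_norm n y + linf_norm n (\<lambda>i. x i - y i)"
  unfolding linf_norm_le_iff[OF assms]
proof (intro allI impI)
  fix i assume "i < n"
  then show "\<bar>x i\<bar> \<le> linf_norm n y + linf_norm n (\<lambda>i. x i - y i)"
    using abs_le_linf_norm[of i n y] abs_le_linf_norm[of i n "\<lambda>i. x i - y i"] by linarith
qed

lemma linf_norm_le_sum:
  assumes "n \<ge> 1"
  shows "linf_norm n x \<le> (\<Sum>i<n. \<bar>x i\<bar>)"
  using member_le_sum[of _ "{..<n}" "\<lambda>i. \<bar>x i\<bar>"] by (auto simp: linf_norm_le_iff[OF assms])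

lemma l2_norm_nonneg: "0 \<le> l2_norm n x"
  by (simp add: l2_norm_def)

lemma l2_norm_power2: "(l2_norm n x)\<^sup>2 = (\<Sum>i<n. (x i)\<^sup>2)"
  by (simp add: l2_norm_def L2_set_def sum_nonneg)

lemma l2_norm_cong: "(\<And>i. i < n \<Longrightarrow> x i = y i) \<Longrightarrow> l2_norm n x = l2_norm n y"
  unfolding l2_norm_def by (rule L2_set_cong) auto

lemma l2_norm_scale: "l2_norm n (\<lambda>i. c * x i) = \<bar>c\<bar> * l2_norm n x"
  by (simp add: l2_norm_def L2_set_def power_mult_distrib sum_distrib_left[symmetric] real_sqrt_mult)

lemma l2_norm_add: "l2_norm n (\<lambda>i. x i + y i) \<le> l2_norm n x + l2_norm n y"
  unfolding l2_norm_def by (rule L2_set_triangle_ineq)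

lemma l2_norm_minus_commute: "l2_norm n (\<lambda>i. x i - y i) = l2_norm n (\<lambda>i. y i - x i)"
  by (simp add: l2_norm_def L2_set_def power2_commute)

lemma l2_norm_diff: "l2_norm n (\<lambda>i. x i - y i) \<le> l2_norm n x + l2_norm n y"
  using l2_norm_add[of n x "\<lambda>i. - y i"] l2_norm_scale[of n "-1" y] by simp

lemma l2_norm_triangle: "l2_norm n x \<le> l2_norm n y + l2_norm n (\<lambda>i. x i - y i)"
  using l2_norm_add[of n y "\<lambda>i. x i - y i"] by simp

lemma l2_norm_sum:
  "finite S \<Longrightarrow> l2_norm n (\<lambda>i. \<Sum>s\<in>S. f s i) \<le> (\<Sum>s\<in>S. l2_norm n (f s))"
proof (induction S rule: finite_induct)
  case empty
  then show ?case by (simp add: l2_norm_def L2_set_def)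
next
  case (insert s S)
  then show ?case using l2_norm_add[of n "f s" "\<lambda>i. \<Sum>s\<in>S. f s i"] by simp
qed

lemma abs_le_l2_norm: "i < n \<Longrightarrow> \<bar>x i\<bar> \<le> l2_norm n x"
  unfolding l2_norm_def using member_le_L2_set[of "{..<n}" i "\<lambda>i. \<bar>x i\<bar>"]
  by (simp add: L2_set_def)

lemma l2_norm_le_sum: "l2_norm n x \<le> (\<Sum>i<n. \<bar>x i\<bar>)"
  unfolding l2_norm_def by (rule L2_set_le_sum_abs)

lemma linf_norm_le_l2_norm: "n \<ge> 1 \<Longrightarrow> linf_norm n x \<le> l2_norm n x"
  by (simp add: linf_norm_le_iff abs_le_l2_norm)

text \<open>One inclusion of topologies holds because coordinates are 1-Lipschitz for
  \<open>d\<close>, the other because the sum of coordinate differences is continuous for the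
  product topology. An abstract \<open>d\<close> serves both norms.\<close>

lemma mtopology_Rn:
  assumes M: "Metric_space (Rn n) d"
    and lower: "\<And>x y i. x \<in> Rn n \<Longrightarrow> y \<in> Rn n \<Longrightarrow> i < n \<Longrightarrow> \<bar>x i - y i\<bar> \<le> d x y"
    and upper: "\<And>x y. x \<in> Rn n \<Longrightarrow> y \<in> Rn n \<Longrightarrow> d x y \<le> (\<Sum>i<n. \<bar>x i - y i\<bar>)"
  shows "Metric_space.mtopology (Rn n) d = top_of_set (Rn n)"
proof -
  interpret Metric_space "Rn n" d by (rule M)
  have 1: "continuous_map (top_of_set (Rn n)) mtopology id"
    unfolding continuous_map_to_metric
  proof (intro ballI allI impI)
    fix x :: "nat \<Rightarrow> real" and e :: real assume x: "x \<in> topspace (top_of_set (Rn n))" and e: "e > 0"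
    let ?U = "{y \<in> Rn n. (\<Sum>i<n. \<bar>x i - y i\<bar>) < e}"
    have "open ((\<lambda>y. \<Sum>i<n. \<bar>x i - y i\<bar>) -` {..<e})"
      by (intro open_vimage continuous_intros) auto
    then have "openin (top_of_set (Rn n)) ?U"
      by (auto simp: openin_open intro!: exI[of _ "(\<lambda>y. \<Sum>i<n. \<bar>x i - y i\<bar>) -` {..<e}"])
    moreover have "x \<in> ?U" using x e by simp
    moreover have "\<forall>y\<in>?U. id y \<in> mball (id x) e"
      using upper x by (fastforce simp: in_mball)
    ultimately show "\<exists>U. openin (top_of_set (Rn n)) U \<and> x \<in> U \<and> (\<forall>y\<in>U. id y \<in> mball (id x) e)"
      by blast
  qed
  have coord: "continuous_map mtopology euclideanreal (\<lambda>x. x i)" for i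
  proof -
    have "Lipschitz_continuous_map (metric (Rn n, d)) euclidean_metric (\<lambda>x. x i)"
      unfolding Lipschitz_continuous_map_def
    proof (intro conjI exI[of _ 1] ballI)
      fix x y assume "x \<in> mspace (metric (Rn n, d))" "y \<in> mspace (metric (Rn n, d))"
      then have "x \<in> Rn n" "y \<in> Rn n" by auto
      then show "mdist euclidean_metric (x i) (y i) \<le> 1 * mdist (metric (Rn n, d)) x y"
        using lower[of x y i] M Metric_space.mdist_metric[OF M]
        by (cases "i < n") (auto simp: dist_real_def Rn_def)
    qed auto
    then show ?thesis
      using Lipschitz_continuous_imp_continuous_map by fastforce
  qed
  have 2: "continuous_map mtopology (top_of_set (Rn n)) id"
    unfolding continuous_map_in_subtopology
  proof
    show "continuous_map mtopology euclidean id"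
      unfolding euclidean_product_topology[symmetric] continuous_map_componentwise_UNIV
      using coord by simp
  qed auto
  show ?thesis
  proof (rule topology_eq[THEN iffD2], intro allI iffI)
    fix U
    { assume "openin mtopology U"
      then have "openin (top_of_set (Rn n)) {x \<in> topspace (top_of_set (Rn n)). id x \<in> U}"
        using 1 by (rule openin_continuous_map_preimage[rotated])
      moreover have "{x \<in> topspace (top_of_set (Rn n)). id x \<in> U} = U"
        using openin_subset[OF \<open>openin mtopology U\<close>] by auto
      ultimately show "openin (top_of_set (Rn n)) U" by simp }
    { assume "openin (top_of_set (Rn n)) U"
      then have "openin mtopology {x \<in> topspace mtopology. id x \<in> U}"
        using 2 by (rule openin_continuous_map_preimage[rotated])
      moreover have "{x \<in> topspace mtopology. id x \<in> U} = U"
        using openin_subset[OF \<open>openin (top_of_set (Rn n)) U\<close>] by auto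
      ultimately show "openin mtopology U" by simp }
  qed
qed

lemma mtopology_l2_metric: "mtopology_of (l2_metric n) = top_of_set (Rn n)"
proof -
  interpret Metric_space "Rn n" "\<lambda>x y. l2_norm n (\<lambda>i. x i - y i)" by (rule Metric_space_l2)
  show ?thesis
    unfolding l2_metric_def mtopology_of
    by (rule mtopology_Rn[OF Metric_space_l2]) (use abs_le_l2_norm l2_norm_le_sum in auto)
qed

lemma mtopology_linf_metric:
  assumes "n \<ge> 1"
  shows "mtopology_of (linf_metric n) = top_of_set (Rn n)"
proof -
  interpret Metric_space "Rn n" "\<lambda>x y. linf_norm n (\<lambda>i. x i - y i)" using assms by (rule Metric_space_linf)
  show ?thesis
    unfolding linf_metric_def mtopology_of
    by (rule mtopology_Rn[OF Metric_space_linf[OF assms]]) 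
      (use abs_le_linf_norm linf_norm_le_sum[OF assms] in auto)
qed

lemma mtopology_l2_ball: "mtopology_of (l2_ball n) = top_of_set {x \<in> Rn n. l2_norm n x \<le> 1}"
  by (auto simp: l2_ball_def mtopology_of_submetric mtopology_l2_metric subtopology_subtopology
      intro!: arg_cong[where f = top_of_set])

lemma mtopology_l2_sphere: "mtopology_of (l2_sphere n) = top_of_set {x \<in> Rn n. l2_norm n x = 1}"
  by (auto simp: l2_sphere_def mtopology_of_submetric mtopology_l2_metric subtopology_subtopology
      intro!: arg_cong[where f = top_of_set])

lemma mtopology_linf_ball:
  "n \<ge> 1 \<Longrightarrow> mtopology_of (linf_ball n) = top_of_set {x \<in> Rn n. linf_norm n x \<le> 1}"
  by (auto simp: linf_ball_def mtopology_of_submetric mtopology_linf_metric subtopology_subtopology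
      intro!: arg_cong[where f = top_of_set])

lemma mtopology_linf_sphere:
  "n \<ge> 1 \<Longrightarrow> mtopology_of (linf_sphere n) = top_of_set {x \<in> Rn n. linf_norm n x = 1}"
  by (auto simp: linf_sphere_def mtopology_of_submetric mtopology_linf_metric subtopology_subtopology
      intro!: arg_cong[where f = top_of_set])

lemma Euclidean_space_eq: "Euclidean_space n = top_of_set (Rn n)"
  by (simp add: Euclidean_space_def Rn_def euclidean_product_topology)

lemma nsphere_eq:
  assumes "n \<ge> 1"
  shows "nsphere (n - 1) = top_of_set {x \<in> Rn n. l2_norm n x = 1}"
proof -
  have "l2_norm n x = 1 \<longleftrightarrow> (\<Sum>i\<le>n-1. (x i)\<^sup>2) = 1" for x
  proof -
    have "{..n-1} = {..<n}" using assms by auto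
    then show ?thesis
      by (simp add: l2_norm_power2[symmetric] l2_norm_nonneg)
         (smt (verit) l2_norm_nonneg power2_eq_1_iff)
  qed
  moreover have "n - 1 + 1 = n" using assms by simp
  ultimately show ?thesis
    by (auto simp: nsphere euclidean_product_topology Rn_def Euclidean_space_def subtopology_subtopology
      intro!: arg_cong[where f = top_of_set])
qed

lemma continuous_on_linf_norm:
  assumes "n \<ge> 1" and f: "\<And>i. i < n \<Longrightarrow> continuous_on S (\<lambda>x. f x i)"
  shows "continuous_on S (\<lambda>x. linf_norm n (f x))"
  unfolding continuous_on_def
proof
  fix x assume x: "x \<in> S"
  have "((\<lambda>y. \<Sum>i<n. \<bar>f y i - f x i\<bar>) \<longlongrightarrow> (\<Sum>i<n. \<bar>f x i - f x i\<bar>)) (at x within S)"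
    using f x by (intro tendsto_intros) (auto simp: continuous_on_def)
  then have lim: "((\<lambda>y. \<Sum>i<n. \<bar>f y i - f x i\<bar>) \<longlongrightarrow> 0) (at x within S)" by simp
  have "((\<lambda>y. linf_norm n (f y) - linf_norm n (f x)) \<longlongrightarrow> 0) (at x within S)"
  proof (rule Lim_null_comparison[OF _ lim])
    show "\<forall>\<^sub>F y in at x within S. norm (linf_norm n (f y) - linf_norm n (f x)) \<le> (\<Sum>i<n. \<bar>f y i - f x i\<bar>)"
    proof (intro always_eventually allI)
      fix y
      show "norm (linf_norm n (f y) - linf_norm n (f x)) \<le> (\<Sum>i<n. \<bar>f y i - f x i\<bar>)"
        using linf_norm_triangle[OF assms(1), of "f x" "f y"] linf_norm_triangle[OF assms(1), of "f y" "f x"]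
          linf_norm_le_sum[OF assms(1), of "\<lambda>i. f y i - f x i"] linf_norm_minus_commute[of n "f x" "f y"]
        by (simp add: real_norm_def)
    qed
  qed
  then show "((\<lambda>y. linf_norm n (f y)) \<longlongrightarrow> linf_norm n (f x)) (at x within S)"
    by (simp add: LIM_zero_iff)
qed

lemma continuous_on_l2_norm:
  assumes "\<And>i. i < n \<Longrightarrow> continuous_on S (\<lambda>x. f x i)"
  shows "continuous_on S (\<lambda>x. l2_norm n (f x))"
  unfolding l2_norm_def L2_set_def using assms by (intro continuous_intros) auto

section \<open>Lipschitz constants, and restriction to the spheres\<close>

text \<open>The two distinct points make the set of difference quotients nonempty, so that an upper
  bound of the quotients bounds their supremum.\<close>

lemma Lip_le:
  assumes "u \<in> mspace X" "v \<in> mspace X" "u \<noteq> v"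
    and le: "\<And>x y. x \<in> mspace X \<Longrightarrow> y \<in> mspace X \<Longrightarrow> mdist Y (f x) (f y) \<le> L * mdist X x y"
  shows "Lip X Y f \<le> L"
  unfolding Lip_def
proof (rule cSUP_least)
  show "{(x, y). x \<in> mspace X \<and> y \<in> mspace X \<and> x \<noteq> y} \<noteq> {}" using assms by auto
  show "(case p of (x, y) \<Rightarrow> mdist Y (f x) (f y) / mdist X x y) \<le> L"
    if pA: "p \<in> {(x, y). x \<in> mspace X \<and> y \<in> mspace X \<and> x \<noteq> y}" for p
  proof -
    obtain x y where p: "p = (x, y)" "x \<in> mspace X" "y \<in> mspace X" "x \<noteq> y"
      using pA by (cases p) auto
    then have "mdist X x y > 0"
      by (metis mdist_nonneg mdist_zero order_less_le)
    then show ?thesis using le[of x y] p by (simp add: divide_le_eq)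
  qed
qed

text \<open>The quotients of a Lipschitz map are bounded, so the real supremum \<open>Lip\<close> is
  itself a Lipschitz constant. At coinciding points, which have no quotient, both sides are
  0.\<close>

lemma mdist_le_Lip:
  assumes f: "Lipschitz_continuous_map X Y f" and "x \<in> mspace X" "y \<in> mspace X"
  shows "mdist Y (f x) (f y) \<le> Lip X Y f * mdist X x y"
proof (cases "x = y")
  case True
  have "f y \<in> mspace Y" using f assms(3) by (auto simp: Lipschitz_continuous_map_def)
  then show ?thesis using True assms(3) by (simp del: mdist_zero add: mdist_zero[THEN iffD2])
next
  case False
  let ?A = "{(x, y). x \<in> mspace X \<and> y \<in> mspace X \<and> x \<noteq> y}"
  let ?F = "\<lambda>(x, y). mdist Y (f x) (f y) / mdist X x y"
  obtain B where B: "\<And>x y. x \<in> mspace X \<Longrightarrow> y \<in> mspace X \<Longrightarrow> mdist Y (f x) (f y) \<le> B * mdist X x y"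
    using f by (auto simp: Lipschitz_continuous_map_def)
  have pos: "mdist X x y > 0" if "x \<in> mspace X" "y \<in> mspace X" "x \<noteq> y" for x y
    using that by (metis mdist_nonneg mdist_zero order_less_le)
  have "bdd_above (?F ` ?A)"
    by (rule bdd_aboveI2[of _ _ B]) (use B pos in \<open>auto simp: divide_le_eq\<close>)
  then have "?F (x, y) \<le> Lip X Y f"
    unfolding Lip_def using False assms by (intro cSUP_upper) auto
  then show ?thesis using pos[OF assms(2,3) False] by (simp add: divide_le_eq)
qed

lemma Lip_nonneg:
  assumes "Lipschitz_continuous_map X Y f" "u \<in> mspace X" "v \<in> mspace X" "u \<noteq> v"
  shows "0 \<le> Lip X Y f"
proof -
  have "mdist X u v > 0"
    using assms by (metis mdist_nonneg mdist_zero order_less_le)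
  moreover have "0 \<le> Lip X Y f * mdist X u v"
    using mdist_le_Lip[OF assms(1-3)] by (meson mdist_nonneg order_trans)
  ultimately show ?thesis by (simp add: zero_le_mult_iff)
qed

lemma linf_sphere_two_points:
  assumes "n \<ge> 1"
  obtains u v where "u \<in> mspace (linf_sphere n)" "v \<in> mspace (linf_sphere n)" "u \<noteq> v"
    "u \<in> mspace (linf_ball n)" "v \<in> mspace (linf_ball n)"
proof -
  define e where "e c = (\<lambda>i::nat. if i = 0 then c else (0::real))" for c
  have "linf_norm n (e c) = \<bar>c\<bar>" for c
    by (rule linf_norm_eqI[of 0]) (use assms in \<open>auto simp: e_def\<close>)
  moreover have "e c \<in> Rn n" for c using assms by (auto simp: e_def Rn_def)
  moreover have "e 1 \<noteq> e (-1)" by (auto simp: e_def fun_eq_iff)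
  ultimately show thesis using that[of "e 1" "e (-1)"] assms by auto
qed

section \<open>Restricting a homeomorphism of the balls to the spheres\<close>

lemma Rn_scale: "x \<in> Rn n \<Longrightarrow> (\<lambda>i. c * x i) \<in> Rn n"
  by (simp add: Rn_def)

text \<open>An open subset of \<open>Rn n\<close> inside a unit ball avoids the sphere: dilate a boundary point.\<close>
lemma openin_Rn_subset_ball:
  assumes "openin (top_of_set (Rn n)) V"
    and scale: "\<And>c x. N (\<lambda>i. c * x i) = \<bar>c\<bar> * N x"
    and sub: "\<And>x. x \<in> V \<Longrightarrow> N x \<le> (1::real)"
    and x: "x \<in> V"
  shows "N x < 1"
proof (rule ccontr)
  assume "\<not> N x < 1"
  then have N1: "N x = 1" using sub[OF x] by simp
  obtain T where T: "open T" "V = Rn n \<inter> T"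
    using assms(1) by (auto simp: openin_open)
  have "continuous_on UNIV (\<lambda>c::real. (\<lambda>i. c * x i))"
    by (intro continuous_on_coordinatewise_then_product continuous_intros)
  then have "open ((\<lambda>c::real. (\<lambda>i. c * x i)) -` T)"
    using T(1) by (rule open_vimage[rotated])
  moreover have "1 \<in> (\<lambda>c::real. (\<lambda>i. c * x i)) -` T" using x T by simp
  ultimately obtain e where e: "e > 0" "ball 1 e \<subseteq> (\<lambda>c::real. (\<lambda>i. c * x i)) -` T"
    by (meson openE)
  have "1 + e/2 \<in> ball 1 e" using e by (simp add: dist_real_def)
  then have "(\<lambda>i. (1 + e/2) * x i) \<in> V"
    using e(2) T x Rn_scale by blast
  then have "\<bar>1 + e/2\<bar> * N x \<le> 1" using sub scale by metis
  then show False using N1 e by simp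
qed

text \<open>By invariance of domain the image of the open \<open>N1\<close>-ball is open in
  \<open>Rn n\<close>; lying in the closed \<open>N2\<close>-ball, it avoids the
  \<open>N2\<close>-sphere. The two gauges are abstract because the argument is applied to a
  homeomorphism and to its inverse.\<close>

lemma homeomorphism_unit_balls_interior:
  assumes g: "homeomorphism {x \<in> Rn n. N1 x \<le> 1} {x \<in> Rn n. N2 x \<le> 1} g k"
    and scale: "\<And>c x. N2 (\<lambda>i. c * x i) = \<bar>c\<bar> * N2 x"
    and cont: "continuous_on UNIV N1"
    and x: "x \<in> Rn n" "N1 x < (1::real)"
  shows "N2 (g x) < (1::real)"
proof -
  let ?U = "{x \<in> Rn n. N1 x < 1}"
  have "open (N1 -` {..<1})" using cont by (intro open_vimage) auto
  then have U: "openin (Euclidean_space n) ?U"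
    unfolding Euclidean_space_eq openin_open by (intro exI[of _ "N1 -` {..<1}"]) auto
  have sub: "?U \<subseteq> {x \<in> Rn n. N1 x \<le> 1}" by auto
  have gU: "g ` ?U \<subseteq> {x \<in> Rn n. N2 x \<le> 1}" using g by (force simp: homeomorphism_def)
  have "continuous_on ?U g" using g sub by (auto simp: homeomorphism_def intro: continuous_on_subset)
  then have "continuous_map (subtopology (Euclidean_space n) ?U) (Euclidean_space n) g"
    unfolding Euclidean_space_eq subtopology_subtopology using gU
    by (auto simp: continuous_map_in_subtopology intro: continuous_on_subset)
  moreover have "inj_on g ?U"
    using g sub by (intro inj_on_inverseI[of _ k]) (auto simp: homeomorphism_def)
  ultimately have "openin (top_of_set (Rn n)) (g ` ?U)"
    using invariance_of_domain_Euclidean_space[OF U] by (simp add: Euclidean_space_eq)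
  then show ?thesis
    by (rule openin_Rn_subset_ball[of n _ N2]) (use scale gU x in auto)
qed

lemma homeomorphic_map_top_of_set:
  "homeomorphic_map (top_of_set S) (top_of_set T) f \<longleftrightarrow> (\<exists>g. homeomorphism S T f g)"
proof -
  have "homeomorphic_maps (top_of_set S) (top_of_set T) f g \<longleftrightarrow> homeomorphism S T f g" for g
  proof
    assume "homeomorphic_maps (top_of_set S) (top_of_set T) f g"
    then show "homeomorphism S T f g"
      by (intro homeomorphismI) (auto simp: homeomorphic_maps_def continuous_map_in_subtopology)
  next
    assume h: "homeomorphism S T f g"
    then have "f ` S = T" "g ` T = S" by (auto simp: homeomorphism_def)
    then show "homeomorphic_maps (top_of_set S) (top_of_set T) f g"
      using h unfolding homeomorphic_maps_def continuous_map_in_subtopology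
      by (auto simp: homeomorphism_def)
  qed
  then show ?thesis by (simp add: homeomorphic_map_maps)
qed

lemma continuous_on_linf_norm_UNIV: "n \<ge> 1 \<Longrightarrow> continuous_on UNIV (linf_norm n)"
  using continuous_on_linf_norm[of n UNIV "\<lambda>x. x"] by (simp add: continuous_on_product_coordinates)

lemma continuous_on_l2_norm_UNIV: "continuous_on UNIV (l2_norm n)"
  using continuous_on_l2_norm[of n UNIV "\<lambda>x. x"] by (simp add: continuous_on_product_coordinates)

text \<open>Interior points go to interior points under \<open>g\<close> and under its inverse, so
  the spheres correspond. Distances on a sphere are those of its ball, hence the constant cannot
  grow.\<close>

lemma Lipschitz_homeomorphism_sphere:
  assumes n: "n \<ge> 1" and g: "Lipschitz_homeomorphism (linf_ball n) (l2_ball n) g"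
  shows "Lipschitz_homeomorphism (linf_sphere n) (l2_sphere n) g"
    and "Lip (linf_sphere n) (l2_sphere n) g \<le> Lip (linf_ball n) (l2_ball n) g"
proof -
  let ?B1 = "{x \<in> Rn n. linf_norm n x \<le> 1}" and ?B2 = "{x \<in> Rn n. l2_norm n x \<le> 1}"
  let ?S1 = "{x \<in> Rn n. linf_norm n x = 1}" and ?S2 = "{x \<in> Rn n. l2_norm n x = 1}"
  have gL: "Lipschitz_continuous_map (linf_ball n) (l2_ball n) g"
    using g by (simp add: Lipschitz_homeomorphism_def)
  obtain k where k: "homeomorphism ?B1 ?B2 g k"
    using g by (auto simp: Lipschitz_homeomorphism_def mtopology_linf_ball[OF n] mtopology_l2_ball
        homeomorphic_map_top_of_set)
  have in1: "l2_norm n (g x) < 1" if "x \<in> Rn n" "linf_norm n x < 1" for x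
    by (rule homeomorphism_unit_balls_interior[OF k]) (use that continuous_on_linf_norm_UNIV[OF n] in \<open>auto simp: l2_norm_scale\<close>)
  have in2: "linf_norm n (k z) < 1" if "z \<in> Rn n" "l2_norm n z < 1" for z
    by (rule homeomorphism_unit_balls_interior[OF homeomorphism_symD[OF k]])
       (rule linf_norm_scale[OF n] continuous_on_l2_norm_UNIV that)+
  have "g ` ?S1 = ?S2"
  proof (intro equalityI subsetI)
    fix z assume "z \<in> g ` ?S1"
    then obtain x where x: "x \<in> ?S1" "z = g x" by auto
    then have "z \<in> ?B2" "k z = x" using k by (auto simp: homeomorphism_def)
    moreover have "\<not> l2_norm n z < 1" using in2[of z] x \<open>k z = x\<close> \<open>z \<in> ?B2\<close> by auto
    ultimately show "z \<in> ?S2" by auto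
  next
    fix z assume z: "z \<in> ?S2"
    then have "k z \<in> ?B1" "g (k z) = z" using k by (force simp: homeomorphism_def)+
    moreover have "\<not> linf_norm n (k z) < 1" using in1[of "k z"] z \<open>k z \<in> ?B1\<close> \<open>g (k z) = z\<close> by auto
    ultimately have "k z \<in> ?S1" by auto
    then show "z \<in> g ` ?S1" using \<open>g (k z) = z\<close> by force
  qed
  then have hS: "homeomorphism ?S1 ?S2 g k"
    by (intro homeomorphism_of_subsets[OF k, where T''="{}"]) auto
  have LS: "mdist (l2_sphere n) (g x) (g y) \<le> Lip (linf_ball n) (l2_ball n) g * mdist (linf_sphere n) x y"
    if "x \<in> mspace (linf_sphere n)" "y \<in> mspace (linf_sphere n)" for x y
    using mdist_le_Lip[OF gL, of x y] that n by simp
  then have "Lipschitz_continuous_map (linf_sphere n) (l2_sphere n) g"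
    unfolding Lipschitz_continuous_map_def using \<open>g ` ?S1 = ?S2\<close> n by auto
  moreover have "homeomorphic_map (mtopology_of (linf_sphere n)) (mtopology_of (l2_sphere n)) g"
    using hS by (auto simp: mtopology_linf_sphere[OF n] mtopology_l2_sphere homeomorphic_map_top_of_set)
  ultimately show "Lipschitz_homeomorphism (linf_sphere n) (l2_sphere n) g"
    by (simp add: Lipschitz_homeomorphism_def)
  obtain u v where "u \<in> mspace (linf_sphere n)" "v \<in> mspace (linf_sphere n)" "u \<noteq> v"
    by (rule linf_sphere_two_points[OF n])
  then show "Lip (linf_sphere n) (l2_sphere n) g \<le> Lip (linf_ball n) (l2_ball n) g"
    using LS by (rule Lip_le)
qed

lemma Lip_sphere_nonneg:
  assumes "n \<ge> 1" "Lipschitz_homeomorphism (linf_sphere n) (l2_sphere n) h"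
  shows "0 \<le> Lip (linf_sphere n) (l2_sphere n) h"
  by (rule linf_sphere_two_points[OF assms(1)])
     (use assms(2) Lip_nonneg in \<open>auto simp: Lipschitz_homeomorphism_def\<close>)

lemma sphere_const_le:
  assumes "n \<ge> 1" "Lipschitz_homeomorphism (linf_sphere n) (l2_sphere n) h"
  shows "sphere_const n \<le> Lip (linf_sphere n) (l2_sphere n) h"
  unfolding sphere_const_def
  by (rule cInf_lower) (use assms Lip_sphere_nonneg in \<open>auto intro!: bdd_belowI[of _ 0]\<close>)

lemma ball_const_le:
  assumes "n \<ge> 1" "Lipschitz_homeomorphism (linf_ball n) (l2_ball n) g"
  shows "ball_const n \<le> Lip (linf_ball n) (l2_ball n) g"
  unfolding ball_const_def
proof (rule cInf_lower)
  show "bdd_below {Lip (linf_ball n) (l2_ball n) g |g. Lipschitz_homeomorphism (linf_ball n) (l2_ball n) g}"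
    using Lip_sphere_nonneg[OF assms(1)] Lipschitz_homeomorphism_sphere[OF assms(1)]
    by (auto intro!: bdd_belowI[of _ 0] intro: order_trans)
qed (use assms in auto)

text \<open>Every competitor for the balls restricts to one for the spheres. The existence
  hypothesis keeps the infimum on the right from being taken over the empty set.\<close>

lemma sphere_const_le_ball_const:
  assumes "n \<ge> 1" "Lipschitz_homeomorphism (linf_ball n) (l2_ball n) g"
  shows "sphere_const n \<le> ball_const n"
  unfolding ball_const_def
proof (rule cInf_greatest)
  fix c assume "c \<in> {Lip (linf_ball n) (l2_ball n) g |g. Lipschitz_homeomorphism (linf_ball n) (l2_ball n) g}"
  then obtain f where "Lipschitz_homeomorphism (linf_ball n) (l2_ball n) f" "c = Lip (linf_ball n) (l2_ball n) f"
    by auto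
  then show "sphere_const n \<le> c"
    using Lipschitz_homeomorphism_sphere[OF assms(1)] sphere_const_le[OF assms(1)] by (metis order_trans)
qed (use assms in auto)

section \<open>A homeomorphism from the cube onto the ball\<close>

lemma sum_mult_le_l2_norm: "\<bar>\<Sum>i<n. u i * w i\<bar> \<le> l2_norm n u * l2_norm n w"
proof -
  have "\<bar>\<Sum>i<n. u i * w i\<bar> \<le> (\<Sum>i<n. \<bar>u i\<bar> * \<bar>w i\<bar>)"
    by (rule order_trans[OF sum_abs]) (simp add: abs_mult)
  also have "\<dots> \<le> l2_norm n u * l2_norm n w"
    unfolding l2_norm_def by (rule L2_set_mult_ineq)
  finally show ?thesis .
qed

text \<open>The left side pairs \<open>u\<close> with \<open>(I - p p^T) w\<close>, and
  \<open>I - p p^T\<close> is a contraction when \<open>p\<close> has norm at most 1. This form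
  arises when a vector divided by its norm is differentiated.\<close>

lemma inner_projection_le:
  assumes p: "l2_norm n p \<le> 1"
  shows "\<bar>(\<Sum>i<n. u i * w i) - (\<Sum>i<n. u i * p i) * (\<Sum>i<n. p i * w i)\<bar> \<le> l2_norm n u * l2_norm n w"
proof -
  define c where "c = (\<Sum>i<n. p i * w i)"
  have "(\<Sum>i<n. u i * w i) - (\<Sum>i<n. u i * p i) * c = (\<Sum>i<n. u i * (w i - c * p i))"
    unfolding sum_distrib_right sum_subtractf[symmetric] by (rule sum.cong) (auto simp: algebra_simps)
  then have "\<bar>(\<Sum>i<n. u i * w i) - (\<Sum>i<n. u i * p i) * c\<bar> \<le> l2_norm n u * l2_norm n (\<lambda>i. w i - c * p i)"
    using sum_mult_le_l2_norm[of u "\<lambda>i. w i - c * p i" n] by simp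
  also have "\<dots> \<le> l2_norm n u * l2_norm n w"
  proof (intro mult_left_mono l2_norm_nonneg)
    have "(l2_norm n (\<lambda>i. w i - c * p i))\<^sup>2 = (\<Sum>i<n. (w i)\<^sup>2 - (2 * c) * (p i * w i) + c\<^sup>2 * (p i)\<^sup>2)"
      unfolding l2_norm_power2 by (rule sum.cong) (auto simp: power2_eq_square algebra_simps)
    also have "\<dots> = (l2_norm n w)\<^sup>2 - 2 * c * c + c\<^sup>2 * (l2_norm n p)\<^sup>2"
      by (simp only: sum.distrib sum_subtractf sum_distrib_left[symmetric] c_def l2_norm_power2)
    also have "\<dots> \<le> (l2_norm n w)\<^sup>2 - 2 * c * c + c\<^sup>2 * 1"
      using p by (intro add_left_mono mult_left_mono) (auto simp: power_le_one l2_norm_nonneg)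
    also have "\<dots> \<le> (l2_norm n w)\<^sup>2" by (simp add: power2_eq_square)
    finally show "l2_norm n (\<lambda>i. w i - c * p i) \<le> l2_norm n w"
      using l2_norm_nonneg by (rule power2_le_imp_le)
  qed
  finally show ?thesis by (simp add: c_def)
qed

text \<open>The condition \<open>big\<close> says that \<open>\<kappa> \<le> 1\<close>, which keeps
  the quantity under the root in \<open>rad\<close> at least \<open>n\<close>. The value of
  \<open>\<kappa>\<close> makes \<open>n\<close> and
  \<open>\<kappa> * (linf_norm n y)\<^sup>2\<close> cancel when \<open>y\<close> has sup norm
  \<open>sinh a\<close>.\<close>

locale sinh_map =
  fixes n :: nat and a \<kappa> :: real
  assumes n: "n \<ge> 2" and a: "a > 0" and big: "real n \<le> (sinh a)\<^sup>2"
  defines "\<kappa> \<equiv> real n / (sinh a)\<^sup>2"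
begin

text \<open>The radial factor is chosen so that \<open>y / rad y\<close> maps the sphere \<open>linf_norm n y = sinh a\<close>
  onto the Euclidean unit sphere.\<close>
definition rad :: "(nat \<Rightarrow> real) \<Rightarrow> real"
  where "rad y = sqrt (real n + (l2_norm n y)\<^sup>2 - \<kappa> * (linf_norm n y)\<^sup>2)"

definition cube_to_ball :: "(nat \<Rightarrow> real) \<Rightarrow> nat \<Rightarrow> real"
  where "cube_to_ball x = (\<lambda>i. sinh (a * x i) / rad (\<lambda>i. sinh (a * x i)))"

text \<open>Solving \<open>y / rad y = z\<close> with \<open>y = c * z\<close> gives
  \<open>c\<^sup>2 = n + c\<^sup>2 * (1 - co_rad z)\<close>, hence
  \<open>c\<^sup>2 = n / co_rad z\<close>: the inverse map is explicit.\<close>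

definition co_rad :: "(nat \<Rightarrow> real) \<Rightarrow> real"
  where "co_rad z = 1 - (l2_norm n z)\<^sup>2 + \<kappa> * (linf_norm n z)\<^sup>2"

definition ball_to_cube :: "(nat \<Rightarrow> real) \<Rightarrow> nat \<Rightarrow> real"
  where "ball_to_cube z = (\<lambda>i. arsinh (sqrt (real n) / sqrt (co_rad z) * z i) / a)"

lemma n1: "n \<ge> 1" using n by simp

lemma sinh_a: "sinh a > 0" using a by simp

lemma kappa: "0 < \<kappa>" "\<kappa> \<le> 1" "\<kappa> * (sinh a)\<^sup>2 = real n"
  using n big sinh_a by (auto simp: \<kappa>_def divide_le_eq)

lemma kappa_le: "\<bar>t\<bar> \<le> sinh a \<Longrightarrow> \<kappa> * t\<^sup>2 \<le> real n"
  using kappa sinh_a by (metis abs_le_square_iff abs_of_pos mult_left_mono less_imp_le)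

lemma rad_arg_ge: "real n \<le> real n + (l2_norm n y)\<^sup>2 - \<kappa> * (linf_norm n y)\<^sup>2"
proof -
  have "\<kappa> * (linf_norm n y)\<^sup>2 \<le> 1 * (l2_norm n y)\<^sup>2"
    using kappa linf_norm_nonneg[OF n1] linf_norm_le_l2_norm[OF n1] by (intro mult_mono power_mono) auto
  then show ?thesis by simp
qed

lemma rad_pos: "rad y > 0"
  unfolding rad_def using rad_arg_ge[of y] n by (intro real_sqrt_gt_zero) linarith

lemma rad_power2: "(rad y)\<^sup>2 = real n + (l2_norm n y)\<^sup>2 - \<kappa> * (linf_norm n y)\<^sup>2"
  unfolding rad_def using rad_arg_ge[of y] n by (intro real_sqrt_pow2) linarith

lemma linf_norm_sinh: "linf_norm n (\<lambda>i. sinh (a * x i)) = sinh (a * linf_norm n x)"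
proof -
  have abs_sinh: "\<bar>sinh (a * t)\<bar> = sinh (a * \<bar>t\<bar>)" for t
    using a by (simp add: abs_mult flip: sinh_real_abs)
  obtain i where i: "i < n" "linf_norm n x = \<bar>x i\<bar>" using linf_norm_attained[OF n1] by blast
  show ?thesis
    using a abs_le_linf_norm[of _ n x] by (intro linf_norm_eqI[OF i(1)]) (auto simp: abs_sinh i(2))
qed

lemma l2_norm_cube_to_ball:
  "l2_norm n (cube_to_ball x) = l2_norm n (\<lambda>i. sinh (a * x i)) / rad (\<lambda>i. sinh (a * x i))"
  using l2_norm_scale[of n "1 / rad (\<lambda>i. sinh (a * x i))" "\<lambda>i. sinh (a * x i)"] rad_pos[of "\<lambda>i. sinh (a * x i)"]
  by (simp add: cube_to_ball_def)

lemma linf_norm_cube_to_ball: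
  "linf_norm n (cube_to_ball x) = linf_norm n (\<lambda>i. sinh (a * x i)) / rad (\<lambda>i. sinh (a * x i))"
  using linf_norm_scale[OF n1, of "1 / rad (\<lambda>i. sinh (a * x i))" "\<lambda>i. sinh (a * x i)"] rad_pos[of "\<lambda>i. sinh (a * x i)"]
  by (simp add: cube_to_ball_def)

text \<open>\<open>l2_norm n y \<le> rad y\<close> amounts to
  \<open>\<kappa> * (linf_norm n y)\<^sup>2 \<le> n\<close>, that is, to \<open>y\<close> having sup
  norm at most \<open>sinh a\<close>; equality corresponds to the boundary of the cube.\<close>

lemma cube_to_ball_in:
  assumes "x \<in> Rn n" "linf_norm n x \<le> 1"
  shows "cube_to_ball x \<in> Rn n" "l2_norm n (cube_to_ball x) \<le> 1"
proof -
  show "cube_to_ball x \<in> Rn n" using assms(1) by (simp add: cube_to_ball_def Rn_def)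
  let ?y = "\<lambda>i. sinh (a * x i)"
  have "a * linf_norm n x \<le> a" using assms(2) a by simp
  then have "\<kappa> * (linf_norm n ?y)\<^sup>2 \<le> real n"
    using linf_norm_nonneg[OF n1, of x] a by (intro kappa_le) (simp add: linf_norm_sinh)
  then have "(l2_norm n ?y)\<^sup>2 \<le> (rad ?y)\<^sup>2" by (simp add: rad_power2)
  then have "l2_norm n ?y \<le> rad ?y" by (rule power2_le_imp_le) (rule less_imp_le[OF rad_pos])
  then show "l2_norm n (cube_to_ball x) \<le> 1" using rad_pos[of ?y] by (simp add: l2_norm_cube_to_ball)
qed

text \<open>On the unit sphere the first two terms cancel and only the \<open>\<kappa>\<close> term
  is left; it is positive because \<open>z\<close> is not zero on the coordinates below
  \<open>n\<close>.\<close>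

lemma co_rad_pos:
  assumes "l2_norm n z \<le> 1"
  shows "co_rad z > 0"
proof (cases "linf_norm n z = 0")
  case True
  then have "z i = 0" if "i < n" for i using abs_le_linf_norm[OF that, of z] by simp
  then have "l2_norm n z = 0" by (simp add: l2_norm_def L2_set_def)
  then show ?thesis using True by (simp add: co_rad_def)
next
  case False
  then have "0 < \<kappa> * (linf_norm n z)\<^sup>2" using kappa by simp
  moreover have "(l2_norm n z)\<^sup>2 \<le> 1" using assms by (simp add: power_le_one l2_norm_nonneg)
  ultimately show ?thesis by (simp add: co_rad_def)
qed

lemma ball_to_cube_in:
  assumes "z \<in> Rn n" "l2_norm n z \<le> 1"
  shows "ball_to_cube z \<in> Rn n" "linf_norm n (ball_to_cube z) \<le> 1"
proof -
  show "ball_to_cube z \<in> Rn n" using assms(1) by (simp add: ball_to_cube_def Rn_def)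
  show "linf_norm n (ball_to_cube z) \<le> 1"
    unfolding linf_norm_le_iff[OF n1]
  proof (intro allI impI)
    fix i assume i: "i < n"
    let ?t = "sqrt (real n) / sqrt (co_rad z) * z i"
    have pos: "co_rad z > 0" by (rule co_rad_pos[OF assms(2)])
    have "\<kappa> * (z i)\<^sup>2 \<le> \<kappa> * (linf_norm n z)\<^sup>2"
      using abs_le_linf_norm[OF i, of z] kappa by (intro mult_left_mono) (auto simp: abs_le_square_iff[symmetric])
    also have "\<dots> \<le> co_rad z" using assms(2) by (simp add: co_rad_def power_le_one l2_norm_nonneg)
    finally have "real n * (z i)\<^sup>2 \<le> (sinh a)\<^sup>2 * co_rad z"
      using sinh_a by (simp add: \<kappa>_def field_simps)
    then have "?t\<^sup>2 \<le> (sinh a)\<^sup>2"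
      using pos by (simp add: power_mult_distrib power_divide divide_le_eq)
    then have "\<bar>?t\<bar> \<le> sinh a" using sinh_a by (simp add: abs_le_square_iff[symmetric])
    moreover have "arsinh t \<le> a" if "t \<le> sinh a" for t
      using that arsinh_less_iff_real[of "sinh a" t] by (simp add: arsinh_sinh_real not_less[symmetric] del: arsinh_less_iff_real)
    note this[of ?t] this[of "- ?t"]
    ultimately have "\<bar>arsinh ?t\<bar> \<le> a" unfolding arsinh_minus_real by linarith
    then show "\<bar>ball_to_cube z i\<bar> \<le> 1" using a by (simp add: ball_to_cube_def)
  qed
qed

lemma ball_to_cube_to_ball:
  assumes "l2_norm n z \<le> 1"
  shows "cube_to_ball (ball_to_cube z) = z"
proof -
  define c where "c = sqrt (real n) / sqrt (co_rad z)"
  have pos: "co_rad z > 0" by (rule co_rad_pos[OF assms])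
  then have c: "c > 0" using n by (simp add: c_def)
  have c2: "c\<^sup>2 = real n / co_rad z" using pos by (simp add: c_def power_divide)
  have y: "sinh (a * ball_to_cube z i) = c * z i" for i
    using a by (simp add: ball_to_cube_def c_def)
  have "(rad (\<lambda>i. c * z i))\<^sup>2 = real n + c\<^sup>2 * ((l2_norm n z)\<^sup>2 - \<kappa> * (linf_norm n z)\<^sup>2)"
    by (simp add: rad_power2 l2_norm_scale linf_norm_scale[OF n1] power_mult_distrib algebra_simps)
  also have "\<dots> = c\<^sup>2"
    using pos unfolding c2 by (simp add: field_simps co_rad_def)
  finally have "rad (\<lambda>i. c * z i) = c"
    using c rad_pos[of "\<lambda>i. c * z i"] by (simp add: power2_eq_iff_nonneg)
  then show ?thesis using c by (simp add: cube_to_ball_def y)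
qed

lemma cube_to_ball_to_cube: "ball_to_cube (cube_to_ball x) = x"
proof -
  let ?y = "\<lambda>i. sinh (a * x i)"
  have r: "rad ?y > 0" by (rule rad_pos)
  have "co_rad (cube_to_ball x) * (rad ?y)\<^sup>2 = (rad ?y)\<^sup>2 - (l2_norm n ?y)\<^sup>2 + \<kappa> * (linf_norm n ?y)\<^sup>2"
    using r by (simp add: co_rad_def l2_norm_cube_to_ball linf_norm_cube_to_ball power_divide field_simps)
  also have "\<dots> = real n" by (simp add: rad_power2)
  finally have "co_rad (cube_to_ball x) = real n / (rad ?y)\<^sup>2" using r by (simp add: field_simps)
  then have "sqrt (real n) / sqrt (co_rad (cube_to_ball x)) = rad ?y"
    using r n by (simp add: real_sqrt_divide)
  then show ?thesis using r a by (simp add: ball_to_cube_def) (simp add: cube_to_ball_def arsinh_sinh_real)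
qed

lemma continuous_on_cube_to_ball: "continuous_on S cube_to_ball"
proof (rule continuous_on_coordinatewise_then_product)
  fix i
  have coord: "continuous_on S (\<lambda>x. sinh (a * x j))" for j
    by (intro continuous_intros continuous_on_subset[OF continuous_on_product_coordinates]) auto
  have "continuous_on S (\<lambda>x. rad (\<lambda>i. sinh (a * x i)))"
    unfolding rad_def by (intro continuous_intros continuous_on_l2_norm continuous_on_linf_norm n1 coord)
  then show "continuous_on S (\<lambda>x. cube_to_ball x i)"
    unfolding cube_to_ball_def using rad_pos by (intro continuous_on_divide coord) (auto simp: less_imp_neq[symmetric])
qed

lemma continuous_on_ball_to_cube:
  assumes "\<And>z. z \<in> S \<Longrightarrow> l2_norm n z \<le> 1"
  shows "continuous_on S ball_to_cube"
proof (rule continuous_on_coordinatewise_then_product)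
  fix i
  have coord: "continuous_on S (\<lambda>x. x j)" for j :: nat
    by (rule continuous_on_subset[OF continuous_on_product_coordinates]) auto
  have "continuous_on S co_rad"
    unfolding co_rad_def by (intro continuous_intros continuous_on_l2_norm continuous_on_linf_norm n1 coord)
  moreover have "sqrt (co_rad z) \<noteq> 0" if "z \<in> S" for z using co_rad_pos[OF assms[OF that]] by simp
  ultimately show "continuous_on S (\<lambda>z. ball_to_cube z i)"
    unfolding ball_to_cube_def using a
    by (intro continuous_on_compose2[OF continuous_on_arsinh[of UNIV]] continuous_on_divide continuous_on_mult
        continuous_on_real_sqrt continuous_on_const coord) auto
qed

lemma homeomorphism_cube_to_ball:
  "homeomorphism {x \<in> Rn n. linf_norm n x \<le> 1} {x \<in> Rn n. l2_norm n x \<le> 1} cube_to_ball ball_to_cube"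
  by (rule homeomorphismI)
     (auto simp: continuous_on_cube_to_ball cube_to_ball_in ball_to_cube_in cube_to_ball_to_cube
        ball_to_cube_to_ball intro: continuous_on_ball_to_cube)

text \<open>\<open>\<phi>\<close> and \<open>\<phi>'\<close> stand for \<open>sinh (a * x j)\<close> and its derivative in the direction \<open>v\<close>, and \<open>i\<close>
  for a coordinate where the sup norm of \<open>x\<close> is attained.\<close>
lemma derivative_bound:
  assumes i: "i < n" and s: "\<bar>\<phi> i\<bar> \<le> sinh a"
    and \<phi>': "\<And>j. j < n \<Longrightarrow> \<bar>\<phi>' j\<bar> \<le> a * V * sqrt (1 + (\<phi> j)\<^sup>2)" and V: "V \<ge> 0"
    and R: "R = real n + (\<Sum>j<n. (\<phi> j)\<^sup>2) - \<kappa> * (\<phi> i)\<^sup>2"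
  shows "\<bar>(\<Sum>j<n. u j * \<phi>' j) / sqrt R
     - (\<Sum>j<n. u j * \<phi> j) * ((\<Sum>j<n. \<phi> j * \<phi>' j) - \<kappa> * (\<phi> i * \<phi>' i)) / (R * sqrt R)\<bar>
     \<le> l2_norm n u * (a * (1 + 7 / 4 * \<kappa>) * V)"
proof -
  define S where "S = (\<Sum>j<n. (\<phi> j)\<^sup>2)"
  have ks: "\<kappa> * (\<phi> i)\<^sup>2 \<le> real n" using s by (rule kappa_le)
  have sS: "(\<phi> i)\<^sup>2 \<le> S" unfolding S_def using i by (intro member_le_sum) auto
  have R1: "real n + (\<phi> i)\<^sup>2 - \<kappa> * (\<phi> i)\<^sup>2 \<le> R" using sS by (simp add: R S_def)
  have "\<kappa> * (\<phi> i)\<^sup>2 \<le> 1 * (\<phi> i)\<^sup>2" using kappa by (intro mult_right_mono) auto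
  then have R0: "R > 0" using R1 n by linarith
  \<comment> \<open>In these variables the expression is \<open>u\<close> paired with
    \<open>(I - p p^T) w\<close>, plus \<open>\<kappa>\<close> times \<open>p i * w i\<close> times
    \<open>u\<close> paired with \<open>p\<close>. The first part costs the factor 1 + \<kappa>/2,
    the second 5/4 \<kappa>, which add up to 1 + 7/4 \<kappa>.\<close>
  define p w where "p j = \<phi> j / sqrt R" and "w j = \<phi>' j / sqrt R" for j
  have l2p: "l2_norm n p \<le> 1"
  proof -
    have "(l2_norm n p)\<^sup>2 = S / R"
      using R0 by (simp add: l2_norm_power2 p_def power_divide sum_divide_distrib S_def)
    also have "\<dots> \<le> 1" using ks R0 by (simp add: R S_def)
    finally show ?thesis by (simp add: power2_le_imp_le)
  qed
  have l2w: "l2_norm n w \<le> a * V * (1 + \<kappa> / 2)"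
  proof (rule power2_le_imp_le)
    have "(l2_norm n w)\<^sup>2 = (\<Sum>j<n. (\<phi>' j)\<^sup>2) / R"
      using R0 by (simp add: l2_norm_power2 w_def power_divide sum_divide_distrib)
    also have "(\<Sum>j<n. (\<phi>' j)\<^sup>2) \<le> (\<Sum>j<n. (a * V)\<^sup>2 * (1 + (\<phi> j)\<^sup>2))"
    proof (rule sum_mono)
      fix j assume "j \<in> {..<n}"
      then have "\<bar>\<phi>' j\<bar>\<^sup>2 \<le> (a * V * sqrt (1 + (\<phi> j)\<^sup>2))\<^sup>2" using \<phi>' by (intro power_mono) auto
      also have "\<dots> = (a * V)\<^sup>2 * (1 + (\<phi> j)\<^sup>2)" by (simp add: power_mult_distrib add_nonneg_nonneg)
      finally show "(\<phi>' j)\<^sup>2 \<le> (a * V)\<^sup>2 * (1 + (\<phi> j)\<^sup>2)" by simp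
    qed
    also have "\<dots> = (a * V)\<^sup>2 * (real n + S)" by (simp add: sum_distrib_left[symmetric] sum.distrib S_def)
    also have "(a * V)\<^sup>2 * (real n + S) / R \<le> (a * V)\<^sup>2 * (1 + \<kappa>)"
    proof -
      have "\<kappa> * (\<phi> i)\<^sup>2 \<le> \<kappa> * R" using R1 ks kappa by (intro mult_left_mono) auto
      then have "real n + S \<le> (1 + \<kappa>) * R" by (simp add: R S_def algebra_simps)
      then have "(a * V)\<^sup>2 * (real n + S) \<le> (a * V)\<^sup>2 * ((1 + \<kappa>) * R)" by (intro mult_left_mono) auto
      then show ?thesis using R0 by (simp add: divide_le_eq mult.assoc)
    qed
    also have "\<dots> \<le> (a * V * (1 + \<kappa> / 2))\<^sup>2"
    proof -
      have "1 + \<kappa> \<le> (1 + \<kappa> / 2)\<^sup>2" by (simp add: power2_eq_square algebra_simps)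
      then show ?thesis unfolding power_mult_distrib[of "a * V"] by (intro mult_left_mono) auto
    qed
    finally show "(l2_norm n w)\<^sup>2 \<le> (a * V * (1 + \<kappa> / 2))\<^sup>2" using R0 by (simp add: divide_right_mono)
  qed (use a V kappa in simp)
  have pw: "\<bar>p i * w i\<bar> \<le> 5 / 4 * (a * V)"
  proof -
    define s where "s = (\<phi> i)\<^sup>2"
    have s0: "s \<ge> 0" by (simp add: s_def)
    have sq: "sqrt s = \<bar>\<phi> i\<bar>" by (simp add: s_def)
    have "0 \<le> (sqrt (1 + s) - sqrt s)\<^sup>2" by simp
    also have "\<dots> = (1 + s) + s - 2 * (sqrt (1 + s) * sqrt s)" using s0 by (simp add: power2_diff)
    finally have amgm: "sqrt (1 + s) * sqrt s \<le> s + 1 / 2" by simp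
    \<comment> \<open>The constant 5/4 comes from \<open>R \<ge> s\<close> and, for
      \<open>s < 2\<close>, \<open>R \<ge> 2\<close>: the worst case of (s + 1/2) / max 2 s is s =
      2. The bound by 2 rests on \<open>2 * \<kappa> \<le> n\<close>, which holds as (sinh a)^2 is
      at least 2.\<close>
    have "s + 1 / 2 \<le> 5 / 4 * R"
    proof (cases "s \<ge> 2")
      case True
      then show ?thesis using R1 ks by (simp add: s_def)
    next
      case False
      have "2 - s \<le> real n - \<kappa> * s"
      proof -
        have "2 \<le> (sinh a)\<^sup>2" using big n by linarith
        then have "\<kappa> * 2 \<le> real n"
          using kappa(1) mult_left_mono[of 2 "(sinh a)\<^sup>2" \<kappa>] by (simp add: kappa(3))
        then have "real n * (2 - s) \<le> 2 * (real n - \<kappa> * s)"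
          using s0 False mult_right_mono[of "\<kappa> * 2" "real n" s] by (simp add: algebra_simps)
        moreover have "2 * (2 - s) \<le> real n * (2 - s)" using n False by (intro mult_right_mono) auto
        ultimately show ?thesis by simp
      qed
      then show ?thesis using R1 False by (simp add: s_def)
    qed
    then have "sqrt (1 + s) * sqrt s \<le> 5 / 4 * R" using amgm by linarith
    then have "a * V * (sqrt (1 + s) * sqrt s) \<le> a * V * (5 / 4 * R)" using a V by (intro mult_left_mono) auto
    moreover have "\<bar>\<phi> i\<bar> * \<bar>\<phi>' i\<bar> \<le> \<bar>\<phi> i\<bar> * (a * V * sqrt (1 + s))"
      using \<phi>'[OF i] by (intro mult_left_mono) (auto simp: s_def)
    ultimately have "\<bar>\<phi> i\<bar> * \<bar>\<phi>' i\<bar> \<le> 5 / 4 * (a * V) * R" by (simp add: sq algebra_simps)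
    then show ?thesis using R0 by (simp add: p_def w_def abs_mult divide_le_eq)
  qed
  have up: "\<bar>\<Sum>j<n. u j * p j\<bar> \<le> l2_norm n u"
    using sum_mult_le_l2_norm[of u p n] mult_left_mono[OF l2p l2_norm_nonneg[of n u]] by simp
  have "(\<Sum>j<n. u j * \<phi>' j) / sqrt R
     - (\<Sum>j<n. u j * \<phi> j) * ((\<Sum>j<n. \<phi> j * \<phi>' j) - \<kappa> * (\<phi> i * \<phi>' i)) / (R * sqrt R)
     = ((\<Sum>j<n. u j * w j) - (\<Sum>j<n. u j * p j) * (\<Sum>j<n. p j * w j)) + (\<Sum>j<n. u j * p j) * (\<kappa> * (p i * w i))"
  proof -
    have "(\<Sum>j<n. u j * w j) = (\<Sum>j<n. u j * \<phi>' j) / sqrt R" "(\<Sum>j<n. u j * p j) = (\<Sum>j<n. u j * \<phi> j) / sqrt R"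
      "(\<Sum>j<n. p j * w j) = (\<Sum>j<n. \<phi> j * \<phi>' j) / R"
      using R0 by (simp_all add: p_def w_def sum_divide_distrib)
    moreover have "p i * w i = \<phi> i * \<phi>' i / R" using R0 by (simp add: p_def w_def)
    ultimately show ?thesis by (simp only:) (simp add: diff_divide_distrib right_diff_distrib mult_ac)
  qed
  also have "\<bar>\<dots>\<bar> \<le> l2_norm n u * (a * V * (1 + \<kappa> / 2)) + l2_norm n u * (\<kappa> * (5 / 4 * (a * V)))"
  proof (rule order_trans[OF abs_triangle_ineq add_mono])
    show "\<bar>(\<Sum>j<n. u j * w j) - (\<Sum>j<n. u j * p j) * (\<Sum>j<n. p j * w j)\<bar> \<le> l2_norm n u * (a * V * (1 + \<kappa> / 2))"
      by (rule order_trans[OF inner_projection_le[OF l2p] mult_left_mono[OF l2w l2_norm_nonneg]])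
    show "\<bar>(\<Sum>j<n. u j * p j) * (\<kappa> * (p i * w i))\<bar> \<le> l2_norm n u * (\<kappa> * (5 / 4 * (a * V)))"
      unfolding abs_mult[of "\<Sum>j<n. u j * p j"] abs_mult[of \<kappa>]
      using kappa by (intro mult_mono[OF up] mult_mono[OF _ pw]) (auto simp: l2_norm_nonneg)
  qed
  also have "\<dots> = l2_norm n u * (a * (1 + 7 / 4 * \<kappa>) * V)" by (simp add: algebra_simps)
  finally show ?thesis .
qed

text \<open>A segment is cut into the finitely many closed convex pieces on which the sup norm is
  attained at a fixed coordinate with a fixed sign; there the map is smooth.\<close>
lemma lipschitz_cube_to_ball:
  assumes x: "linf_norm n x \<le> 1" and y: "linf_norm n y \<le> 1"
  shows "l2_norm n (\<lambda>i. cube_to_ball x i - cube_to_ball y i)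
           \<le> a * (1 + 7 / 4 * \<kappa>) * linf_norm n (\<lambda>i. x i - y i)"
proof -
  define v V C where "v i = x i - y i" and "V = linf_norm n (\<lambda>i. x i - y i)" and "C = a * (1 + 7 / 4 * \<kappa>)" for i
  define p where "p t = (\<lambda>i. y i + t * v i)" for t :: real
  have V: "V \<ge> 0" "\<And>i. i < n \<Longrightarrow> \<bar>v i\<bar> \<le> V"
    using linf_norm_nonneg[OF n1] abs_le_linf_norm[of _ n "\<lambda>i. x i - y i"] by (auto simp: V_def v_def)
  have C: "C \<ge> 0" using a kappa by (simp add: C_def)
  have p1: "\<bar>p t i\<bar> \<le> 1" if "t \<in> {0..1}" "i < n" for t i
  proof -
    have "p t i = (1 - t) * y i + t * x i" by (simp add: p_def v_def algebra_simps)
    also have "\<bar>\<dots>\<bar> \<le> \<bar>(1 - t) * y i\<bar> + \<bar>t * x i\<bar>" by (rule abs_triangle_ineq)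
    also have "\<dots> = (1 - t) * \<bar>y i\<bar> + t * \<bar>x i\<bar>" using that by (simp add: abs_mult)
    also have "\<dots> \<le> (1 - t) * 1 + t * 1"
      using that x y by (intro add_mono mult_left_mono) (auto simp: linf_norm_le_iff[OF n1])
    finally show ?thesis by simp
  qed
  \<comment> \<open>Pairing with a fixed vector \<open>u\<close> leaves a real function of one
    variable; taking \<open>u\<close> to be the difference of the two values at the end recovers the
    norm.\<close>
  have main: "\<bar>\<Sum>i<n. u i * (cube_to_ball x i - cube_to_ball y i)\<bar> \<le> l2_norm n u * (C * V)" for u
  proof -
    define f where "f t = (\<Sum>i<n. u i * cube_to_ball (p t) i)" for t
    define B where "B = l2_norm n u * (C * V)"
    have B: "B \<ge> 0" using C V by (simp add: B_def l2_norm_nonneg)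
    define U where "U = (\<lambda>(i, \<epsilon>). {t \<in> {0..1::real}. \<forall>j\<in>{..<n}. \<bar>p t j\<bar> \<le> \<epsilon> * p t i})"
    have "B-lipschitz_on {0..1} f"
    proof (rule lipschitz_on_closed_Union)
      show "finite ({..<n} \<times> {-1, 1::real})" by simp
      show "B \<ge> 0" by (rule B)
      show "{0..1} \<subseteq> (\<Union>k\<in>{..<n} \<times> {-1, 1}. U k)"
      proof
        fix t :: real assume t: "t \<in> {0..1}"
        obtain i where i: "i < n" "linf_norm n (p t) = \<bar>p t i\<bar>" using linf_norm_attained[OF n1] by blast
        define \<epsilon> :: real where "\<epsilon> = (if p t i \<ge> 0 then 1 else -1)"
        have "\<bar>p t i\<bar> = \<epsilon> * p t i" by (simp add: \<epsilon>_def)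
        then have "t \<in> U (i, \<epsilon>)" using t i abs_le_linf_norm[of _ n "p t"] by (auto simp: U_def)
        moreover have "(i, \<epsilon>) \<in> {..<n} \<times> {-1, 1}" using i by (simp add: \<epsilon>_def)
        ultimately show "t \<in> (\<Union>k\<in>{..<n} \<times> {-1, 1}. U k)" by blast
      qed
      fix k assume "k \<in> {..<n} \<times> {-1, 1::real}"
      then obtain i \<epsilon> where k: "k = (i, \<epsilon>)" "i < n" "\<epsilon> = 1 \<or> \<epsilon> = -1" by auto
      have U_eq: "U k = {0..1} \<inter> (\<Inter>j\<in>{..<n}. {t. p t j \<le> \<epsilon> * p t i} \<inter> {t. - p t j \<le> \<epsilon> * p t i})"
        by (auto simp: U_def k abs_le_iff)
      show "closed (U k)"
        unfolding U_eq p_def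
        by (auto intro!: closed_Int closed_INT closed_Collect_le continuous_intros)
      \<comment> \<open>For a fixed coordinate and sign the defining inequalities are affine in
        \<open>t\<close>, so each piece is an interval and a bound on the derivative gives a
        Lipschitz bound on it.\<close>
      have half: "convex {t::real. c + t * d \<le> \<epsilon> * (c' + t * d')}" for c d c' d'
      proof -
        have eq: "{t::real. c + t * d \<le> \<epsilon> * (c' + t * d')} = {t. (d - \<epsilon> * d') \<bullet> t \<le> \<epsilon> * c' - c}"
          by (auto simp: algebra_simps)
        show ?thesis unfolding eq by (rule convex_halfspace_le)
      qed
      have "convex (U k)"
        unfolding U_eq
      proof (intro convex_Int convex_INT)
        fix j
        show "convex {t. p t j \<le> \<epsilon> * p t i}" unfolding p_def by (rule half)
        show "convex {t. - p t j \<le> \<epsilon> * p t i}"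
          using half[of "- y j" "- v j" "y i" "v i"] by (simp add: p_def)
      qed simp
      define \<phi> where "\<phi> j t = sinh (a * p t j)" for j t
      define \<phi>' where "\<phi>' j t = a * v j * cosh (a * p t j)" for j t
      define R where "R t = real n + (\<Sum>j<n. (\<phi> j t)\<^sup>2) - \<kappa> * (\<phi> i t)\<^sup>2" for t
      have Rpos: "R t > 0" for t
      proof -
        have "\<kappa> * (\<phi> i t)\<^sup>2 \<le> 1 * (\<phi> i t)\<^sup>2" using kappa by (intro mult_right_mono) auto
        moreover have "(\<phi> i t)\<^sup>2 \<le> (\<Sum>j<n. (\<phi> j t)\<^sup>2)" using k(2) by (intro member_le_sum) auto
        ultimately show ?thesis using n by (simp add: R_def)
      qed
      define f' where "f' t = (\<Sum>j<n. u j * \<phi>' j t) / sqrt (R t)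
        - (\<Sum>j<n. u j * \<phi> j t) * ((\<Sum>j<n. \<phi> j t * \<phi>' j t) - \<kappa> * (\<phi> i t * \<phi>' i t)) / (R t * sqrt (R t))" for t
      have d\<phi>: "(\<phi> j has_real_derivative \<phi>' j t) (at t within U k)" for j t
        unfolding \<phi>_def[abs_def] \<phi>'_def p_def by (auto intro!: derivative_eq_intros)
      have dR: "(R has_real_derivative 2 * ((\<Sum>j<n. \<phi> j t * \<phi>' j t) - \<kappa> * (\<phi> i t * \<phi>' i t))) (at t within U k)" for t
        unfolding R_def[abs_def]
        by (auto intro!: derivative_eq_intros d\<phi> simp: sum_distrib_left algebra_simps)
      have dsR: "((\<lambda>t. sqrt (R t)) has_real_derivative 
          2 * ((\<Sum>j<n. \<phi> j t * \<phi>' j t) - \<kappa> * (\<phi> i t * \<phi>' i t)) * (inverse (sqrt (R t)) / 2)) (at t within U k)" for t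
        using DERIV_chain2[OF DERIV_real_sqrt[OF Rpos] dR] by (simp add: mult.commute)
      have dS: "((\<lambda>t. \<Sum>j<n. u j * \<phi> j t) has_real_derivative (\<Sum>j<n. u j * \<phi>' j t)) (at t within U k)" for t
        by (auto intro!: derivative_eq_intros d\<phi> simp: mult.commute)
      have df: "((\<lambda>t. (\<Sum>j<n. u j * \<phi> j t) / sqrt (R t)) has_real_derivative f' t) (at t within U k)" for t
      proof (rule DERIV_cong[OF DERIV_divide[OF dS dsR]])
        have alg: "(A * r - F * (2 * D * (inverse r / 2))) / (r * r) = A / r - F * D / (r * r * r)"
          if "r \<noteq> 0" for A D F r :: real
          using that by (simp add: field_simps)
        have r: "sqrt (R t) \<noteq> 0" "R t = sqrt (R t) * sqrt (R t)" using Rpos[of t] by auto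
        show "((\<Sum>j<n. u j * \<phi>' j t) * sqrt (R t) - (\<Sum>j<n. u j * \<phi> j t) *
            (2 * ((\<Sum>j<n. \<phi> j t * \<phi>' j t) - \<kappa> * (\<phi> i t * \<phi>' i t)) * (inverse (sqrt (R t)) / 2))) / (sqrt (R t) * sqrt (R t)) = f' t"
          unfolding f'_def by (subst alg[OF r(1)]) (simp only: r(2)[symmetric])
      qed (use Rpos in \<open>auto simp: less_imp_neq[symmetric]\<close>)
      have bound: "\<bar>f' t\<bar> \<le> B" if t: "t \<in> U k" for t
        unfolding f'_def B_def C_def
      proof (rule derivative_bound[where i = i])
        have "t \<in> {0..1}" using t by (simp add: U_eq)
        then have le: "\<bar>p t i\<bar> \<le> 1" using p1 k by blast
        show "\<bar>\<phi> i t\<bar> \<le> sinh a"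
          using le a by (simp add: \<phi>_def abs_mult flip: sinh_real_abs)
        show "\<bar>\<phi>' j t\<bar> \<le> a * V * sqrt (1 + (\<phi> j t)\<^sup>2)" if "j < n" for j
        proof -
          have "sqrt (1 + (\<phi> j t)\<^sup>2) = cosh (a * p t j)"
            unfolding \<phi>_def add.commute[of 1] cosh_square_eq[symmetric] by simp
          then show ?thesis using a V(2)[OF that] by (simp add: \<phi>'_def abs_mult mult_right_mono)
        qed
      qed (use k V in \<open>auto simp: R_def\<close>)
      have f_eq: "f t = (\<Sum>j<n. u j * \<phi> j t) / sqrt (R t)" if t: "t \<in> U k" for t
      proof -
        have "linf_norm n (p t) = \<bar>p t i\<bar>"
        proof (rule linf_norm_eqI[OF k(2) refl])
          fix j assume "j < n"
          then have "\<bar>p t j\<bar> \<le> \<epsilon> * p t i" using t k(1) by (simp add: U_def)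
          also have "\<dots> \<le> \<bar>p t i\<bar>" using k(3) by auto
          finally show "\<bar>p t j\<bar> \<le> \<bar>p t i\<bar>" .
        qed
        then have "linf_norm n (\<lambda>j. \<phi> j t) = \<bar>\<phi> i t\<bar>"
          using a linf_norm_sinh[of "p t"] by (simp add: \<phi>_def abs_mult flip: sinh_real_abs)
        then have "rad (\<lambda>j. \<phi> j t) = sqrt (R t)"
          by (simp add: rad_def R_def l2_norm_power2)
        then show ?thesis by (simp add: f_def cube_to_ball_def \<phi>_def sum_divide_distrib)
      qed
      show "B-lipschitz_on (U k) f"
      proof (rule lipschitz_onI)
        fix s t assume st: "s \<in> U k" "t \<in> U k"
        have "norm ((\<Sum>j<n. u j * \<phi> j s) / sqrt (R s) - (\<Sum>j<n. u j * \<phi> j t) / sqrt (R t)) \<le> B * norm (s - t)"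
          by (rule field_differentiable_bound[OF \<open>convex (U k)\<close> df _ st]) (use bound in simp)
        then show "dist (f s) (f t) \<le> B * dist s t" by (simp add: dist_norm f_eq st)
      qed (rule B)
    qed
    then have "dist (f 1) (f 0) \<le> B * dist 1 (0::real)" by (rule lipschitz_onD) auto
    moreover have "p 1 = x" "p 0 = y" by (auto simp: p_def v_def)
    ultimately show ?thesis
      by (simp add: f_def B_def dist_real_def sum_subtractf right_diff_distrib)
  qed
  define d where "d i = cube_to_ball x i - cube_to_ball y i" for i
  have "(l2_norm n d)\<^sup>2 = (\<Sum>i<n. d i * d i)"
    unfolding l2_norm_power2 by (simp add: power2_eq_square)
  also have "\<dots> \<le> l2_norm n d * (C * V)"
    using main[of d] unfolding d_def[symmetric] by (rule order_trans[OF abs_ge_self])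
  finally have "l2_norm n d \<le> C * V"
    using C V l2_norm_nonneg[of n d] by (cases "l2_norm n d = 0") (auto simp: power2_eq_square)
  then show ?thesis by (simp add: d_def[abs_def] C_def V_def)
qed

lemma Lipschitz_homeomorphism_cube_to_ball:
  "Lipschitz_homeomorphism (linf_ball n) (l2_ball n) cube_to_ball"
proof -
  have "mdist (l2_ball n) (cube_to_ball x) (cube_to_ball y) \<le> a * (1 + 7 / 4 * \<kappa>) * mdist (linf_ball n) x y"
    if "x \<in> mspace (linf_ball n)" "y \<in> mspace (linf_ball n)" for x y
    using that lipschitz_cube_to_ball n1 by simp
  then have "Lipschitz_continuous_map (linf_ball n) (l2_ball n) cube_to_ball"
    unfolding Lipschitz_continuous_map_def using cube_to_ball_in n1 by auto
  moreover have "homeomorphic_map (mtopology_of (linf_ball n)) (mtopology_of (l2_ball n)) cube_to_ball"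
    using homeomorphism_cube_to_ball
    by (auto simp: mtopology_linf_ball[OF n1] mtopology_l2_ball homeomorphic_map_top_of_set)
  ultimately show ?thesis by (simp add: Lipschitz_homeomorphism_def)
qed

lemma ball_const_le_sinh_map: "ball_const n \<le> a * (1 + 7 / 4 * \<kappa>)"
proof -
  obtain u v where uv: "u \<in> mspace (linf_ball n)" "v \<in> mspace (linf_ball n)" "u \<noteq> v"
    by (rule linf_sphere_two_points[OF n1])
  have "Lip (linf_ball n) (l2_ball n) cube_to_ball \<le> a * (1 + 7 / 4 * \<kappa>)"
    by (rule Lip_le[OF uv]) (use lipschitz_cube_to_ball n1 in simp)
  then show ?thesis
    using ball_const_le[OF n1 Lipschitz_homeomorphism_cube_to_ball] by linarith
qed

end

text \<open>Adding \<open>b\<close> to \<open>A\<close> multiplies the lower bound for sinh^2 by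
  exp(2b) = 2q, so \<kappa> is at most \<nu>/(2q). The cost \<open>b\<close> is logarithmic in
  \<open>q\<close>, while the error \<open>a * \<kappa>\<close> falls to order
  \<open>q = sqrt (1 + A)\<close>.\<close>

lemma ball_const_upper:
  fixes n :: nat
  assumes n: "n \<ge> 2"
  defines "A \<equiv> arsinh (sqrt (real n - 1))"
  shows "\<exists>g. Lipschitz_homeomorphism (linf_ball n) (l2_ball n) g"
    and "ball_const n \<le> 1 + A + (1 + real n / (2 * (real n - 1))) * sqrt (1 + A)"
proof -
  have A: "A > 0" using n by (simp add: A_def)
  define q where "q = sqrt (1 + A)"
  have q: "q \<ge> 1" "q\<^sup>2 = 1 + A" using A by (auto simp: q_def)
  define b where "b = ln (2 * q) / 2"
  have b: "b \<ge> 0" using q by (simp add: b_def)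
  define a where "a = A + b"
  have a0: "a > 0" using A b by (simp add: a_def)
  define \<nu> where "\<nu> = real n / (real n - 1)"
  have \<nu>2: "real n / (2 * (real n - 1)) = \<nu> / 2"
    unfolding \<nu>_def by (metis divide_divide_eq_left mult.commute)
  have \<nu>: "1 \<le> \<nu>" "\<nu> \<le> 2" using n by (auto simp: \<nu>_def field_simps)
  have sinhA: "(sinh A)\<^sup>2 = real n - 1" using n by (simp add: A_def)
  have "sinh A * exp b \<le> sinh a"
  proof -
    have "sinh A * sinh b \<le> cosh A * sinh b"
      using b by (intro mult_right_mono) (auto simp: sinh_le_cosh_real)
    then show ?thesis unfolding a_def sinh_add cosh_plus_sinh[symmetric] by (simp add: algebra_simps)
  qed
  then have "(sinh A * exp b)\<^sup>2 \<le> (sinh a)\<^sup>2" using A by (intro power_mono) auto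
  moreover have "(sinh A * exp b)\<^sup>2 = (real n - 1) * (2 * q)"
    using q by (simp add: power_mult_distrib sinhA b_def exp_double[symmetric])
  ultimately have sinha: "(real n - 1) * (2 * q) \<le> (sinh a)\<^sup>2" by simp
  have "real n \<le> (real n - 1) * 2" using n by simp
  also have "\<dots> \<le> (real n - 1) * (2 * q)" using n q by (intro mult_left_mono) auto
  finally interpret sinh_map n a "real n / (sinh a)\<^sup>2"
    using n a0 sinha by unfold_locales auto
  show "\<exists>g. Lipschitz_homeomorphism (linf_ball n) (l2_ball n) g"
    using Lipschitz_homeomorphism_cube_to_ball by blast
  have "real n / (sinh a)\<^sup>2 \<le> real n / ((real n - 1) * (2 * q))"
    using sinha n q sinh_a by (intro divide_left_mono mult_pos_pos) auto
  also have "\<dots> = \<nu> / (2 * q)" by (simp add: \<nu>_def)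
  finally have "7 / 4 * (real n / (sinh a)\<^sup>2) \<le> 7 / 8 * \<nu> / q" by simp
  then have "a * (1 + 7 / 4 * (real n / (sinh a)\<^sup>2)) \<le> a * (1 + 7 / 8 * \<nu> / q)"
    using a0 by (intro mult_left_mono add_left_mono) auto
  also have "\<dots> \<le> (q\<^sup>2 + q / 15) * (1 + 7 / 8 * \<nu> / q)"
  proof (rule mult_right_mono)
    \<comment> \<open>The tangent of \<open>ln\<close> at exp 3 gives ln(2q) \<le> 2 + 2q/15, hence
      b \<le> 1 + q/15. Since q^2 = 1 + A, the 1 is absorbed in q^2.\<close>
    have "15 \<le> exp (3::real)"
    proof -
      have "(5/2::real) \<le> exp 1" using exp_lower_Taylor_quadratic[of "1::real"] by simp
      then have "(5/2::real) ^ 3 \<le> exp 1 ^ 3" by (intro power_mono) auto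
      also have "exp 1 ^ 3 = exp (3::real)" by (simp add: exp_of_nat_mult[symmetric])
      finally show ?thesis by (simp add: power3_eq_cube)
    qed
    then have "2 * q / exp 3 \<le> 2 * q / 15" using q by (intro divide_left_mono) auto
    moreover have "ln (2 * q / exp 3) \<le> 2 * q / exp 3 - 1" using q by (intro ln_le_minus_one) simp
    moreover have "ln (2 * q / exp 3) = ln (2 * q) - 3" using q by (simp add: ln_div)
    ultimately show "a \<le> q\<^sup>2 + q / 15" using q by (simp add: a_def b_def)
  qed (use \<nu> q in auto)
  also have "\<dots> = q\<^sup>2 + q * (7 / 8 * \<nu> + 1 / 15) + 7 / 120 * \<nu>"
    using q(1) by (simp add: power2_eq_square field_simps)
  also have "\<dots> \<le> q\<^sup>2 + (1 + \<nu> / 2) * q"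
  proof -
    have "7 / 120 * \<nu> \<le> 7 / 60 * q" using \<nu> q by simp
    moreover have "q * (7 / 8 * \<nu> + 1 / 15) + 7 / 60 * q \<le> (1 + \<nu> / 2) * q"
    proof -
      \<comment> \<open>Both this and the bound on the constant term use \<nu> \<le> 2, which is
        where n \<ge> 2 enters; at \<nu> = 2 the slack is 1/15.\<close>
      have "7 / 8 * \<nu> + 1 / 15 + 7 / 60 \<le> 1 + \<nu> / 2" using \<nu> by simp
      then have "(7 / 8 * \<nu> + 1 / 15 + 7 / 60) * q \<le> (1 + \<nu> / 2) * q" using q by (intro mult_right_mono) auto
      then show ?thesis by (simp add: algebra_simps)
    qed
    ultimately show ?thesis by linarith
  qed
  finally show "ball_const n \<le> 1 + A + (1 + real n / (2 * (real n - 1))) * sqrt (1 + A)"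
    using ball_const_le_sinh_map unfolding \<nu>2 q_def[symmetric] q(2) by (rule order_trans[rotated])
qed

section \<open>Averaging over product distributions\<close>

text \<open>Expectation over a random shift of coordinate \<open>i\<close> by
  \<open>\<tau> * k\<close>, where \<open>k\<close> has the law \<open>w\<close> on
  \<open>J\<close>; \<open>avgs\<close> below makes independent shifts of the first \<open>k\<close>
  coordinates. Finite sums avoid all questions of integrability and of differentiating under an
  integral.\<close>

definition avg1 :: "(int \<Rightarrow> real) \<Rightarrow> int set \<Rightarrow> real \<Rightarrow> nat \<Rightarrow> ((nat \<Rightarrow> real) \<Rightarrow> real) \<Rightarrow> (nat \<Rightarrow> real) \<Rightarrow> real"
  where "avg1 w J \<tau> i f x = (\<Sum>k\<in>J. w k * f (x(i := x i + \<tau> * of_int k)))"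

primrec avgs :: "(int \<Rightarrow> real) \<Rightarrow> int set \<Rightarrow> real \<Rightarrow> nat \<Rightarrow> ((nat \<Rightarrow> real) \<Rightarrow> real) \<Rightarrow> (nat \<Rightarrow> real) \<Rightarrow> real"
  where "avgs w J \<tau> 0 f = f"
  | "avgs w J \<tau> (Suc k) f = avgs w J \<tau> k (avg1 w J \<tau> k f)"

definition fdiff :: "real \<Rightarrow> nat \<Rightarrow> ((nat \<Rightarrow> real) \<Rightarrow> real) \<Rightarrow> (nat \<Rightarrow> real) \<Rightarrow> real"
  where "fdiff \<tau> i f x = f (x(i := x i + \<tau>)) - f x"

lemma fdiff_avg1: "i \<noteq> j \<Longrightarrow> fdiff \<tau> i (avg1 w J \<tau> j f) = avg1 w J \<tau> j (fdiff \<tau> i f)"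
  by (rule ext) (simp add: fdiff_def avg1_def sum_subtractf right_diff_distrib fun_upd_twist)

lemma fdiff_avgs: "k \<le> i \<Longrightarrow> fdiff \<tau> i (avgs w J \<tau> k f) = avgs w J \<tau> k (fdiff \<tau> i f)"
  by (induction k arbitrary: f) (simp_all add: fdiff_avg1)

lemma avg1_add: "avg1 w J \<tau> i (\<lambda>x. f x + g x) x = avg1 w J \<tau> i f x + avg1 w J \<tau> i g x"
  by (simp add: avg1_def sum.distrib distrib_left)

lemma avg1_scale: "avg1 w J \<tau> i (\<lambda>x. c * f x) x = c * avg1 w J \<tau> i f x"
  by (simp add: avg1_def sum_distrib_left mult.left_commute)

lemma avgs_add: "avgs w J \<tau> k (\<lambda>x. f x + g x) x = avgs w J \<tau> k f x + avgs w J \<tau> k g x"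
  by (induction k arbitrary: f g) (simp_all add: avg1_add[abs_def])

lemma avgs_scale: "avgs w J \<tau> k (\<lambda>x. c * f x) x = c * avgs w J \<tau> k f x"
  by (induction k arbitrary: f) (simp_all add: avg1_scale[abs_def])

lemma avgs_zero: "avgs w J \<tau> k (\<lambda>x. 0) x = 0"
  using avgs_scale[of w J \<tau> k 0 "\<lambda>x. 0" x] by simp

lemma avgs_sum: "finite S \<Longrightarrow> avgs w J \<tau> k (\<lambda>x. \<Sum>s\<in>S. f s x) x = (\<Sum>s\<in>S. avgs w J \<tau> k (f s) x)"
  by (induction S rule: finite_induct) (simp_all add: avgs_zero avgs_add)

locale avg_weights =
  fixes w :: "int \<Rightarrow> real" and J :: "int set"
  assumes fin: "finite J" and w_nonneg: "\<And>k. w k \<ge> 0" and w_sum: "(\<Sum>k\<in>J. w k) = 1"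
begin

lemma avg1_const: "avg1 w J \<tau> i (\<lambda>x. c) x = c"
  by (simp add: avg1_def sum_distrib_right[symmetric] w_sum)

lemma avgs_const: "avgs w J \<tau> k (\<lambda>x. c) x = c"
  by (induction k) (simp_all add: avg1_const[abs_def])

lemma avg1_mono_local:
  assumes "\<And>k. k \<in> J \<Longrightarrow> f (x(i := x i + \<tau> * of_int k)) \<le> g (x(i := x i + \<tau> * of_int k))"
  shows "avg1 w J \<tau> i f x \<le> avg1 w J \<tau> i g x"
  unfolding avg1_def by (intro sum_mono mult_left_mono assms w_nonneg)

text \<open>Only points that the shifts can reach matter; the 0 in \<open>insert 0 J\<close>
  accounts for coordinates that are never shifted. This is how the bounded range of the noise is
  exploited.\<close>

lemma avgs_mono_local:
  assumes "\<And>y. (\<And>i. \<exists>k\<in>insert 0 J. y i = x i + \<tau> * of_int k) \<Longrightarrow> f y \<le> g y"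
  shows "avgs w J \<tau> n f x \<le> avgs w J \<tau> n g x"
proof -
  \<comment> \<open>The induction needs the further information that coordinates from
    \<open>n\<close> on are still those of \<open>x\<close>: the next shift must start from the
    original value.\<close>
  have "avgs w J \<tau> n f x \<le> avgs w J \<tau> n g x"
    if "\<And>y. (\<And>i. \<exists>k\<in>insert 0 J. y i = x i + \<tau> * of_int k) \<Longrightarrow> (\<And>i. i \<ge> n \<Longrightarrow> y i = x i) \<Longrightarrow> f y \<le> g y"
    using that
  proof (induction n arbitrary: f g)
    case 0
    then show ?case by (auto intro!: bexI[of _ 0])
  next
    case (Suc n)
    show ?case unfolding avgs.simps
    proof (rule Suc.IH, rule avg1_mono_local)
      fix y k assume y: "\<And>i. \<exists>k\<in>insert 0 J. y i = x i + \<tau> * of_int k" "\<And>i. i \<ge> n \<Longrightarrow> y i = x i" and k: "k \<in> J"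
      show "f (y(n := y n + \<tau> * of_int k)) \<le> g (y(n := y n + \<tau> * of_int k))"
      proof (rule Suc.prems)
        show "\<exists>k'\<in>insert 0 J. (y(n := y n + \<tau> * of_int k)) i = x i + \<tau> * of_int k'" for i
          using y(1)[of i] y(2)[of n] k by (cases "i = n") auto
        show "i \<ge> Suc n \<Longrightarrow> (y(n := y n + \<tau> * of_int k)) i = x i" for i
          using y(2) by simp
      qed
    qed
  qed
  then show ?thesis using assms by blast
qed

lemma avgs_mono: "(\<And>y. f y \<le> g y) \<Longrightarrow> avgs w J \<tau> k f x \<le> avgs w J \<tau> k g x"
  by (rule avgs_mono_local)

lemma avg1_power2_le: "(avg1 w J \<tau> i f x)\<^sup>2 \<le> avg1 w J \<tau> i (\<lambda>x. (f x)\<^sup>2) x"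
proof -
  let ?m = "avg1 w J \<tau> i f x"
  have "0 \<le> (\<Sum>k\<in>J. w k * (f (x(i := x i + \<tau> * of_int k)) - ?m)\<^sup>2)"
    by (intro sum_nonneg mult_nonneg_nonneg w_nonneg) auto
  also have "\<dots> = (\<Sum>k\<in>J. w k * (f (x(i := x i + \<tau> * of_int k)))\<^sup>2)
      - (\<Sum>k\<in>J. (2 * ?m) * (w k * f (x(i := x i + \<tau> * of_int k)))) + (\<Sum>k\<in>J. ?m\<^sup>2 * w k)"
    by (simp add: power2_diff sum.distrib sum_subtractf algebra_simps)
  also have "\<dots> = avg1 w J \<tau> i (\<lambda>x. (f x)\<^sup>2) x - 2 * ?m * ?m + ?m\<^sup>2"
    by (simp only: sum_distrib_left[symmetric] w_sum avg1_def mult_1_right)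
  finally show ?thesis by (simp add: power2_eq_square)
qed

text \<open>Tensorisation: averaging the one-dimensional inequality in the last coordinate leaves
  the variance of the partial average \<open>?A f\<close>, and Jensen's inequality
  \<open>avg1_power2_le\<close> bounds the squared differences of \<open>?A f\<close> by averages of
  those of \<open>f\<close>. The constant does not depend on the dimension.\<close>

lemma avgs_Poincare:
  assumes c: "\<And>g :: int \<Rightarrow> real. (\<Sum>k\<in>J. w k * (g k)\<^sup>2) - (\<Sum>k\<in>J. w k * g k)\<^sup>2
                 \<le> c * (\<Sum>k\<in>J. w k * (g (k + 1) - g k)\<^sup>2)"
    and "c \<ge> 0"
  shows "avgs w J \<tau> n (\<lambda>x. (f x)\<^sup>2) x - (avgs w J \<tau> n f x)\<^sup>2
           \<le> c * (\<Sum>i<n. avgs w J \<tau> n (\<lambda>x. (fdiff \<tau> i f x)\<^sup>2) x)"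
proof (induction n arbitrary: f)
  case 0
  then show ?case by simp
next
  case (Suc n)
  let ?A = "avg1 w J \<tau> n" and ?E = "avgs w J \<tau> n"
  have one: "?A (\<lambda>x. (f x)\<^sup>2) y \<le> (?A f y)\<^sup>2 + c * ?A (\<lambda>x. (fdiff \<tau> n f x)\<^sup>2) y" for y
    using c[of "\<lambda>k. f (y(n := y n + \<tau> * of_int k))"]
    by (simp add: avg1_def fdiff_def algebra_simps)
  have "?E (?A (\<lambda>x. (f x)\<^sup>2)) x \<le> ?E (\<lambda>y. (?A f y)\<^sup>2 + c * ?A (\<lambda>x. (fdiff \<tau> n f x)\<^sup>2) y) x"
    by (rule avgs_mono) (rule one)
  also have "\<dots> = ?E (\<lambda>y. (?A f y)\<^sup>2) x + c * ?E (?A (\<lambda>x. (fdiff \<tau> n f x)\<^sup>2)) x"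
    by (simp add: avgs_add avgs_scale)
  finally have 1: "?E (?A (\<lambda>x. (f x)\<^sup>2)) x \<le> ?E (\<lambda>y. (?A f y)\<^sup>2) x + c * ?E (?A (\<lambda>x. (fdiff \<tau> n f x)\<^sup>2)) x" .
  have "?E (\<lambda>y. (?A f y)\<^sup>2) x - (?E (?A f) x)\<^sup>2 \<le> c * (\<Sum>i<n. ?E (\<lambda>x. (fdiff \<tau> i (?A f) x)\<^sup>2) x)"
    by (rule Suc.IH)
  also have "\<dots> \<le> c * (\<Sum>i<n. ?E (?A (\<lambda>x. (fdiff \<tau> i f x)\<^sup>2)) x)"
  proof (intro mult_left_mono sum_mono avgs_mono \<open>c \<ge> 0\<close>)
    fix i y assume "i \<in> {..<n}"
    then have "fdiff \<tau> i (?A f) = ?A (fdiff \<tau> i f)" by (intro fdiff_avg1) auto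
    then show "(fdiff \<tau> i (?A f) y)\<^sup>2 \<le> ?A (\<lambda>x. (fdiff \<tau> i f x)\<^sup>2) y"
      by (simp add: avg1_power2_le)
  qed
  finally show ?case using 1 by (simp add: distrib_left)
qed

end

text \<open>The two points need not be joined by a segment outside the cube. The radius may be any
  real: averaging only adds to it, and requiring the condition for all \<open>r\<close> says that
  \<open>f\<close> is Lipschitz everywhere.\<close>

definition lipschitz_outside :: "nat \<Rightarrow> real \<Rightarrow> real \<Rightarrow> ((nat \<Rightarrow> real) \<Rightarrow> nat \<Rightarrow> real) \<Rightarrow> bool"
  where "lipschitz_outside n r L f \<longleftrightarrow> (\<forall>x y. r \<le> linf_norm n x \<longrightarrow> r \<le> linf_norm n y \<longrightarrow>
     l2_norm n (\<lambda>a. f x a - f y a) \<le> L * linf_norm n (\<lambda>i. x i - y i))"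

lemma linf_norm_upd:
  assumes "n \<ge> 1" "\<bar>s\<bar> \<le> \<rho>"
  shows "linf_norm n x - \<rho> \<le> linf_norm n (x(i := x i + s))"
proof -
  have "linf_norm n (\<lambda>j. x j - (x(i := x i + s)) j) \<le> \<rho>"
    using assms by (auto simp: linf_norm_le_iff)
  then show ?thesis using linf_norm_triangle[OF assms(1), of x "x(i := x i + s)"] by linarith
qed

context avg_weights
begin

text \<open>Both points receive the same shift, so their distance is unchanged; a shift by at most
  \<open>\<rho>\<close> lowers the sup norm by at most \<open>\<rho>\<close>, which the larger
  radius absorbs.\<close>

lemma lipschitz_outside_avg1:
  assumes n: "n \<ge> 1" and f: "lipschitz_outside n r L f"
    and \<rho>: "\<And>k. k \<in> J \<Longrightarrow> \<bar>\<tau> * of_int k\<bar> \<le> \<rho>"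
  shows "lipschitz_outside n (r + \<rho>) L (\<lambda>x a. avg1 w J \<tau> i (\<lambda>y. f y a) x)"
  unfolding lipschitz_outside_def
proof (intro allI impI)
  fix x y assume x: "r + \<rho> \<le> linf_norm n x" and y: "r + \<rho> \<le> linf_norm n y"
  let ?s = "\<lambda>x k. x(i := x i + \<tau> * of_int k)"
  have "l2_norm n (\<lambda>a. avg1 w J \<tau> i (\<lambda>y. f y a) x - avg1 w J \<tau> i (\<lambda>y. f y a) y)
      = l2_norm n (\<lambda>a. \<Sum>k\<in>J. w k * (f (?s x k) a - f (?s y k) a))"
    by (simp add: avg1_def sum_subtractf right_diff_distrib)
  also have "\<dots> \<le> (\<Sum>k\<in>J. l2_norm n (\<lambda>a. w k * (f (?s x k) a - f (?s y k) a)))"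
    by (rule l2_norm_sum[OF fin])
  also have "\<dots> \<le> (\<Sum>k\<in>J. w k * (L * linf_norm n (\<lambda>i. x i - y i)))"
  proof (rule sum_mono)
    fix k assume k: "k \<in> J"
    have "r \<le> linf_norm n (?s x k)" "r \<le> linf_norm n (?s y k)"
      using linf_norm_upd[OF n \<rho>[OF k]] x y by (smt (verit))+
    then have "l2_norm n (\<lambda>a. f (?s x k) a - f (?s y k) a) \<le> L * linf_norm n (\<lambda>j. ?s x k j - ?s y k j)"
      using f unfolding lipschitz_outside_def by blast
    also have "(\<lambda>j. ?s x k j - ?s y k j) = (\<lambda>i. x i - y i)" by auto
    finally show "l2_norm n (\<lambda>a. w k * (f (?s x k) a - f (?s y k) a)) \<le> w k * (L * linf_norm n (\<lambda>i. x i - y i))"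
      using w_nonneg[of k] by (simp add: l2_norm_scale mult_left_mono del: fun_upd_apply)
  qed
  also have "\<dots> = L * linf_norm n (\<lambda>i. x i - y i)"
    by (simp add: sum_distrib_right[symmetric] w_sum)
  finally show "l2_norm n (\<lambda>a. avg1 w J \<tau> i (\<lambda>y. f y a) x - avg1 w J \<tau> i (\<lambda>y. f y a) y)
      \<le> L * linf_norm n (\<lambda>i. x i - y i)" .
qed

lemma lipschitz_outside_avgs:
  assumes n: "n \<ge> 1" and \<rho>: "\<And>k. k \<in> J \<Longrightarrow> \<bar>\<tau> * of_int k\<bar> \<le> \<rho>"
  shows "lipschitz_outside n r L f \<Longrightarrow>
    lipschitz_outside n (r + real k * \<rho>) L (\<lambda>x a. avgs w J \<tau> k (\<lambda>y. f y a) x)"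
proof (induction k arbitrary: f r)
  case 0
  then show ?case by simp
next
  case (Suc k)
  have "lipschitz_outside n ((r + \<rho>) + real k * \<rho>) L
     (\<lambda>x a. avgs w J \<tau> k (\<lambda>y. avg1 w J \<tau> k (\<lambda>y. f y a) y) x)"
    using Suc.IH[OF lipschitz_outside_avg1[OF n Suc.prems \<rho>]] by simp
  then show ?case by (simp add: algebra_simps)
qed

end

section \<open>Box averages and the sum of squared partial differences\<close>

lemma fdiff_avg1_box:
  assumes "N \<ge> 1"
  shows "fdiff \<tau> i (avg1 (\<lambda>_. 1 / real N) {0..<int N} \<tau> i f) x
          = (f (x(i := x i + \<tau> * real N)) - f x) / real N"
proof -
  have J: "{0..<int N} = int ` {..<N}"
    by (simp add: image_int_atLeastLessThan lessThan_atLeast0)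
  let ?F = "\<lambda>k. f (x(i := x i + \<tau> * real k))"
  have A: "avg1 (\<lambda>_. 1 / real N) {0..<int N} \<tau> i f y = (\<Sum>k<N. f (y(i := y i + \<tau> * real k)) / real N)" for y
    unfolding avg1_def J by (subst sum.reindex) auto
  have "fdiff \<tau> i (avg1 (\<lambda>_. 1 / real N) {0..<int N} \<tau> i f) x = (\<Sum>k<N. (?F (Suc k) - ?F k) / real N)"
    by (simp add: fdiff_def A sum_subtractf diff_divide_distrib algebra_simps)
  also have "\<dots> = (?F N - ?F 0) / real N"
    using sum_lessThan_telescope[of ?F N] by (simp only: sum_divide_distrib[symmetric])
  finally show ?thesis by simp
qed

abbreviation box :: "nat \<Rightarrow> real \<Rightarrow> nat \<Rightarrow> ((nat \<Rightarrow> real) \<Rightarrow> real) \<Rightarrow> (nat \<Rightarrow> real) \<Rightarrow> real"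
  where "box N \<equiv> avgs (\<lambda>_. 1 / real N) {0..<int N}"

lemma avg_weights_box: "N \<ge> 1 \<Longrightarrow> avg_weights (\<lambda>_. 1 / real N) {0..<int N}"
  by unfold_locales auto

lemma box_step: "\<tau> \<ge> 0 \<Longrightarrow> k \<in> {0..<int N} \<Longrightarrow> \<bar>\<tau> * of_int k\<bar> \<le> \<tau> * real N"
  by (simp add: abs_mult mult_left_mono)

text \<open>The gain of the factor \<open>2 / N\<close>: averaging turns a difference with step \<open>\<tau>\<close> into \<open>1 / N\<close>
  times one with step \<open>N \<tau>\<close>.\<close>
lemma lipschitz_outside_fdiff_box:
  assumes n: "n \<ge> 1" and N: "N \<ge> 1" and \<tau>: "\<tau> \<ge> 0" and L: "L \<ge> 0"
  shows "lipschitz_outside n r L f \<Longrightarrow> i < k \<Longrightarrow>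
    lipschitz_outside n (r + real k * (\<tau> * real N)) (2 * L / real N) (\<lambda>x a. fdiff \<tau> i (box N \<tau> k (\<lambda>y. f y a)) x)"
proof (induction k arbitrary: f r)
  case 0
  then show ?case by simp
next
  case (Suc k)
  interpret avg_weights "\<lambda>_. 1 / real N" "{0..<int N}" using N by (rule avg_weights_box)
  let ?\<rho> = "\<tau> * real N"
  let ?g = "\<lambda>x a. avg1 (\<lambda>_. 1 / real N) {0..<int N} \<tau> k (\<lambda>y. f y a) x"
  show ?case
  proof (cases "i < k")
    case True
    have "lipschitz_outside n (r + ?\<rho>) L ?g"
      by (rule lipschitz_outside_avg1[OF n Suc.prems(1) box_step[OF \<tau>]])
    then have "lipschitz_outside n ((r + ?\<rho>) + real k * ?\<rho>) (2 * L / real N) (\<lambda>x a. fdiff \<tau> i (box N \<tau> k (\<lambda>y. ?g y a)) x)"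
      using True by (rule Suc.IH)
    then show ?thesis by (simp add: algebra_simps)
  next
    \<comment> \<open>The average in coordinate \<open>i\<close> itself supplies the factor 1/N by
      telescoping; those in the other coordinates commute with the difference and preserve the
      bound.\<close>
    case False
    then have i: "i = k" using Suc.prems by simp
    let ?D = "\<lambda>x a. fdiff \<tau> k (\<lambda>y. ?g y a) x"
    have "lipschitz_outside n (r + ?\<rho>) (2 * L / real N) ?D"
      unfolding lipschitz_outside_def
    proof (intro allI impI)
      fix x y assume x: "r + ?\<rho> \<le> linf_norm n x" and y: "r + ?\<rho> \<le> linf_norm n y"
      let ?s = "\<lambda>x. x(k := x k + ?\<rho>)"
      have \<rho>: "\<bar>?\<rho>\<bar> \<le> ?\<rho>" "?\<rho> \<ge> 0" using \<tau> by auto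
      have "r \<le> linf_norm n (?s x)" "r \<le> linf_norm n (?s y)" "r \<le> linf_norm n x" "r \<le> linf_norm n y"
        using linf_norm_upd[OF n \<rho>(1)] x y \<rho>(2) by (smt (verit))+
      then have "l2_norm n (\<lambda>a. f (?s x) a - f (?s y) a) \<le> L * linf_norm n (\<lambda>j. ?s x j - ?s y j)"
         and 2: "l2_norm n (\<lambda>a. f x a - f y a) \<le> L * linf_norm n (\<lambda>j. x j - y j)"
        using Suc.prems(1) unfolding lipschitz_outside_def by blast+
      moreover have "(\<lambda>j. ?s x j - ?s y j) = (\<lambda>i. x i - y i)" by auto
      ultimately have 1: "l2_norm n (\<lambda>a. f (?s x) a - f (?s y) a) \<le> L * linf_norm n (\<lambda>i. x i - y i)" by metis
      have "l2_norm n (\<lambda>a. ?D x a - ?D y a)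
          = l2_norm n (\<lambda>a. (1 / real N) * ((f (?s x) a - f (?s y) a) - (f x a - f y a)))"
        unfolding fdiff_avg1_box[OF N]
        by (rule l2_norm_cong) (simp add: diff_divide_distrib right_diff_distrib del: fun_upd_apply)
      also have "\<dots> = (1 / real N) * l2_norm n (\<lambda>a. (f (?s x) a - f (?s y) a) - (f x a - f y a))"
        by (subst l2_norm_scale) simp
      also have "\<dots> \<le> (1 / real N) * (2 * L * linf_norm n (\<lambda>i. x i - y i))"
        using l2_norm_diff[of n "\<lambda>a. f (?s x) a - f (?s y) a" "\<lambda>a. f x a - f y a"] 1 2
        by (intro mult_left_mono) auto
      finally show "l2_norm n (\<lambda>a. ?D x a - ?D y a) \<le> 2 * L / real N * linf_norm n (\<lambda>i. x i - y i)"
        by simp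
    qed
    then have "lipschitz_outside n ((r + ?\<rho>) + real k * ?\<rho>) (2 * L / real N) (\<lambda>x a. box N \<tau> k (\<lambda>y. ?D y a) x)"
      using lipschitz_outside_avgs[OF n box_step[OF \<tau>], where f = ?D and k = k] by blast
    moreover have "fdiff \<tau> i (box N \<tau> (Suc k) (\<lambda>y. f y a)) = box N \<tau> k (\<lambda>y. ?D y a)" for a
      using fdiff_avgs[of k k] i by simp
    ultimately show ?thesis by (simp add: algebra_simps)
  qed
qed

text \<open>Greedy choice: each new sign makes the cross term with the sum so far nonnegative, so
  the square of the norm grows by at least the square of the new term.\<close>

lemma exists_signs:
  "\<exists>\<epsilon>::nat \<Rightarrow> real. (\<forall>i. \<epsilon> i = 1 \<or> \<epsilon> i = -1) \<and>
     (\<Sum>i<k. (l2_norm n (v i))\<^sup>2) \<le> (l2_norm n (\<lambda>a. \<Sum>i<k. \<epsilon> i * v i a))\<^sup>2"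
proof (induction k)
  case 0
  then show ?case by (intro exI[of _ "\<lambda>_. 1"]) auto
next
  case (Suc k)
  then obtain \<epsilon> :: "nat \<Rightarrow> real" where e: "\<forall>i. \<epsilon> i = 1 \<or> \<epsilon> i = -1"
    "(\<Sum>i<k. (l2_norm n (v i))\<^sup>2) \<le> (l2_norm n (\<lambda>a. \<Sum>i<k. \<epsilon> i * v i a))\<^sup>2" by blast
  define p where "p a = (\<Sum>i<k. \<epsilon> i * v i a)" for a
  define s :: real where "s = (if (\<Sum>a<n. p a * v k a) \<ge> 0 then 1 else -1)"
  define \<epsilon>' where "\<epsilon>' = \<epsilon>(k := s)"
  have s: "s = 1 \<or> s = -1" "s * (\<Sum>a<n. p a * v k a) \<ge> 0" by (auto simp: s_def)
  have "(\<Sum>i<Suc k. \<epsilon>' i * v i a) = p a + s * v k a" for a by (simp add: \<epsilon>'_def p_def)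
  then have "(l2_norm n (\<lambda>a. \<Sum>i<Suc k. \<epsilon>' i * v i a))\<^sup>2 = (\<Sum>a<n. (p a + s * v k a)\<^sup>2)"
    by (simp add: l2_norm_power2)
  also have "\<dots> = (\<Sum>a<n. (p a)\<^sup>2) + s\<^sup>2 * (\<Sum>a<n. (v k a)\<^sup>2) + 2 * (s * (\<Sum>a<n. p a * v k a))"
    by (simp add: power2_sum sum.distrib sum_distrib_left power_mult_distrib mult.assoc mult.left_commute)
  also have "\<dots> \<ge> (l2_norm n p)\<^sup>2 + (l2_norm n (v k))\<^sup>2"
    using s by (auto simp: l2_norm_power2)
  finally have "(\<Sum>i<Suc k. (l2_norm n (v i))\<^sup>2) \<le> (l2_norm n (\<lambda>a. \<Sum>i<Suc k. \<epsilon>' i * v i a))\<^sup>2"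
    using e(2) by (simp add: p_def[abs_def])
  then show ?case using e(1) s(1) by (intro exI[of _ \<epsilon>']) (auto simp: \<epsilon>'_def)
qed

text \<open>Along the vertex path with the signs of \<open>exists_signs\<close> the increments of \<open>f\<close> add up to
  nearly the signed sum of the partial differences, while the end points are at distance \<open>\<tau>\<close>.\<close>
lemma sum_fdiff_le:
  assumes n: "n \<ge> 1" and \<tau>: "\<tau> \<ge> 0" and f: "lipschitz_outside n r L f"
    and D: "\<And>i. i < n \<Longrightarrow> lipschitz_outside n r M (\<lambda>x a. fdiff \<tau> i (\<lambda>y. f y a) x)"
    and x: "r + \<tau> \<le> linf_norm n x" and "L \<ge> 0" "M \<ge> 0"
  shows "(\<Sum>i<n. (l2_norm n (\<lambda>a. fdiff \<tau> i (\<lambda>y. f y a) x))\<^sup>2) \<le> ((L + real n * M) * \<tau>)\<^sup>2"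
proof -
  define v where "v i a = fdiff \<tau> i (\<lambda>y. f y a) x" for i a
  obtain \<epsilon> :: "nat \<Rightarrow> real" where e: "\<And>i. \<epsilon> i = 1 \<or> \<epsilon> i = -1"
    "(\<Sum>i<n. (l2_norm n (v i))\<^sup>2) \<le> (l2_norm n (\<lambda>a. \<Sum>i<n. \<epsilon> i * v i a))\<^sup>2"
    using exists_signs[where k = n and n = n and v = v] by blast
  define y where "y k = (\<lambda>j. if j < k then x j + \<tau> * \<epsilon> j else x j)" for k
  have ye: "\<bar>x j - y k j\<bar> \<le> \<tau>" for k j using e(1)[of j] \<tau> by (auto simp: y_def)
  have yx: "linf_norm n (\<lambda>j. x j - y k j) \<le> \<tau>" for k
    using ye n by (simp add: linf_norm_le_iff)
  have yr: "r \<le> linf_norm n (y k)" for k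
    using linf_norm_triangle[OF n, of x "y k"] x yx[of k] by linarith
  have xr: "r \<le> linf_norm n x" using x \<tau> by linarith
  have step: "l2_norm n (\<lambda>a. f (y (Suc k)) a - f (y k) a - \<epsilon> k * v k a) \<le> M * \<tau>" if k: "k < n" for k
  proof -
    \<comment> \<open>A forward difference is based at the end of the edge with the smaller
      \<open>k\<close>-th coordinate, which is \<open>y k\<close> or \<open>y (Suc k)\<close>
      according to the sign.\<close>
    obtain j where j: "j = k \<or> j = Suc k" "\<And>a. f (y (Suc k)) a - f (y k) a = \<epsilon> k * fdiff \<tau> k (\<lambda>y. f y a) (y j)"
    proof (cases "\<epsilon> k = 1")
      case True
      have "y (Suc k) = (y k)(k := y k k + \<tau>)" by (auto simp: y_def True less_Suc_eq)
      then show ?thesis using that[of k] True by (simp add: fdiff_def)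
    next
      case False
      then have "\<epsilon> k = -1" using e(1) by blast
      then have "y k = (y (Suc k))(k := y (Suc k) k + \<tau>)" by (auto simp: y_def less_Suc_eq)
      then show ?thesis using that[of "Suc k"] \<open>\<epsilon> k = -1\<close> by (simp add: fdiff_def)
    qed
    have "l2_norm n (\<lambda>a. f (y (Suc k)) a - f (y k) a - \<epsilon> k * v k a)
       = l2_norm n (\<lambda>a. \<epsilon> k * (fdiff \<tau> k (\<lambda>y. f y a) (y j) - v k a))"
      by (rule l2_norm_cong) (simp only: j(2), simp add: algebra_simps)
    also have "\<dots> = l2_norm n (\<lambda>a. fdiff \<tau> k (\<lambda>y. f y a) (y j) - v k a)"
      using e(1)[of k] by (auto simp: l2_norm_scale)
    also have "\<dots> \<le> M * linf_norm n (\<lambda>i. y j i - x i)"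
      using D[OF k] yr xr unfolding lipschitz_outside_def v_def by blast
    also have "\<dots> \<le> M * \<tau>"
      using yx[of j] linf_norm_minus_commute[of n "y j" x] \<open>M \<ge> 0\<close> by (simp add: mult_left_mono)
    finally show ?thesis .
  qed
  have path: "l2_norm n (\<lambda>a. f (y k) a - f x a - (\<Sum>i<k. \<epsilon> i * v i a)) \<le> real k * (M * \<tau>)" if "k \<le> n" for k
    using that
  proof (induction k)
    case 0
    have "y 0 = x" by (simp add: y_def)
    then show ?case by (simp add: l2_norm_def L2_set_def)
  next
    case (Suc k)
    have "l2_norm n (\<lambda>a. f (y (Suc k)) a - f x a - (\<Sum>i<Suc k. \<epsilon> i * v i a))
       = l2_norm n (\<lambda>a. (f (y k) a - f x a - (\<Sum>i<k. \<epsilon> i * v i a)) + (f (y (Suc k)) a - f (y k) a - \<epsilon> k * v k a))"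
      by (rule l2_norm_cong) simp
    also have "\<dots> \<le> real k * (M * \<tau>) + M * \<tau>"
      by (rule order_trans[OF l2_norm_add add_mono]) (use Suc step in auto)
    finally show ?case by (simp add: algebra_simps)
  qed
  have "l2_norm n (\<lambda>a. \<Sum>i<n. \<epsilon> i * v i a)
     = l2_norm n (\<lambda>a. (f (y n) a - f x a) - (f (y n) a - f x a - (\<Sum>i<n. \<epsilon> i * v i a)))"
    by simp
  also have "\<dots> \<le> l2_norm n (\<lambda>a. f (y n) a - f x a) + real n * (M * \<tau>)"
    by (rule order_trans[OF l2_norm_diff add_mono]) (use path in auto)
  also have "l2_norm n (\<lambda>a. f (y n) a - f x a) \<le> L * linf_norm n (\<lambda>i. y n i - x i)"
    using f yr xr unfolding lipschitz_outside_def by blast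
  also have "\<dots> \<le> L * \<tau>"
    using yx[of n] linf_norm_minus_commute[of n "y n" x] \<open>L \<ge> 0\<close> by (simp add: mult_left_mono)
  finally have "l2_norm n (\<lambda>a. \<Sum>i<n. \<epsilon> i * v i a) \<le> (L + real n * M) * \<tau>"
    by (simp add: algebra_simps)
  then have "(l2_norm n (\<lambda>a. \<Sum>i<n. \<epsilon> i * v i a))\<^sup>2 \<le> ((L + real n * M) * \<tau>)\<^sup>2"
    by (rule power_mono) (rule l2_norm_nonneg)
  then show ?thesis using e(2) unfolding v_def by linarith
qed

section \<open>Two-sided geometric noise\<close>

definition geom_Z :: "real \<Rightarrow> nat \<Rightarrow> real"
  where "geom_Z q M = (\<Sum>k = - int M..int M. q ^ nat \<bar>k\<bar>)"

text \<open>A discretised two-sided exponential law. The weight itself does not vanish beyond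
  \<open>M\<close>; the truncation lies in the index set \<open>{- int M..int M}\<close> over which
  averages are taken.\<close>

definition geom_w :: "real \<Rightarrow> nat \<Rightarrow> int \<Rightarrow> real"
  where "geom_w q M k = q ^ nat \<bar>k\<bar> / geom_Z q M"

lemma int_interval_Suc:
  "{- int (Suc M)..int (Suc M)} = insert (int M + 1) (insert (- int M - 1) {- int M..int M})"
  "{- int (Suc M)..<int (Suc M)} = insert (int M) (insert (- int M - 1) {- int M..<int M})"
  by auto

lemma geom_Z_pos: "0 < q \<Longrightarrow> 0 < geom_Z q M"
  unfolding geom_Z_def by (rule sum_pos) auto

text \<open>The full two-sided series has sum (1 + q)/(1 - q); the induction keeps exact account of
  the two missing tails.\<close>

lemma geom_Z_le:
  assumes "0 < q" "q < 1"
  shows "geom_Z q M \<le> 2 / (1 - q)"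
proof -
  have "geom_Z q M + 2 * q ^ Suc M / (1 - q) = (1 + q) / (1 - q)"
  proof (induction M)
    case 0
    then show ?case using assms by (simp add: geom_Z_def field_simps)
  next
    case (Suc M)
    have "nat (1 + int M) = Suc M" "nat (int M + 1) = Suc M" by simp_all
    then have "geom_Z q (Suc M) = geom_Z q M + 2 * q ^ Suc M"
      unfolding geom_Z_def int_interval_Suc by (simp add: abs_if)
    moreover have "2 * q ^ Suc M + 2 * q ^ Suc (Suc M) / (1 - q) = 2 * q ^ Suc M / (1 - q)"
      using assms by (simp add: field_simps)
    ultimately show ?case using Suc by linarith
  qed
  moreover have "0 \<le> 2 * q ^ Suc M / (1 - q)" using assms by simp
  moreover have "(1 + q) / (1 - q) \<le> 2 / (1 - q)" using assms by (simp add: divide_right_mono)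
  ultimately show ?thesis by linarith
qed

lemma avg_weights_geom:
  assumes "0 < q"
  shows "avg_weights (geom_w q M) {- int M..int M}"
proof
  show "(\<Sum>k = - int M..int M. geom_w q M k) = 1"
    using geom_Z_pos[OF assms, of M]
    by (simp add: geom_w_def sum_divide_distrib[symmetric] geom_Z_def)
qed (use assms geom_Z_pos[of q M] in \<open>auto simp: geom_w_def less_imp_le\<close>)

text \<open>Summation by parts: the discrete form of bounding the integral of u^2 against a
  two-sided exponential by that of the modulus of its derivative, for u(0) = 0. The end terms on the
  left, equal to what the remaining tails would contribute if \<open>u\<close> stayed constant
  there, make the induction on \<open>M\<close> close.\<close>

lemma geom_abel:
  fixes u :: "int \<Rightarrow> real"
  assumes q: "0 < q" "q < 1" and u0: "u 0 = 0"
  defines "e \<equiv> \<lambda>k. 2 * \<bar>u k\<bar> * \<bar>u (k + 1) - u k\<bar> + (u (k + 1) - u k)\<^sup>2"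
  shows "(\<Sum>k = - int M..int M. q ^ nat \<bar>k\<bar> * (u k)\<^sup>2) + q ^ Suc M / (1 - q) * ((u (int M))\<^sup>2 + (u (- int M))\<^sup>2)
     \<le> 1 / (1 - q) * (\<Sum>k = - int M..<int M. q ^ nat \<bar>k\<bar> * e k)"
proof (induction M)
  case 0
  then show ?case using u0 by simp
next
  case (Suc M)
  have e: "\<bar>(u (k + 1))\<^sup>2 - (u k)\<^sup>2\<bar> \<le> e k" for k
  proof -
    have "(u (k + 1))\<^sup>2 - (u k)\<^sup>2 = 2 * u k * (u (k + 1) - u k) + (u (k + 1) - u k)\<^sup>2"
      by (simp add: power2_eq_square algebra_simps)
    also have "\<bar>\<dots>\<bar> \<le> e k"
      unfolding e_def by (rule order_trans[OF abs_triangle_ineq]) (simp add: abs_mult)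
    finally show ?thesis .
  qed
  have n: "nat (1 + int M) = Suc M" by simp
  have S1: "(\<Sum>k = - int (Suc M)..int (Suc M). q ^ nat \<bar>k\<bar> * (u k)\<^sup>2) =
      (\<Sum>k = - int M..int M. q ^ nat \<bar>k\<bar> * (u k)\<^sup>2) + q ^ Suc M * ((u (int M + 1))\<^sup>2 + (u (- int M - 1))\<^sup>2)"
    unfolding int_interval_Suc using n by (simp add: abs_if algebra_simps)
  have S2: "(\<Sum>k = - int (Suc M)..<int (Suc M). q ^ nat \<bar>k\<bar> * e k) =
      (\<Sum>k = - int M..<int M. q ^ nat \<bar>k\<bar> * e k) + q ^ M * e (int M) + q ^ Suc M * e (- int M - 1)"
    unfolding int_interval_Suc using n by (simp add: abs_if)
  have "0 \<le> e (int M)" by (simp add: e_def)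
  \<comment> \<open>On the positive side an increment carries the weight of its end nearer to 0,
    more than required by a factor 1/q; on the negative side \<open>k\<close> is the far end and the
    weights match.\<close>
  have "q ^ Suc M * e (int M) \<le> q ^ M * e (int M)"
    using q \<open>0 \<le> e (int M)\<close> by (intro mult_right_mono) auto
  moreover have "q ^ Suc M * ((u (int M + 1))\<^sup>2 - (u (int M))\<^sup>2) \<le> q ^ Suc M * e (int M)"
    using e[of "int M"] q by (intro mult_left_mono) auto
  moreover have "q ^ Suc M * ((u (- int M - 1))\<^sup>2 - (u (- int M))\<^sup>2) \<le> q ^ Suc M * e (- int M - 1)"
    using e[of "- int M - 1"] q by (intro mult_left_mono) auto
  ultimately have "q ^ Suc M * ((u (int M + 1))\<^sup>2 + (u (- int M - 1))\<^sup>2) - q ^ Suc M * ((u (int M))\<^sup>2 + (u (- int M))\<^sup>2)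
    \<le> q ^ M * e (int M) + q ^ Suc M * e (- int M - 1)"
    by (simp add: algebra_simps)
  then have "1 / (1 - q) * (q ^ Suc M * ((u (int M + 1))\<^sup>2 + (u (- int M - 1))\<^sup>2) - q ^ Suc M * ((u (int M))\<^sup>2 + (u (- int M))\<^sup>2))
    \<le> 1 / (1 - q) * (q ^ M * e (int M) + q ^ Suc M * e (- int M - 1))"
    using q by (intro mult_left_mono) auto
  moreover have "q ^ Suc M * X + q ^ Suc (Suc M) / (1 - q) * X = 1 / (1 - q) * (q ^ Suc M * X)" for X
  proof -
    have "q ^ Suc M + q ^ Suc (Suc M) / (1 - q) = q ^ Suc M / (1 - q)"
      using q by (simp add: field_simps)
    then show ?thesis by (metis distrib_right mult.assoc mult.commute mult_1 times_divide_eq_right)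
  qed
  note this[of "(u (int M + 1))\<^sup>2 + (u (- int M - 1))\<^sup>2"]
  moreover have "int (Suc M) = int M + 1" "- int (Suc M) = - int M - 1" by simp_all
  moreover have "q ^ Suc M / (1 - q) * X = 1 / (1 - q) * (q ^ Suc M * X)" for X by simp
  note this[of "(u (int M))\<^sup>2 + (u (- int M))\<^sup>2"]
  ultimately show ?case
    using Suc.IH unfolding S1 S2
    by (simp only: right_diff_distrib distrib_left[of "1 / (1 - q)"])
qed

text \<open>Subtracting \<open>g 0\<close> leaves the variance unchanged and makes
  \<open>geom_abel\<close> applicable; the cross term in its right side is then split so that half
  of the second moment \<open>S\<close> can be absorbed.\<close>

lemma geom_Poincare:
  fixes g :: "int \<Rightarrow> real" and M :: nat
  assumes q: "0 < q" "q < 1"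
  defines "J \<equiv> {- int M..int M}" and "w \<equiv> geom_w q M"
  shows "(\<Sum>k\<in>J. w k * (g k)\<^sup>2) - (\<Sum>k\<in>J. w k * g k)\<^sup>2
           \<le> (2 / (1 - q) + 1)\<^sup>2 * (\<Sum>k\<in>J. w k * (g (k + 1) - g k)\<^sup>2)"
proof -
  interpret avg_weights w J unfolding w_def J_def using q by (intro avg_weights_geom)
  define u where "u k = g k - g 0" for k
  define c where "c = 1 / (1 - q)"
  have c: "c > 0" using q by (simp add: c_def)
  define S where "S = (\<Sum>k\<in>J. w k * (u k)\<^sup>2)"
  define D where "D = (\<Sum>k\<in>J. w k * (g (k + 1) - g k)\<^sup>2)"
  define e where "e k = 2 * \<bar>u k\<bar> * \<bar>u (k + 1) - u k\<bar> + (u (k + 1) - u k)\<^sup>2" for k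
  define Z where "Z = geom_Z q M"
  have Z: "Z > 0" using q geom_Z_pos by (simp add: Z_def)
  have wZ: "w k = q ^ nat \<bar>k\<bar> / Z" for k by (simp add: w_def geom_w_def Z_def)
  have D0: "D \<ge> 0" unfolding D_def by (intro sum_nonneg mult_nonneg_nonneg w_nonneg) auto
  have "(\<Sum>k\<in>J. w k * (g k)\<^sup>2) - (\<Sum>k\<in>J. w k * g k)\<^sup>2 = S - (\<Sum>k\<in>J. w k * u k)\<^sup>2"
  proof -
    have U: "(\<Sum>k\<in>J. w k * u k) = (\<Sum>k\<in>J. w k * g k) - g 0"
      by (simp add: u_def right_diff_distrib sum_subtractf sum_distrib_right[symmetric] w_sum)
    have "S = (\<Sum>k\<in>J. w k * (g k)\<^sup>2 - (2 * g 0) * (w k * g k) + (g 0)\<^sup>2 * w k)"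
      unfolding S_def u_def by (rule sum.cong) (auto simp: power2_eq_square algebra_simps)
    then have S: "S = (\<Sum>k\<in>J. w k * (g k)\<^sup>2) - 2 * g 0 * (\<Sum>k\<in>J. w k * g k) + (g 0)\<^sup>2"
      by (simp only: sum.distrib sum_subtractf sum_distrib_left[symmetric] w_sum mult_1_right)
    show ?thesis unfolding U S by (simp add: power2_eq_square algebra_simps)
  qed
  then have 1: "(\<Sum>k\<in>J. w k * (g k)\<^sup>2) - (\<Sum>k\<in>J. w k * g k)\<^sup>2 \<le> S" by simp
  have "(\<Sum>k\<in>J. q ^ nat \<bar>k\<bar> * (u k)\<^sup>2) \<le> c * (\<Sum>k = - int M..<int M. q ^ nat \<bar>k\<bar> * e k)"
  proof -
    have "0 \<le> q ^ Suc M / (1 - q) * ((u (int M))\<^sup>2 + (u (- int M))\<^sup>2)" using q by simp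
    then show ?thesis
      using geom_abel[OF q, of u M] unfolding e_def c_def J_def by (simp add: u_def)
  qed
  \<comment> \<open>The added term k = M looks at \<open>g\<close> one step beyond the support. It
    is nonnegative, and with it the differences are averaged under the same law as the
    function.\<close>
  also have "\<dots> \<le> c * (\<Sum>k\<in>J. q ^ nat \<bar>k\<bar> * e k)"
    unfolding J_def using q c by (intro mult_left_mono sum_mono2) (auto simp: e_def)
  finally have "S * Z \<le> c * (\<Sum>k\<in>J. w k * e k) * Z"
    using Z by (simp add: S_def wZ sum_distrib_right mult.assoc)
  then have "S \<le> c * (\<Sum>k\<in>J. w k * e k)" using Z by simp
  \<comment> \<open>Young's inequality with weight 1/(2c): after multiplication by \<open>c\<close>
    the term in \<open>u\<close> is exactly S/2.\<close>
  also have "\<dots> \<le> c * (\<Sum>k\<in>J. w k * ((1 / (2 * c)) * (u k)\<^sup>2 + (2 * c + 1) * (g (k + 1) - g k)\<^sup>2))"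
  proof (intro mult_left_mono sum_mono w_nonneg)
    fix k
    define d where "d = \<bar>g (k + 1) - g k\<bar>"
    have "0 \<le> (\<bar>u k\<bar> - 2 * c * d)\<^sup>2 / (2 * c)" using c by simp
    also have "\<dots> = (1 / (2 * c)) * (u k)\<^sup>2 + 2 * c * d\<^sup>2 - 2 * \<bar>u k\<bar> * d"
      using c by (simp add: power2_diff power_mult_distrib field_simps power2_eq_square)
    finally show "e k \<le> (1 / (2 * c)) * (u k)\<^sup>2 + (2 * c + 1) * (g (k + 1) - g k)\<^sup>2"
      by (simp add: e_def u_def d_def algebra_simps)
  qed (use c in auto)
  also have "\<dots> = c * ((1 / (2 * c)) * S + (2 * c + 1) * D)"
    by (simp add: S_def D_def sum_distrib_left sum.distrib distrib_left mult.left_commute)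
  also have "\<dots> = S / 2 + c * (2 * c + 1) * D" using c by (simp add: field_simps)
  finally have "S \<le> 2 * c * (2 * c + 1) * D" by simp
  also have "\<dots> \<le> (2 * c + 1)\<^sup>2 * D"
    using c D0 by (intro mult_right_mono) (auto simp: power2_eq_square algebra_simps)
  finally show ?thesis using 1 by (simp add: c_def D_def)
qed

section \<open>Probability that the noise leaves the cube\<close>

definition geom_tail :: "real \<Rightarrow> nat \<Rightarrow> nat \<Rightarrow> real"
  where "geom_tail q M K = (\<Sum>k = int K..int M. geom_w q M k)"

lemma geom_tail_ge:
  assumes q: "0 < q" "q < 1" and K: "K \<le> Suc M"
  shows "(q ^ K - q ^ Suc M) / 2 \<le> geom_tail q M K"
proof -
  have "geom_tail q M K = (\<Sum>k = K..M. q ^ k) / geom_Z q M"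
  proof -
    have "{int K..int M} = int ` {K..M}" by (simp add: image_int_atLeastAtMost)
    then show ?thesis
      unfolding geom_tail_def by (simp add: sum.reindex geom_w_def sum_divide_distrib)
  qed
  also have "(\<Sum>k = K..M. q ^ k) = (q ^ K - q ^ Suc M) / (1 - q)"
    using sum_gp[of q K M] q K by (cases "K = Suc M") auto
  finally have eq: "geom_tail q M K = (q ^ K - q ^ Suc M) / (1 - q) / geom_Z q M" .
  have ge: "0 \<le> (q ^ K - q ^ Suc M) / (1 - q)"
    using q K power_decreasing[of K "Suc M" q] by simp
  have "(q ^ K - q ^ Suc M) / 2 = (q ^ K - q ^ Suc M) / (1 - q) / (2 / (1 - q))"
    using q by (simp add: field_simps)
  also have "\<dots> \<le> geom_tail q M K"
    unfolding eq using ge geom_Z_le[OF q] geom_Z_pos[OF q(1)] q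
    by (intro divide_left_mono mult_pos_pos) auto
  finally show ?thesis .
qed

text \<open>Wherever \<open>x\<close> lies, the tail of the noise pointing away from the origin
  carries it to modulus at least \<open>r\<close>. The bound is therefore uniform in the
  centre.\<close>

lemma geom_indicator_le:
  assumes q: "0 < q" and \<tau>: "\<tau> \<ge> 0" "r \<le> \<tau> * real K" 
  shows "(\<Sum>k = - int M..int M. geom_w q M k * (if \<bar>x + \<tau> * of_int k\<bar> < r then 1 else 0)) \<le> 1 - geom_tail q M K"
proof -
  let ?J = "{- int M..int M}"
  interpret avg_weights "geom_w q M" ?J using q by (rule avg_weights_geom)
  obtain A where A: "A \<subseteq> ?J" "(\<Sum>k\<in>A. geom_w q M k) = geom_tail q M K"
    "\<And>k. k \<in> A \<Longrightarrow> r \<le> \<bar>x + \<tau> * of_int k\<bar>"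
  proof (cases "x \<ge> 0")
    case True
    show ?thesis
    proof (rule that)
      show "{int K..int M} \<subseteq> ?J" by auto
      show "sum (geom_w q M) {int K..int M} = geom_tail q M K" by (simp add: geom_tail_def)
      fix k assume "k \<in> {int K..int M}"
      then have "real K \<le> of_int k" by simp
      then have "\<tau> * real K \<le> \<tau> * of_int k" using \<tau> by (intro mult_left_mono) auto
      then show "r \<le> \<bar>x + \<tau> * of_int k\<bar>" using True \<tau> by linarith
    qed
  next
    case False
    show ?thesis
    proof (rule that)
      show "uminus ` {int K..int M} \<subseteq> ?J" by auto
      show "sum (geom_w q M) (uminus ` {int K..int M}) = geom_tail q M K"
        unfolding geom_tail_def by (subst sum.reindex) (auto simp: geom_w_def)
      fix k assume "k \<in> uminus ` {int K..int M}"
      then have "real K \<le> of_int (-k)" by auto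
      then have "\<tau> * real K \<le> \<tau> * of_int (-k)" using \<tau> by (intro mult_left_mono) auto
      then show "r \<le> \<bar>x + \<tau> * of_int k\<bar>" using False \<tau> by simp
    qed
  qed
  have "(\<Sum>k\<in>?J. geom_w q M k * (if \<bar>x + \<tau> * of_int k\<bar> < r then 1 else 0)) \<le> (\<Sum>k\<in>?J. geom_w q M k * (if k \<in> A then 0 else 1))"
    using A(3) by (intro sum_mono mult_left_mono w_nonneg) (force simp: not_less)
  also have "\<dots> = sum (geom_w q M) (?J - A)"
    by (simp add: if_distrib[of "\<lambda>t. geom_w q M _ * t"] sum.If_cases Diff_eq Collect_neg_eq cong: if_cong)
  also have "\<dots> = 1 - geom_tail q M K"
    using A w_sum by (simp add: sum_diff)
  finally show ?thesis .
qed

text \<open>Independence of the coordinates. Uniformity in \<open>x\<close> is essential, since the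
  bound is later applied at a zero whose position is unknown.\<close>

lemma avgs_indicator_le:
  assumes q: "0 < q" and \<tau>: "\<tau> \<ge> 0" "r \<le> \<tau> * real K"
  shows "avgs (geom_w q M) {- int M..int M} \<tau> n (\<lambda>x. if \<forall>i<n. \<bar>x i\<bar> < r then 1 else 0) x
           \<le> (1 - geom_tail q M K) ^ n"
proof -
  let ?J = "{- int M..int M}"
  interpret avg_weights "geom_w q M" ?J using q by (rule avg_weights_geom)
  have p: "0 \<le> 1 - geom_tail q M K"
    by (rule order_trans[OF _ geom_indicator_le[OF q \<tau>, of M 0]]) (intro sum_nonneg, auto simp: w_nonneg)
  let ?chi = "\<lambda>k (x::nat \<Rightarrow> real). if \<forall>i<k. \<bar>x i\<bar> < r then 1 else 0 :: real"
  show ?thesis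
  proof (induction n)
    case 0
    then show ?case by simp
  next
    case (Suc n)
    have "avg1 (geom_w q M) ?J \<tau> n (?chi (Suc n)) y \<le> (1 - geom_tail q M K) * ?chi n y" for y
    proof (cases "\<forall>i<n. \<bar>y i\<bar> < r")
      case True
      then have "?chi (Suc n) (y(n := z)) = (if \<bar>z\<bar> < r then 1 else 0)" for z
        by (auto simp: less_Suc_eq)
      then show ?thesis
        using geom_indicator_le[OF q \<tau>, of M "y n"] True by (simp add: avg1_def)
    next
      case False
      have "avg1 (geom_w q M) ?J \<tau> n (?chi (Suc n)) y = 0"
        unfolding avg1_def
      proof (rule sum.neutral, intro ballI)
        fix k
        obtain i where "i < n" "\<not> \<bar>y i\<bar> < r" using False by blast
        then have "\<not> (\<forall>i<Suc n. \<bar>(y(n := y n + \<tau> * of_int k)) i\<bar> < r)"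
          by (intro notI) (drule spec[of _ i], simp)
        then show "geom_w q M k * ?chi (Suc n) (y(n := y n + \<tau> * of_int k)) = 0" by (simp only: if_False mult_zero_right)
      qed
      moreover have "?chi n y = 0" using False by (rule if_not_P)
      ultimately show ?thesis by (simp only: mult_zero_right order_refl)
    qed
    then have "avgs (geom_w q M) ?J \<tau> (Suc n) (?chi (Suc n)) x
       \<le> avgs (geom_w q M) ?J \<tau> n (\<lambda>y. (1 - geom_tail q M K) * ?chi n y) x"
      unfolding avgs.simps by (rule avgs_mono)
    also have "\<dots> = (1 - geom_tail q M K) * avgs (geom_w q M) ?J \<tau> n (?chi n) x"
      by (rule avgs_scale)
    also have "\<dots> \<le> (1 - geom_tail q M K) * (1 - geom_tail q M K) ^ n"
      using p Suc by (intro mult_left_mono)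
    finally show ?case by simp
  qed
qed

text \<open>Each single-coordinate average moves the value by at most \<open>L * \<rho>\<close>,
  because averaging does not destroy the Lipschitz bound for the next one.\<close>

lemma (in avg_weights) avgs_close:
  assumes n: "n \<ge> 1" and \<rho>: "\<And>k. k \<in> J \<Longrightarrow> \<bar>\<tau> * of_int k\<bar> \<le> \<rho>" and "L \<ge> 0"
  shows "(\<And>r. lipschitz_outside n r L f) \<Longrightarrow>
    l2_norm n (\<lambda>a. avgs w J \<tau> k (\<lambda>y. f y a) x - f x a) \<le> real k * (L * \<rho>)"
proof (induction k arbitrary: f)
  case 0
  then show ?case by (simp add: l2_norm_def L2_set_def)
next
  case (Suc k)
  let ?g = "\<lambda>x a. avg1 w J \<tau> k (\<lambda>y. f y a) x"
  have "lipschitz_outside n r L ?g" for r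
    using lipschitz_outside_avg1[OF n Suc.prems \<rho>, of "r - \<rho>" k] by simp
  then have 1: "l2_norm n (\<lambda>a. avgs w J \<tau> k (\<lambda>y. ?g y a) x - ?g x a) \<le> real k * (L * \<rho>)"
    by (rule Suc.IH)
  have "?g x a - f x a = (\<Sum>j\<in>J. w j * (f (x(k := x k + \<tau> * of_int j)) a - f x a))" for a
    by (simp add: avg1_def right_diff_distrib sum_subtractf sum_distrib_right[symmetric] w_sum)
  then have "l2_norm n (\<lambda>a. ?g x a - f x a) \<le> (\<Sum>j\<in>J. l2_norm n (\<lambda>a. w j * (f (x(k := x k + \<tau> * of_int j)) a - f x a)))"
    using l2_norm_sum[OF fin] by simp
  also have "\<dots> \<le> (\<Sum>j\<in>J. w j * (L * \<rho>))"
  proof (rule sum_mono)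
    fix j assume j: "j \<in> J"
    let ?y = "x(k := x k + \<tau> * of_int j)"
    have "l2_norm n (\<lambda>a. f ?y a - f x a) \<le> L * linf_norm n (\<lambda>i. ?y i - x i)"
      using Suc.prems[of "min (linf_norm n x) (linf_norm n ?y)"] unfolding lipschitz_outside_def
      by (meson min.cobounded1 min.cobounded2)
    also have "linf_norm n (\<lambda>i. ?y i - x i) \<le> \<rho>"
      using \<rho>[OF j] n by (auto simp: linf_norm_le_iff)
    finally have "l2_norm n (\<lambda>a. f ?y a - f x a) \<le> L * \<rho>" using \<open>L \<ge> 0\<close> by (simp add: mult_left_mono)
    then show "l2_norm n (\<lambda>a. w j * (f ?y a - f x a)) \<le> w j * (L * \<rho>)"
      using w_nonneg[of j] by (simp add: l2_norm_scale mult_left_mono del: fun_upd_apply)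
  qed
  also have "\<dots> = L * \<rho>" by (simp add: sum_distrib_right[symmetric] w_sum)
  finally have 2: "l2_norm n (\<lambda>a. ?g x a - f x a) \<le> L * \<rho>" .
  have "l2_norm n (\<lambda>a. avgs w J \<tau> (Suc k) (\<lambda>y. f y a) x - f x a)
     = l2_norm n (\<lambda>a. (avgs w J \<tau> k (\<lambda>y. ?g y a) x - ?g x a) + (?g x a - f x a))"
    by simp
  also have "\<dots> \<le> real k * (L * \<rho>) + L * \<rho>"
    by (rule order_trans[OF l2_norm_add add_mono[OF 1 2]])
  finally show ?case by (simp add: algebra_simps)
qed

text \<open>If the noisy average of \<open>f\<close> vanishes at \<open>x\<close>, its variance is at least the probability of
  leaving the cube, while the Poincare inequality bounds it by the Lipschitz constant.\<close>
lemma avgs_eq_0_imp: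
  fixes f :: "(nat \<Rightarrow> real) \<Rightarrow> nat \<Rightarrow> real"
  assumes n: "n \<ge> 1" and q: "0 < q" "q < 1" and N: "N \<ge> 1" and \<tau>: "\<tau> \<ge> 0"
    and L: "0 \<le> L" "0 \<le> L'"
    and f: "lipschitz_outside n 1 L f" and f': "\<And>r. lipschitz_outside n r L' f"
    and unit: "\<And>x. 1 \<le> linf_norm n x \<Longrightarrow> l2_norm n (f x) = 1"
    and small: "L' * (real n * real N * \<tau>) \<le> 1"
    and P: "avgs (geom_w q M) {- int M..int M} \<tau> n
              (\<lambda>x. if \<forall>i<n. \<bar>x i\<bar> < 1 + (real n * real N + 1) * \<tau> then 1 else 0) x \<le> P"
    and zero: "\<And>a. a < n \<Longrightarrow> avgs (geom_w q M) {- int M..int M} \<tau> n (box N \<tau> n (\<lambda>y. f y a)) x = 0"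
  shows "(1 - L' * (real n * real N * \<tau>))\<^sup>2 * (1 - P)
     \<le> (2 / (1 - q) + 1)\<^sup>2 * ((1 + 2 * real n / real N) * \<tau>)\<^sup>2 * (L\<^sup>2 + L'\<^sup>2 * P)"
proof -
  let ?J = "{- int M..int M}" and ?w = "geom_w q M"
  interpret avg_weights ?w ?J using q by (intro avg_weights_geom)
  interpret bx: avg_weights "\<lambda>_. 1 / real N" "{0..<int N}" using N by (rule avg_weights_box)
  define E where "E = avgs ?w ?J \<tau> n"
  define F where "F y a = box N \<tau> n (\<lambda>y. f y a) y" for y a
  \<comment> \<open>The margin \<open>n * N * \<tau>\<close> covers the shifts of the box average,
    the extra \<open>\<tau>\<close> the vertex path in \<open>sum_fdiff_le\<close>.\<close>
  define r where "r = 1 + (real n * real N + 1) * \<tau>"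
  define bad :: "(nat \<Rightarrow> real) \<Rightarrow> real" where "bad y = (if \<forall>i<n. \<bar>y i\<bar> < r then 1 else 0)" for y
  define \<kappa> where "\<kappa> = 1 + 2 * real n / real N"
  define C where "C = (2 / (1 - q) + 1)\<^sup>2"
  define \<eta> where "\<eta> = L' * (real n * real N * \<tau>)"
  define \<Gamma> where "\<Gamma> y = (\<Sum>i<n. (l2_norm n (\<lambda>a. fdiff \<tau> i (\<lambda>y. F y a) y))\<^sup>2)" for y
  have chi: "bad y = (if r \<le> linf_norm n y then 0 else 1)" for y
  proof -
    obtain i where i: "i < n" "linf_norm n y = \<bar>y i\<bar>" using linf_norm_attained[OF n] by blast
    have "(\<forall>i<n. \<bar>y i\<bar> < r) \<longleftrightarrow> \<not> r \<le> linf_norm n y"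
      using i abs_le_linf_norm[of _ n y] by fastforce
    then show ?thesis by (simp add: bad_def)
  qed
  \<comment> \<open>Used twice: with the good constant \<open>L\<close> at radius 1 when
    \<open>y\<close> is far enough out, and with the global constant \<open>L'\<close> at a radius
    adapted to \<open>y\<close> otherwise.\<close>
  have Gamma: "\<Gamma> y \<le> (\<kappa> * \<tau>)\<^sup>2 * B\<^sup>2" if B: "0 \<le> B" "lipschitz_outside n s B f" 
      and y: "s + (real n * real N + 1) * \<tau> \<le> linf_norm n y" for B s y
  proof -
    let ?s = "s + real n * (\<tau> * real N)"
    have 1: "lipschitz_outside n ?s B F"
      unfolding F_def[abs_def] by (rule bx.lipschitz_outside_avgs[OF n box_step[OF \<tau>] B(2)])
    have 2: "lipschitz_outside n ?s (2 * B / real N) (\<lambda>x a. fdiff \<tau> i (\<lambda>y. F y a) x)" if "i < n" for i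
      unfolding F_def[abs_def] by (rule lipschitz_outside_fdiff_box[OF n N \<tau> B(1) B(2) that])
    have "\<Gamma> y \<le> ((B + real n * (2 * B / real N)) * \<tau>)\<^sup>2"
      unfolding \<Gamma>_def by (rule sum_fdiff_le[OF n \<tau> 1 2]) (use y B in \<open>auto simp: algebra_simps\<close>)
    also have "(B + real n * (2 * B / real N)) * \<tau> = (\<kappa> * \<tau>) * B"
      by (simp add: \<kappa>_def algebra_simps)
    finally show ?thesis by (simp add: power_mult_distrib)
  qed
  have G: "\<Gamma> y \<le> (\<kappa> * \<tau>)\<^sup>2 * (L\<^sup>2 + L'\<^sup>2 * bad y)" for y
  proof (cases "r \<le> linf_norm n y")
    case True
    then show ?thesis using Gamma[OF L(1) f, of y] by (simp add: chi r_def)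
  next
    case False
    have "\<Gamma> y \<le> (\<kappa> * \<tau>)\<^sup>2 * L'\<^sup>2"
      by (rule Gamma[OF L(2) f', of "linf_norm n y - (real n * real N + 1) * \<tau>"]) simp
    also have "\<dots> \<le> (\<kappa> * \<tau>)\<^sup>2 * (L\<^sup>2 + L'\<^sup>2 * bad y)"
      using False by (intro mult_left_mono) (auto simp: chi)
    finally show ?thesis .
  qed
  have EP: "E bad x \<le> P" using P by (simp add: E_def bad_def[abs_def] r_def)
  have "(1 - \<eta>)\<^sup>2 * (1 - bad y) \<le> (\<Sum>a<n. (F y a)\<^sup>2)" for y
  proof (cases "r \<le> linf_norm n y")
    case True
    moreover have "r \<ge> 1" using \<tau> by (simp add: r_def)
    ultimately have "l2_norm n (f y) = 1" using unit by simp
    moreover have "l2_norm n (\<lambda>a. F y a - f y a) \<le> real n * (L' * (\<tau> * real N))"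
      unfolding F_def by (rule bx.avgs_close[OF n box_step[OF \<tau>] L(2) f'])
    moreover have "real n * (L' * (\<tau> * real N)) = \<eta>" by (simp add: \<eta>_def)
    ultimately have "1 - \<eta> \<le> l2_norm n (F y)"
      using l2_norm_triangle[of n "f y" "F y"] l2_norm_minus_commute[of n "f y" "F y"] by simp
    then have "(1 - \<eta>)\<^sup>2 \<le> (l2_norm n (F y))\<^sup>2"
      using small by (intro power_mono) (auto simp: \<eta>_def)
    then show ?thesis using True by (simp add: chi l2_norm_power2)
  next
    case False
    then show ?thesis by (simp add: chi sum_nonneg)
  qed
  then have "E (\<lambda>y. (1 - \<eta>)\<^sup>2 * (1 - bad y)) x \<le> E (\<lambda>y. \<Sum>a<n. (F y a)\<^sup>2) x"
    unfolding E_def by (intro avgs_mono)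
  moreover have "E (\<lambda>y. (1 - \<eta>)\<^sup>2 * (1 - bad y)) x = (1 - \<eta>)\<^sup>2 * (1 - E bad x)"
    using avgs_add[of ?w ?J \<tau> n "\<lambda>y. 1" "\<lambda>y. - 1 * bad y" x] avgs_scale[of ?w ?J \<tau> n "-1" bad x]
    by (simp add: E_def avgs_scale avgs_const)
  ultimately have "(1 - \<eta>)\<^sup>2 * (1 - E bad x) \<le> (\<Sum>a<n. E (\<lambda>y. (F y a)\<^sup>2) x)"
    by (simp add: E_def avgs_sum)
  \<comment> \<open>The hypothesis \<open>zero\<close> makes each component have mean 0, so its
    second moment is its variance. Summing the Poincare inequality over components reassembles the
    Euclidean norms in \<open>\<Gamma>\<close>.\<close>
  also have "\<dots> \<le> (\<Sum>a<n. C * (\<Sum>i<n. E (\<lambda>y. (fdiff \<tau> i (\<lambda>y. F y a) y)\<^sup>2) x))"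
  proof (rule sum_mono)
    fix a assume "a \<in> {..<n}"
    then have "E (\<lambda>y. F y a) x = 0" using zero[of a] by (simp add: E_def F_def)
    moreover have "C \<ge> 0" by (simp add: C_def)
    ultimately show "E (\<lambda>y. (F y a)\<^sup>2) x \<le> C * (\<Sum>i<n. E (\<lambda>y. (fdiff \<tau> i (\<lambda>y. F y a) y)\<^sup>2) x)"
      using avgs_Poincare[OF geom_Poincare[OF q, of M], where n = n and f = "\<lambda>y. F y a" and x = x and \<tau> = \<tau>]
      by (simp add: E_def C_def)
  qed
  also have "\<dots> = C * E \<Gamma> x"
  proof -
    have "(\<Sum>a<n. \<Sum>i<n. E (\<lambda>y. (fdiff \<tau> i (\<lambda>y. F y a) y)\<^sup>2) x)
        = (\<Sum>i<n. \<Sum>a<n. E (\<lambda>y. (fdiff \<tau> i (\<lambda>y. F y a) y)\<^sup>2) x)"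
      by (rule sum.swap)
    also have "\<dots> = E \<Gamma> x"
      by (simp add: E_def \<Gamma>_def[abs_def] avgs_sum l2_norm_power2)
    finally show ?thesis by (simp add: sum_distrib_left[symmetric])
  qed
  also have "\<dots> \<le> C * ((\<kappa> * \<tau>)\<^sup>2 * (L\<^sup>2 + L'\<^sup>2 * E bad x))"
  proof (rule mult_left_mono)
    have "E \<Gamma> x \<le> E (\<lambda>y. (\<kappa> * \<tau>)\<^sup>2 * (L\<^sup>2 + L'\<^sup>2 * bad y)) x"
      unfolding E_def by (rule avgs_mono) (rule G)
    also have "\<dots> = (\<kappa> * \<tau>)\<^sup>2 * (L\<^sup>2 + L'\<^sup>2 * E bad x)"
      by (simp add: E_def avgs_scale avgs_add avgs_const)
    finally show "E \<Gamma> x \<le> (\<kappa> * \<tau>)\<^sup>2 * (L\<^sup>2 + L'\<^sup>2 * E bad x)" .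
  qed (simp add: C_def)
  also have "\<dots> \<le> C * ((\<kappa> * \<tau>)\<^sup>2 * (L\<^sup>2 + L'\<^sup>2 * P))"
    using EP by (intro mult_left_mono add_left_mono) (auto simp: C_def)
  finally have "(1 - \<eta>)\<^sup>2 * (1 - E bad x) \<le> C * (\<kappa> * \<tau>)\<^sup>2 * (L\<^sup>2 + L'\<^sup>2 * P)"
    by (simp add: mult.assoc)
  moreover have "(1 - \<eta>)\<^sup>2 * (1 - P) \<le> (1 - \<eta>)\<^sup>2 * (1 - E bad x)"
    using EP by (intro mult_left_mono) auto
  ultimately show ?thesis by (simp add: C_def \<kappa>_def \<eta>_def)
qed

section \<open>Topological obstruction\<close>

definition clip :: "nat \<Rightarrow> (nat \<Rightarrow> real) \<Rightarrow> nat \<Rightarrow> real"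
  where "clip n x = (\<lambda>i. if i < n then max (-1) (min 1 (x i)) else 0)"

text \<open>Outside the cube this is \<open>h\<close> composed with the clipping of the coordinates, a
  nonexpansive map for the sup norm; inside it is the conical extension of \<open>h\<close>.\<close>
definition cone_ext :: "nat \<Rightarrow> ((nat \<Rightarrow> real) \<Rightarrow> nat \<Rightarrow> real) \<Rightarrow> (nat \<Rightarrow> real) \<Rightarrow> nat \<Rightarrow> real"
  where "cone_ext n h x =
    (\<lambda>a. linf_norm n (clip n x) * h (\<lambda>i. clip n x i / linf_norm n (clip n x)) a)"

lemma clip_Rn: "clip n x \<in> Rn n"
  by (simp add: clip_def Rn_def)

lemma linf_norm_clip_diff:
  assumes "n \<ge> 1"
  shows "linf_norm n (\<lambda>i. clip n x i - clip n y i) \<le> linf_norm n (\<lambda>i. x i - y i)"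
  unfolding linf_norm_le_iff[OF assms]
proof (intro allI impI)
  fix i assume "i < n"
  then have "\<bar>clip n x i - clip n y i\<bar> \<le> \<bar>x i - y i\<bar>" by (auto simp: clip_def)
  then show "\<bar>clip n x i - clip n y i\<bar> \<le> linf_norm n (\<lambda>i. x i - y i)"
    using abs_le_linf_norm[OF \<open>i < n\<close>, of "\<lambda>i. x i - y i"] by linarith
qed

lemma linf_norm_clip_outside:
  assumes "n \<ge> 1" "1 \<le> linf_norm n x"
  shows "linf_norm n (clip n x) = 1"
proof -
  obtain i where "i < n" "linf_norm n x = \<bar>x i\<bar>" using linf_norm_attained assms by blast
  then show ?thesis using assms by (intro linf_norm_eqI[of i]) (auto simp: clip_def)
qed

lemma clip_idem: "x \<in> Rn n \<Longrightarrow> linf_norm n x \<le> 1 \<Longrightarrow> clip n x = x"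
  using abs_le_linf_norm[of _ n x] by (fastforce simp: clip_def Rn_def fun_eq_iff)

locale sphere_map =
  fixes n :: nat and h :: "(nat \<Rightarrow> real) \<Rightarrow> nat \<Rightarrow> real" and L :: real
  assumes n: "n \<ge> 1" and L: "L \<ge> 0"
    and unit: "\<And>x. x \<in> Rn n \<Longrightarrow> linf_norm n x = 1 \<Longrightarrow> l2_norm n (h x) = 1"
    and lip: "\<And>x y. x \<in> Rn n \<Longrightarrow> y \<in> Rn n \<Longrightarrow> linf_norm n x = 1 \<Longrightarrow> linf_norm n y = 1 \<Longrightarrow>
       l2_norm n (\<lambda>a. h x a - h y a) \<le> L * linf_norm n (\<lambda>i. x i - y i)"
begin

lemma cone_ext_outside: "1 \<le> linf_norm n x \<Longrightarrow> cone_ext n h x = h (clip n x)"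
  by (simp add: cone_ext_def linf_norm_clip_outside[OF n])

lemma unit_cone_ext: "1 \<le> linf_norm n x \<Longrightarrow> l2_norm n (cone_ext n h x) = 1"
  by (simp add: cone_ext_outside unit clip_Rn linf_norm_clip_outside[OF n])

lemma lipschitz_cone_ext_outside: "lipschitz_outside n 1 L (cone_ext n h)"
  unfolding lipschitz_outside_def
proof (intro allI impI)
  fix x y assume "1 \<le> linf_norm n x" "1 \<le> linf_norm n y"
  then have "l2_norm n (\<lambda>a. cone_ext n h x a - cone_ext n h y a) \<le> L * linf_norm n (\<lambda>i. clip n x i - clip n y i)"
    using lip[of "clip n x" "clip n y"] by (simp add: cone_ext_outside clip_Rn linf_norm_clip_outside[OF n])
  also have "\<dots> \<le> L * linf_norm n (\<lambda>i. x i - y i)"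
    using linf_norm_clip_diff[OF n] L by (simp add: mult_left_mono)
  finally show "l2_norm n (\<lambda>a. cone_ext n h x a - cone_ext n h y a) \<le> L * linf_norm n (\<lambda>i. x i - y i)" .
qed

lemma normalize_sphere:
  assumes "c \<in> Rn n" "linf_norm n c > 0"
  shows "(\<lambda>i. c i / linf_norm n c) \<in> Rn n" "linf_norm n (\<lambda>i. c i / linf_norm n c) = 1"
  using assms linf_norm_scale[OF n, of "1 / linf_norm n c" c] by (auto simp: Rn_def)

text \<open>With radii r \<ge> s and directions c', d', write r h(c') - s h(d') as (r - s) h(c') + s
  (h(c') - h(d')); the directions satisfy s |c' - d'| \<le> 2 |c - d| in the sup norm.\<close>

lemma cone_ext_diff_le:
  assumes c: "c \<in> Rn n" "d \<in> Rn n" and le: "linf_norm n d \<le> linf_norm n c"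
  shows "l2_norm n (\<lambda>a. linf_norm n c * h (\<lambda>i. c i / linf_norm n c) a - linf_norm n d * h (\<lambda>i. d i / linf_norm n d) a)
     \<le> (1 + 2 * L) * linf_norm n (\<lambda>i. c i - d i)"
proof -
  define r s \<delta> where "r = linf_norm n c" and "s = linf_norm n d" and "\<delta> = linf_norm n (\<lambda>i. c i - d i)"
  have rs: "0 \<le> s" "s \<le> r" "r - s \<le> \<delta>" "0 \<le> \<delta>"
    using linf_norm_nonneg[OF n] linf_norm_triangle[OF n, of c d] le by (auto simp: r_def s_def \<delta>_def)
  show ?thesis
  proof (cases "r = 0")
    case True
    then have "s = 0" using rs by simp
    then show ?thesis using True rs L unfolding r_def[symmetric] s_def[symmetric] \<delta>_def[symmetric]
      by (simp add: l2_norm_def L2_set_def)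
  next
    case False
    then have r: "r > 0" using rs by simp
    define c' d' where "c' = (\<lambda>i. c i / r)" and "d' = (\<lambda>i. d i / s)"
    have c': "c' \<in> Rn n" "linf_norm n c' = 1" using normalize_sphere[OF c(1)] r by (auto simp: r_def c'_def)
    have hc: "l2_norm n (h c') = 1" using unit c' by simp
    have s_part: "s * l2_norm n (\<lambda>a. h c' a - h d' a) \<le> L * (2 * \<delta>)"
    \<comment> \<open>For s = 0 the sequence \<open>d'\<close> is zero by the convention on
      division, and nothing is known of \<open>h\<close> there; the factor \<open>s\<close> removes
      the term.\<close>
    proof (cases "s = 0")
      case True
      then show ?thesis using L rs by simp
    next
      case False
      then have s: "s > 0" using rs by simp
      have d': "d' \<in> Rn n" "linf_norm n d' = 1" using normalize_sphere[OF c(2)] s by (auto simp: s_def d'_def)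
      have "s * linf_norm n (\<lambda>i. c' i - d' i) = linf_norm n (\<lambda>i. s * (c' i - d' i))"
        using linf_norm_scale[OF n, of s "\<lambda>i. c' i - d' i"] s by simp
      also have "\<dots> \<le> 2 * \<delta>"
        unfolding linf_norm_le_iff[OF n]
      proof (intro allI impI)
        fix i assume i: "i < n"
        have "s * (c' i - d' i) = (c i - d i) - (r - s) * c' i"
          using r s by (simp add: c'_def d'_def field_simps)
        also have "\<bar>\<dots>\<bar> \<le> \<bar>c i - d i\<bar> + (r - s) * \<bar>c' i\<bar>"
          using rs abs_triangle_ineq4[of "c i - d i" "(r - s) * c' i"] by (simp add: abs_mult)
        also have "\<dots> \<le> \<delta> + \<delta> * 1"
          using abs_le_linf_norm[OF i, of "\<lambda>i. c i - d i"] abs_le_linf_norm[OF i, of c'] c' rs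
          by (intro add_mono mult_mono) (auto simp: \<delta>_def)
        finally show "\<bar>s * (c' i - d' i)\<bar> \<le> 2 * \<delta>" by simp
      qed
      finally have "L * (s * linf_norm n (\<lambda>i. c' i - d' i)) \<le> L * (2 * \<delta>)" using L by (rule mult_left_mono)
      moreover have "s * l2_norm n (\<lambda>a. h c' a - h d' a) \<le> s * (L * linf_norm n (\<lambda>i. c' i - d' i))"
        using lip[OF c'(1) d'(1) c'(2) d'(2)] s by simp
      ultimately show ?thesis by (simp add: mult.left_commute)
    qed
    have "l2_norm n (\<lambda>a. r * h c' a - s * h d' a) = l2_norm n (\<lambda>a. (r - s) * h c' a + s * (h c' a - h d' a))"
      by (simp add: algebra_simps)
    also have "\<dots> \<le> l2_norm n (\<lambda>a. (r - s) * h c' a) + l2_norm n (\<lambda>a. s * (h c' a - h d' a))"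
      by (rule l2_norm_add)
    also have "\<dots> = (r - s) + s * l2_norm n (\<lambda>a. h c' a - h d' a)"
      using rs by (simp add: l2_norm_scale hc)
    also have "\<dots> \<le> (1 + 2 * L) * \<delta>" using s_part rs by (simp add: algebra_simps)
    finally show ?thesis by (simp add: r_def s_def \<delta>_def c'_def d'_def)
  qed
qed

text \<open>This global constant is worse than \<open>L\<close>, but in the variance estimate it
  enters only with the small probability of not leaving the cube and through the displacement of the
  boxes.\<close>

lemma lipschitz_cone_ext: "lipschitz_outside n r (1 + 2 * L) (cone_ext n h)"
  unfolding lipschitz_outside_def
proof (intro allI impI)
  fix x y
  have *: "l2_norm n (\<lambda>a. cone_ext n h x a - cone_ext n h y a) \<le> (1 + 2 * L) * linf_norm n (\<lambda>i. clip n x i - clip n y i)"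
  proof (cases "linf_norm n (clip n y) \<le> linf_norm n (clip n x)")
    case True
    then show ?thesis unfolding cone_ext_def by (intro cone_ext_diff_le clip_Rn)
  next
    case False
    then show ?thesis
      using cone_ext_diff_le[of "clip n y" "clip n x"] unfolding cone_ext_def
      by (simp add: clip_Rn l2_norm_minus_commute[of n "\<lambda>a. linf_norm n (clip n x) * _ a"]
          linf_norm_minus_commute[of n "clip n x"])
  qed
  also have "\<dots> \<le> (1 + 2 * L) * linf_norm n (\<lambda>i. x i - y i)"
    using linf_norm_clip_diff[OF n] L by (simp add: mult_left_mono)
  finally show "l2_norm n (\<lambda>a. cone_ext n h x a - cone_ext n h y a) \<le> (1 + 2 * L) * linf_norm n (\<lambda>i. x i - y i)" .
qed

end

section \<open>Continuity in the noise level, and the contraction of the sphere\<close>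

lemma continuous_on_lipschitz_outside:
  assumes n: "n \<ge> 1" and f: "\<And>r. lipschitz_outside n r L f" and a: "a < n"
  shows "continuous_on UNIV (\<lambda>x. f x a)"
  unfolding continuous_on_def
proof
  fix x :: "nat \<Rightarrow> real"
  have "continuous_on UNIV (\<lambda>y. L * linf_norm n (\<lambda>i. y i - x i))"
    by (intro continuous_intros continuous_on_linf_norm n) (auto intro!: continuous_intros)
  then have "((\<lambda>y. L * linf_norm n (\<lambda>i. y i - x i)) \<longlongrightarrow> L * linf_norm n (\<lambda>i. x i - x i)) (at x)"
    unfolding continuous_on_def by blast
  moreover have "linf_norm n (\<lambda>i. x i - x i) = 0" using n by (intro linf_norm_eqI[of 0]) auto
  ultimately have lim: "((\<lambda>y. L * linf_norm n (\<lambda>i. y i - x i)) \<longlongrightarrow> 0) (at x)" by simp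
  have "((\<lambda>y. f y a - f x a) \<longlongrightarrow> 0) (at x)"
  proof (rule Lim_null_comparison[OF _ lim], intro always_eventually allI)
    fix y
    have "\<bar>f y a - f x a\<bar> \<le> l2_norm n (\<lambda>a. f y a - f x a)" using abs_le_l2_norm[OF a] .
    also have "\<dots> \<le> L * linf_norm n (\<lambda>i. y i - x i)"
      using f[of "min (linf_norm n x) (linf_norm n y)"] unfolding lipschitz_outside_def
      by (meson min.cobounded1 min.cobounded2)
    finally show "norm (f y a - f x a) \<le> L * linf_norm n (\<lambda>i. y i - x i)" by simp
  qed
  then show "((\<lambda>y. f y a) \<longlongrightarrow> f x a) (at x within UNIV)" by (simp add: LIM_zero_iff)
qed

text \<open>The parameter scales the shifts and is also handed to \<open>f\<close>, so the lemma
  applies to its own outcome: a box average inside a noise average.\<close>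

lemma continuous_on_avgs:
  fixes f :: "real \<times> (nat \<Rightarrow> real) \<Rightarrow> real"
  assumes "continuous_on UNIV f"
  shows "continuous_on UNIV (\<lambda>p. avgs w J (fst p * c) k (\<lambda>y. f (fst p, y)) (snd p))"
  using assms
proof (induction k arbitrary: f)
  case 0
  then show ?case by simp
next
  case (Suc k)
  let ?g = "\<lambda>p::real \<times> (nat \<Rightarrow> real). avg1 w J (fst p * c) k (\<lambda>y. f (fst p, y)) (snd p)"
  have "continuous_on UNIV ?g"
    unfolding avg1_def
  proof (intro continuous_on_sum continuous_on_mult continuous_on_const)
    fix j
    have coord: "continuous_on UNIV (\<lambda>p::real \<times> (nat \<Rightarrow> real). snd p i)" for i
      by (rule continuous_on_product_then_coordinatewise[OF continuous_on_snd[OF continuous_on_id]])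
    have "continuous_on UNIV (\<lambda>p::real \<times> (nat \<Rightarrow> real). (snd p)(k := snd p k + fst p * c * real_of_int j))"
    proof (rule continuous_on_coordinatewise_then_product)
      fix i
      show "continuous_on UNIV (\<lambda>p::real \<times> (nat \<Rightarrow> real). ((snd p)(k := snd p k + fst p * c * real_of_int j)) i)"
        by (cases "i = k") (auto intro!: continuous_intros coord)
    qed
    then show "continuous_on UNIV (\<lambda>p::real \<times> (nat \<Rightarrow> real). f (fst p, (snd p)(k := snd p k + fst p * c * real_of_int j)))"
      using continuous_on_compose2[OF Suc.prems continuous_on_Pair[OF continuous_on_fst[OF continuous_on_id]]]
      by blast
  qed
  then show ?case using Suc.IH[of ?g] by simp
qed

lemma not_contractible_l2_sphere: "n \<ge> 1 \<Longrightarrow> \<not> contractible {x \<in> Rn n. l2_norm n x = 1}"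
  using non_contractible_space_nsphere[of "n - 1"] nsphere_eq[of n] by simp

text \<open>A zero-free \<open>G\<close> would contract the sphere: for \<open>z = h x\<close>, first let \<open>y\<close> run from \<open>0\<close> to
  \<open>R x\<close> in \<open>G (1, y)\<close>, then let \<open>t\<close> decrease to \<open>0\<close>, and finally move \<open>R x\<close> back to \<open>x\<close>.\<close>
lemma homotopy_has_zero:
  fixes G :: "real \<times> (nat \<Rightarrow> real) \<Rightarrow> nat \<Rightarrow> real"
  assumes sm: "sphere_map n h L"
    and hom: "homeomorphism {x \<in> Rn n. linf_norm n x = 1} {x \<in> Rn n. l2_norm n x = 1} h k"
    and cont: "\<And>a. a < n \<Longrightarrow> continuous_on UNIV (\<lambda>p. G p a)"
    and G0: "\<And>x a. a < n \<Longrightarrow> G (0, x) a = cone_ext n h x a"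
    and G1: "\<And>x. \<exists>a<n. G (1, x) a \<noteq> 0"
    and GR: "\<And>t x. 0 \<le> t \<Longrightarrow> t \<le> 1 \<Longrightarrow> linf_norm n x = R \<Longrightarrow> \<exists>a<n. G (t, x) a \<noteq> 0"
    and R: "R \<ge> 1"
  shows False
proof -
  interpret sphere_map n h L by (rule sm)
  let ?S = "{x \<in> Rn n. l2_norm n x = 1}"
  \<comment> \<open>Time is cut into thirds. \<open>T\<close> is 1, then falls linearly to 0, then
    stays 0; \<open>\<sigma>\<close> rises from 0 to \<open>R\<close>, stays there, then falls to
    1.\<close>
  define T where "T s = max 0 (min 1 (2 - 3 * s))" for s :: real
  define \<sigma> where "\<sigma> s = min (R * (3 * s)) R - (R - 1) * max 0 (3 * s - 2)" for s :: real
  define V where "V p a = G (T (fst p), \<lambda>i. \<sigma> (fst p) * k (snd p) i) a" for p :: "real \<times> (nat \<Rightarrow> real)" and a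
  define H where "H p = (\<lambda>a. if a < n then V p a / l2_norm n (V p) else 0)" for p
  have kx: "k z \<in> Rn n" "linf_norm n (k z) = 1" "h (k z) = z" if "z \<in> ?S" for z
    using hom that by (auto simp: homeomorphism_def)
  have l\<sigma>: "linf_norm n (\<lambda>i. \<sigma> s * k z i) = \<bar>\<sigma> s\<bar>" if "z \<in> ?S" for s z
    using linf_norm_scale[OF n, of "\<sigma> s" "k z"] kx[OF that] by simp
  have Vpos: "l2_norm n (V p) > 0" if p: "p \<in> {0..1} \<times> ?S" for p
  proof -
    obtain s z where sz: "p = (s, z)" "0 \<le> s" "s \<le> 1" "z \<in> ?S" using p by auto
    consider "s \<le> 1/3" | "1/3 \<le> s" "s \<le> 2/3" | "2/3 \<le> s" by linarith
    then have "\<exists>a<n. V p a \<noteq> 0"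
    proof cases
      case 1
      then have "T s = 1" by (simp add: T_def)
      then show ?thesis using G1 by (simp add: V_def sz)
    next
      case 2
      have "R * 1 \<le> R * (3 * s)" using 2 R by (intro mult_left_mono) auto
      then have "\<sigma> s = R" using 2 by (simp add: \<sigma>_def)
      moreover have "0 \<le> T s" "T s \<le> 1" by (auto simp: T_def)
      ultimately show ?thesis using GR l\<sigma>[OF sz(4), of s] R by (simp add: V_def sz)
    next
      case 3
      have "R * 1 \<le> R * (3 * s)" using 3 R by (intro mult_left_mono) auto
      then have "\<sigma> s = R - (R - 1) * (3 * s - 2)" using 3 by (simp add: \<sigma>_def)
      moreover have "(R - 1) * (3 * s - 2) \<le> (R - 1) * 1" using sz R by (intro mult_left_mono) auto
      ultimately have "\<sigma> s \<ge> 1" by simp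
      then have "l2_norm n (cone_ext n h (\<lambda>i. \<sigma> s * k z i)) = 1"
        using l\<sigma>[OF sz(4), of s] by (intro unit_cone_ext) simp
      moreover have "T s = 0" using 3 by (simp add: T_def)
      ultimately have "l2_norm n (V p) = 1"
        using G0 l2_norm_cong[of n "V p" "cone_ext n h (\<lambda>i. \<sigma> s * k z i)"] by (simp add: V_def sz)
      then show ?thesis
        using l2_norm_power2[of n "V p"] by (intro ccontr[of "\<exists>a<n. V p a \<noteq> 0"]) simp
    qed
    then obtain a where "a < n" "V p a \<noteq> 0" by blast
    then show ?thesis using abs_le_l2_norm[of a n "V p"] by (simp add: order_less_le_trans[OF _ abs_le_l2_norm])
  qed
  have contV: "continuous_on ({0..1} \<times> ?S) (\<lambda>p. V p a)" if a: "a < n" for a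
  proof -
    have "continuous_on ({0..1} \<times> ?S) (\<lambda>p. k (snd p))"
      by (rule continuous_on_compose2[OF _ continuous_on_snd[OF continuous_on_id]])
         (use hom in \<open>auto simp: homeomorphism_def\<close>)
    then have "continuous_on ({0..1} \<times> ?S) (\<lambda>p. (T (fst p), \<lambda>i. \<sigma> (fst p) * k (snd p) i))"
      unfolding T_def \<sigma>_def
      by (intro continuous_on_Pair continuous_on_coordinatewise_then_product continuous_intros)
         (auto intro: continuous_on_product_then_coordinatewise)
    then show ?thesis
      unfolding V_def using continuous_on_compose2[OF cont[OF a]] by blast
  qed
  have contH: "continuous_on ({0..1} \<times> ?S) H"
  proof (rule continuous_on_coordinatewise_then_product)
    fix a
    show "continuous_on ({0..1} \<times> ?S) (\<lambda>p. H p a)"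
    proof (cases "a < n")
      case True
      have "continuous_on ({0..1} \<times> ?S) (\<lambda>p. V p a / l2_norm n (V p))"
        using Vpos by (intro continuous_on_divide contV continuous_on_l2_norm True) fastforce+
      then show ?thesis using True by (simp add: H_def)
    qed (simp add: H_def)
  qed
  have HS: "H p \<in> ?S" if "p \<in> {0..1} \<times> ?S" for p
  proof -
    have "l2_norm n (H p) = l2_norm n (\<lambda>a. 1 / l2_norm n (V p) * V p a)"
      by (rule l2_norm_cong) (simp add: H_def)
    also have "\<dots> = 1" using Vpos[OF that] by (subst l2_norm_scale) simp
    finally show ?thesis by (simp add: H_def Rn_def)
  qed
  \<comment> \<open>At time 0 every point is sent to the direction of \<open>G\<close> at level 1
    and the origin, so the homotopy starts at a constant map.\<close>
  have H0: "H (0, z) = (\<lambda>a. if a < n then G (1, \<lambda>i. 0) a / l2_norm n (\<lambda>a. G (1, \<lambda>i. 0) a) else 0)" for z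
  proof -
    have "V (0, z) = G (1, \<lambda>i. 0)" using R by (intro ext) (simp add: V_def T_def \<sigma>_def)
    then show ?thesis unfolding H_def by (simp only:)
  qed
  have H1: "H (1, z) = z" if z: "z \<in> ?S" for z
  proof -
    have "T 1 = 0" "\<sigma> 1 = 1" using R by (auto simp: T_def \<sigma>_def)
    moreover have "cone_ext n h (k z) = z"
      using kx[OF z] by (simp add: cone_ext_outside clip_idem)
    ultimately have V: "V (1, z) a = z a" if "a < n" for a using G0 that by (simp add: V_def)
    then have "l2_norm n (V (1, z)) = l2_norm n z" by (rule l2_norm_cong)
    then have "l2_norm n (V (1, z)) = 1" using z by simp
    then show ?thesis using V z by (auto simp: H_def Rn_def fun_eq_iff)
  qed
  have "homotopic_with_canon (\<lambda>_. True) ?S ?S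
     (\<lambda>z. \<lambda>a. if a < n then G (1, \<lambda>i. 0) a / l2_norm n (\<lambda>a. G (1, \<lambda>i. 0) a) else 0) id"
    by (subst homotopic_with)
       (use contH HS H0 H1 in \<open>auto intro!: exI[of _ H] simp: continuous_map_in_subtopology\<close>)
  then have "contractible ?S"
    unfolding contractible_def using homotopic_with_sym by blast
  then show False using not_contractible_l2_sphere[OF n] by simp
qed

section \<open>Lower bound\<close>

lemma geom_tail_le_1:
  assumes "0 < q"
  shows "geom_tail q M K \<le> 1"
proof -
  interpret avg_weights "geom_w q M" "{- int M..int M}" using assms by (rule avg_weights_geom)
  have "geom_tail q M K \<le> sum (geom_w q M) {- int M..int M}"
    unfolding geom_tail_def by (intro sum_mono2) (auto simp: w_nonneg)
  then show ?thesis using w_sum by simp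
qed

lemma (in avg_weights) avgs_step_0: "avgs w J 0 k f = f"
  by (induction k arbitrary: f) (simp_all add: avg1_def[abs_def] sum_distrib_right[symmetric] w_sum)

text \<open>If the inequality failed, \<open>avgs_eq_0_imp\<close> would exclude zeros at full noise
  level for all centres, and at every level for centres of sup norm 5, contradicting
  \<open>homotopy_has_zero\<close>. The grid has \<open>m\<close> steps per unit length, so
  \<open>q\<close> corresponds to rate \<open>lam\<close>, and truncation at \<open>2 * m\<close>
  steps confines each noise coordinate to [-2, 2].\<close>

lemma sphere_map_inequality_discrete:
  fixes lam :: real and m N :: nat
  assumes sm: "sphere_map n h L"
    and hom: "homeomorphism {x \<in> Rn n. linf_norm n x = 1} {x \<in> Rn n. l2_norm n x = 1} h k"
    and lam: "lam > 0" and m: "m \<ge> 1" and N: "N \<ge> 1" and mN: "n * N + 1 \<le> m"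
    and small: "(1 + 2 * L) * (real n * real N / real m) \<le> 1"
  defines "q \<equiv> exp (- lam / real m)"
  defines "P \<equiv> (1 - (q ^ (m + n * N + 1) - q ^ Suc (2 * m)) / 2) ^ n"
  shows "(1 - (1 + 2 * L) * (real n * real N / real m))\<^sup>2 * (1 - P)
     \<le> (2 / (1 - q) + 1)\<^sup>2 * ((1 + 2 * real n / real N) / real m)\<^sup>2 * (L\<^sup>2 + (1 + 2 * L)\<^sup>2 * P)"
proof (rule ccontr)
  assume neg: "\<not> ?thesis"
  interpret sphere_map n h L by (rule sm)
  have q: "0 < q" "q < 1" using lam m by (auto simp: q_def)
  let ?J = "{- int (2 * m)..int (2 * m)}" and ?w = "geom_w q (2 * m)" and ?K = "m + n * N + 1"
  interpret avg_weights ?w ?J using q(1) by (rule avg_weights_geom)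
  let ?L = "1 + 2 * L"
  define Q where "Q = (2 / (1 - q) + 1)\<^sup>2"
  define \<kappa> where "\<kappa> = (1 + 2 * real n / real N)"
  define f where "f = cone_ext n h"
  define E where "E t = avgs ?w ?J (t / real m) n" for t :: real
  \<comment> \<open>The level scales noise and boxes together: at level 0 both averages are trivial
    and \<open>G\<close> is \<open>f\<close>, while level \<open>t\<close> is the same situation
    with grid step t/m.\<close>
  define G where "G p a = E (fst p) (box N (fst p / real m) n (\<lambda>y. f y a)) (snd p)" for p :: "real \<times> (nat \<Rightarrow> real)" and a
  have qK: "q ^ Suc (2 * m) \<le> q ^ ?K" using q mN by (intro power_decreasing) auto
  have qK1: "q ^ ?K \<le> 1" using q by (intro power_le_one) auto
  have q0: "0 < q ^ Suc (2 * m)" using q by simp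
  have P: "0 \<le> P" "P \<le> 1"
    unfolding P_def using qK1 q0 qK by (auto intro!: zero_le_power power_le_one simp del: power_Suc)
  have zero: "(1 - ?L * (real n * real N * (t / real m)))\<^sup>2 * (1 - p)
     \<le> Q * (\<kappa> * (t / real m))\<^sup>2 * (L\<^sup>2 + ?L\<^sup>2 * p)"
    if t: "0 \<le> t" "t \<le> 1" and z: "\<not> (\<exists>a<n. G (t, x) a \<noteq> 0)"
      and p: "E t (\<lambda>x. if \<forall>i<n. \<bar>x i\<bar> < 1 + (real n * real N + 1) * (t / real m) then 1 else 0) x \<le> p" for t x p
    unfolding Q_def \<kappa>_def
  proof (rule avgs_eq_0_imp[OF n q N _ L _ lipschitz_cone_ext_outside lipschitz_cone_ext unit_cone_ext _ p[unfolded E_def]])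
    show "?L * (real n * real N * (t / real m)) \<le> 1"
    proof -
      have "?L * (real n * real N / real m) * t \<le> 1 * 1"
        using small t L by (intro mult_mono) auto
      then show ?thesis by simp
    qed
    show "avgs ?w ?J (t / real m) n (box N (t / real m) n (\<lambda>y. cone_ext n h y a)) x = 0" if "a < n" for a
      using z that by (auto simp: G_def E_def f_def)
  qed (use t L in auto)
  show False
  proof (rule homotopy_has_zero[OF sm hom, of G 5])
    show "continuous_on UNIV (\<lambda>p. G p a)" if a: "a < n" for a
    proof -
      have "continuous_on UNIV (\<lambda>x. f x a)"
        unfolding f_def using n lipschitz_cone_ext a by (rule continuous_on_lipschitz_outside)
      then have "continuous_on UNIV (\<lambda>p::real \<times> (nat \<Rightarrow> real). f (snd p) a)"
        by (rule continuous_on_compose2[OF _ continuous_on_snd[OF continuous_on_id]]) auto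
      from continuous_on_avgs[OF continuous_on_avgs[OF this, of "\<lambda>_. 1 / real N" "{0..<int N}" "1 / real m" n], of ?w ?J "1 / real m" n]
      show ?thesis by (simp add: G_def E_def)
    qed
    show "G (0, x) a = cone_ext n h x a" for x a
    proof -
      interpret bx: avg_weights "\<lambda>_. 1 / real N" "{0..<int N}" using N by (rule avg_weights_box)
      show ?thesis by (simp add: G_def E_def f_def avgs_step_0 bx.avgs_step_0 del: of_nat_mult)
    qed
    show "\<exists>a<n. G (1, x) a \<noteq> 0" for x
    proof (rule ccontr)
      assume z: "\<not> (\<exists>a<n. G (1, x) a \<noteq> 0)"
      \<comment> \<open>\<open>?K\<close> grid steps of length 1/m are exactly the radius of the
        cube together with the margin.\<close>
      have r: "1 + (real n * real N + 1) * (1 / real m) \<le> 1 / real m * real ?K"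
        using m by (simp add: field_simps)
      have "E 1 (\<lambda>x. if \<forall>i<n. \<bar>x i\<bar> < 1 + (real n * real N + 1) * (1 / real m) then 1 else 0) x
          \<le> (1 - geom_tail q (2 * m) ?K) ^ n"
        unfolding E_def by (rule avgs_indicator_le[OF q(1) _ r]) simp
      also have "\<dots> \<le> P"
        unfolding P_def using geom_tail_ge[OF q, of ?K "2 * m"] geom_tail_le_1[OF q(1), of "2 * m" ?K] mN
        by (intro power_mono) auto
      finally show False using zero[OF _ _ z, of P] neg by (simp add: Q_def \<kappa>_def)
    qed
    show "\<exists>a<n. G (t, x) a \<noteq> 0" if t: "0 \<le> t" "t \<le> 1" and x: "linf_norm n x = 5" for t x
    proof (rule ccontr)
      assume z: "\<not> (\<exists>a<n. G (t, x) a \<noteq> 0)"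
      obtain i where i: "i < n" "\<bar>x i\<bar> = 5" using linf_norm_attained[OF n, of x] x by metis
      \<comment> \<open>The margin is at most 1 by \<open>mN\<close>, so the radius is at most 2,
        while noise of size at most 2 leaves the coordinate of modulus 5 at modulus at least 3.
        Hence the probability bound can be taken to be 0.\<close>
      have r: "1 + (real n * real N + 1) * (t / real m) \<le> 2"
      proof -
        have "real (n * N + 1) \<le> real m" using mN by (simp only: of_nat_le_iff)
        then have "(real n * real N + 1) * t \<le> real m * 1" using t by (intro mult_mono) auto
        then show ?thesis using m by (simp add: field_simps)
      qed
      have "E t (\<lambda>x. if \<forall>i<n. \<bar>x i\<bar> < 1 + (real n * real N + 1) * (t / real m) then 1 else 0) x \<le> E t (\<lambda>x. 0) x"
        unfolding E_def
      proof (rule avgs_mono_local)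
        fix y assume y: "\<And>i. \<exists>k\<in>insert 0 ?J. y i = x i + t / real m * of_int k"
        then obtain k where k: "k \<in> insert 0 ?J" "y i = x i + t / real m * of_int k" by blast
        have "\<bar>real_of_int k\<bar> \<le> 2 * real m" using k(1) by auto
        then have "t * \<bar>real_of_int k\<bar> \<le> 1 * (2 * real m)" using t by (intro mult_mono) auto
        then have "\<bar>t / real m * of_int k\<bar> \<le> 2" using m t by (simp add: abs_mult field_simps)
        then have "\<bar>y i\<bar> \<ge> 3" using k i by linarith
        then have "\<not> \<bar>y i\<bar> < 1 + (real n * real N + 1) * (t / real m)" using r by linarith
        then show "(if \<forall>i<n. \<bar>y i\<bar> < 1 + (real n * real N + 1) * (t / real m) then 1 else 0) \<le> (0::real)"
          using i by auto
      qed
      then have "E t (\<lambda>x. if \<forall>i<n. \<bar>x i\<bar> < 1 + (real n * real N + 1) * (t / real m) then 1 else 0) x \<le> 0"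
        by (simp add: E_def avgs_zero)
      from zero[OF t z this]
      have le: "(1 - ?L * (real n * real N * (t / real m)))\<^sup>2 \<le> Q * (\<kappa> * (t / real m))\<^sup>2 * L\<^sup>2" by simp
      \<comment> \<open>Lowering the level raises the left side and lowers the right side, so the
        inequality at level \<open>t\<close> implies the one at level 1 that was assumed to
        fail.\<close>
      have t_le: "t / real m \<le> 1 / real m" using t m by (simp add: divide_right_mono)
      have "(1 - ?L * (real n * real N / real m))\<^sup>2 \<le> (1 - ?L * (real n * real N * (t / real m)))\<^sup>2"
      proof (rule power_mono)
        have "?L * (real n * real N * (t / real m)) \<le> ?L * (real n * real N * (1 / real m))"
          using t_le L by (intro mult_left_mono) auto
        then show "1 - ?L * (real n * real N / real m) \<le> 1 - ?L * (real n * real N * (t / real m))" by simp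
      qed (use small in simp)
      also note le
      also have "Q * (\<kappa> * (t / real m))\<^sup>2 * L\<^sup>2 \<le> Q * (\<kappa> / real m)\<^sup>2 * (L\<^sup>2 + ?L\<^sup>2 * P)"
      proof (rule mult_mono)
        have "\<kappa> * (t / real m) \<le> \<kappa> * (1 / real m)" using t_le by (intro mult_left_mono) (auto simp: \<kappa>_def)
        moreover have "0 \<le> \<kappa> * (t / real m)" using t by (simp add: \<kappa>_def)
        ultimately show "Q * (\<kappa> * (t / real m))\<^sup>2 \<le> Q * (\<kappa> / real m)\<^sup>2"
          by (intro mult_left_mono power_mono) (auto simp: Q_def)
        show "L\<^sup>2 \<le> L\<^sup>2 + ?L\<^sup>2 * P" using P by simp
      qed (auto simp: Q_def)
      finally have "(1 - ?L * (real n * real N / real m))\<^sup>2 \<le> Q * (\<kappa> / real m)\<^sup>2 * (L\<^sup>2 + ?L\<^sup>2 * P)" .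
      moreover have "(1 - ?L * (real n * real N / real m))\<^sup>2 * (1 - P) \<le> (1 - ?L * (real n * real N / real m))\<^sup>2 * 1"
        using P by (intro mult_left_mono) auto
      ultimately show False using neg by (simp add: Q_def \<kappa>_def)
    qed
  qed (simp_all)
qed

text \<open>Take m = N^2 and let N grow. The boxes have width N/m = 1/N, so their total displacement
  n/N vanishes, and so does the loss 2n/N in the partial differences.\<close>

lemma sphere_map_inequality:
  fixes lam :: real
  assumes sm: "sphere_map n h L"
    and hom: "homeomorphism {x \<in> Rn n. linf_norm n x = 1} {x \<in> Rn n. l2_norm n x = 1} h k"
    and lam: "lam > 0"
  defines "P \<equiv> (1 - (exp (- lam) - exp (- (2 * lam))) / 2) ^ n"
  shows "1 - P \<le> (2 / lam)\<^sup>2 * (L\<^sup>2 + (1 + 2 * L)\<^sup>2 * P)"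
proof -
  define q where "q N = exp (- lam / real (N\<^sup>2))" for N :: nat
  define p where "p N = (1 - (q N ^ (N\<^sup>2 + n * N + 1) - q N ^ Suc (2 * N\<^sup>2)) / 2) ^ n" for N
  define lhs where "lhs N = (1 - (1 + 2 * L) * (real n * real N / real (N\<^sup>2)))\<^sup>2 * (1 - p N)" for N :: nat
  define rhs where "rhs N = (2 / (1 - q N) + 1)\<^sup>2 * ((1 + 2 * real n / real N) / real (N\<^sup>2))\<^sup>2 * (L\<^sup>2 + (1 + 2 * L)\<^sup>2 * p N)" for N :: nat
  have qpow: "q N ^ j = exp (- lam * real j / real (N\<^sup>2))" for N j
    by (simp add: q_def exp_of_nat_mult[symmetric] mult.commute)
  have "(\<lambda>N. q N ^ (N\<^sup>2 + n * N + 1)) \<longlonglongrightarrow> exp (- lam)"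
    unfolding qpow of_nat_add of_nat_mult of_nat_power of_nat_1 by real_asymp
  moreover have "(\<lambda>N. q N ^ Suc (2 * N\<^sup>2)) \<longlonglongrightarrow> exp (- (2 * lam))"
    unfolding qpow Suc_eq_plus1 of_nat_add of_nat_mult of_nat_power of_nat_1 of_nat_numeral by real_asymp
  ultimately have p: "p \<longlonglongrightarrow> P"
    unfolding p_def[abs_def] P_def by (intro tendsto_intros) auto
  have e0: "(\<lambda>N. (1 + 2 * L) * (real n * real N / real (N\<^sup>2))) \<longlonglongrightarrow> 0"
    unfolding of_nat_power by real_asymp
  have lhs: "lhs \<longlonglongrightarrow> (1 - 0)\<^sup>2 * (1 - P)"
    unfolding lhs_def[abs_def] by (intro tendsto_intros e0 p)
  \<comment> \<open>Since 1 - q is asymptotic to lam/N^2, the discrete Poincare constant times the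
    squared grid step tends to 4/lam^2.\<close>
  have "(\<lambda>N. (2 / (1 - q N) + 1) * ((1 + 2 * real n / real N) / real (N\<^sup>2))) \<longlonglongrightarrow> 2 / lam"
    unfolding q_def of_nat_power using lam by (real_asymp simp: field_simps)
  then have "(\<lambda>N. ((2 / (1 - q N) + 1) * ((1 + 2 * real n / real N) / real (N\<^sup>2)))\<^sup>2 * (L\<^sup>2 + (1 + 2 * L)\<^sup>2 * p N))
     \<longlonglongrightarrow> (2 / lam)\<^sup>2 * (L\<^sup>2 + (1 + 2 * L)\<^sup>2 * P)"
    by (intro tendsto_intros p)
  then have rhs: "rhs \<longlonglongrightarrow> (2 / lam)\<^sup>2 * (L\<^sup>2 + (1 + 2 * L)\<^sup>2 * P)"
    unfolding rhs_def[abs_def] by (simp only: power_mult_distrib)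
  have "eventually (\<lambda>N. lhs N \<le> rhs N) sequentially"
  proof -
    have "eventually (\<lambda>N. (1 + 2 * L) * (real n * real N / real (N\<^sup>2)) < 1) sequentially"
      using e0 by (rule order_tendstoD) simp
    then show ?thesis
      using eventually_ge_at_top[of "n + 1"]
    proof eventually_elim
      case (elim N)
      have "n * N + 1 \<le> N\<^sup>2"
      proof -
        have "(n + 1) * N \<le> N * N" using elim by (intro mult_right_mono) auto
        moreover have "N \<ge> 1" using elim by simp
        ultimately show ?thesis by (simp add: power2_eq_square)
      qed
      then show ?case
        unfolding lhs_def rhs_def p_def q_def
        by (intro sphere_map_inequality_discrete[OF sm hom lam]) (use elim in auto)
    qed
  qed
  then have "(1 - 0)\<^sup>2 * (1 - P) \<le> (2 / lam)\<^sup>2 * (L\<^sup>2 + (1 + 2 * L)\<^sup>2 * P)"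
    using tendsto_le[OF _ rhs lhs] by simp
  then show ?thesis by simp
qed

text \<open>The rate is chosen so that \<open>n * exp (- lam) = ln n\<close>: the noise leaves the cube with
  probability tending to one, while \<open>lam\<close> is still asymptotic to \<open>ln n\<close>.\<close>
lemma sphere_const_ge:
  assumes n: "n \<ge> 3" and ex: "Lipschitz_homeomorphism (linf_sphere n) (l2_sphere n) g"
  defines "lam \<equiv> ln (real n) - ln (ln (real n))"
  defines "P \<equiv> (1 - (exp (- lam) - exp (- (2 * lam))) / 2) ^ n"
  shows "lam / 2 * sqrt ((1 - P) / (1 + 9 * P)) \<le> max 1 (sphere_const n)"
proof -
  have n1: "n \<ge> 1" using n by simp
  have lam: "lam > 0"
  proof -
    have "real n > 0" using n by simp
    have "exp 1 < (3::real)" using e_less_272 by simp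
    then have "1 < ln (real n)" using n ln_less_cancel_iff[of "exp 1" "real n"] by simp
    then have "ln (ln (real n)) < ln (real n)"
      using ln_less_self[of "ln (real n)"] by simp
    then show ?thesis by (simp add: lam_def)
  qed
  have e: "exp (- lam) \<le> 1" "0 < exp (- (2 * lam))" "exp (- (2 * lam)) \<le> exp (- lam)" using lam by auto
  have "0 \<le> (exp (- lam) - exp (- (2 * lam))) / 2" using e(3) by simp
  moreover have "(u - v) / 2 \<le> 1" if "u \<le> 1" "0 < v" for u v :: real using that by simp
  note this[OF e(1,2)]
  ultimately have P: "0 \<le> P" "P \<le> 1"
    unfolding P_def by (intro zero_le_power power_le_one; linarith)+
  have "lam / 2 * sqrt ((1 - P) / (1 + 9 * P)) \<le> max 1 (Lip (linf_sphere n) (l2_sphere n) h)"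
    if h: "Lipschitz_homeomorphism (linf_sphere n) (l2_sphere n) h" for h
  proof -
    define L where "L = Lip (linf_sphere n) (l2_sphere n) h"
    \<comment> \<open>As l is at least 1, 1 + 2L \<le> 3l; this is the origin of the 9 and of the
      \<open>max 1\<close> in the conclusion.\<close>
    define l where "l = max 1 L"
    have L0: "L \<ge> 0" unfolding L_def using n1 h by (rule Lip_sphere_nonneg)
    obtain k where k: "homeomorphism {x \<in> Rn n. linf_norm n x = 1} {x \<in> Rn n. l2_norm n x = 1} h k"
      using h by (auto simp: Lipschitz_homeomorphism_def mtopology_linf_sphere[OF n1] mtopology_l2_sphere
        homeomorphic_map_top_of_set)
    have hL: "Lipschitz_continuous_map (linf_sphere n) (l2_sphere n) h"
      using h by (simp add: Lipschitz_homeomorphism_def)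
    have "sphere_map n h L"
    proof
      show "l2_norm n (h x) = 1" if "x \<in> Rn n" "linf_norm n x = 1" for x
        using k that by (auto simp: homeomorphism_def)
      show "l2_norm n (\<lambda>a. h x a - h y a) \<le> L * linf_norm n (\<lambda>i. x i - y i)"
        if "x \<in> Rn n" "y \<in> Rn n" "linf_norm n x = 1" "linf_norm n y = 1" for x y
        using mdist_le_Lip[OF hL, of x y] that n1 by (simp add: L_def)
    qed (use n1 L0 in auto)
    then have "1 - P \<le> (2 / lam)\<^sup>2 * (L\<^sup>2 + (1 + 2 * L)\<^sup>2 * P)"
      unfolding P_def using k lam by (rule sphere_map_inequality)
    also have "\<dots> \<le> (2 / lam)\<^sup>2 * (l\<^sup>2 + (3 * l)\<^sup>2 * P)"
      using L0 P by (intro mult_left_mono add_mono mult_right_mono power_mono) (auto simp: l_def)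
    also have "\<dots> = (2 / lam * l)\<^sup>2 * (1 + 9 * P)"
      by (simp only: power_mult_distrib) (simp add: algebra_simps)
    finally have "(1 - P) / (1 + 9 * P) \<le> (2 / lam * l)\<^sup>2"
      using P by (simp add: divide_le_eq)
    then have "sqrt ((1 - P) / (1 + 9 * P)) \<le> 2 / lam * l"
      using lam by (intro real_le_lsqrt) (auto simp: l_def)
    then show ?thesis using lam by (simp add: l_def L_def field_simps)
  qed
  then have *: "lam / 2 * sqrt ((1 - P) / (1 + 9 * P)) \<le> 1 \<or>
      lam / 2 * sqrt ((1 - P) / (1 + 9 * P)) \<le> Lip (linf_sphere n) (l2_sphere n) h"
    if "Lipschitz_homeomorphism (linf_sphere n) (l2_sphere n) h" for h
    using that by (simp add: le_max_iff_disj)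
  show ?thesis
  proof (cases "lam / 2 * sqrt ((1 - P) / (1 + 9 * P)) \<le> 1")
    case False
    then have "lam / 2 * sqrt ((1 - P) / (1 + 9 * P)) \<le> sphere_const n"
      unfolding sphere_const_def using ex * by (intro cInf_greatest) auto
    then show ?thesis by simp
  qed simp
qed

text \<open>Since exp(-lam) = ln n / n, the product \<open>n * b n\<close> is asymptotic to (ln
  n)/2. It tends to infinity, so \<open>P n\<close>, at most exp(- n b n), tends to 0.\<close>

lemma noise_bound_asymptotics:
  defines "lam \<equiv> \<lambda>n. ln (real n) - ln (ln (real n))"
  defines "P \<equiv> \<lambda>n. (1 - (exp (- lam n) - exp (- (2 * lam n))) / 2) ^ n"
  shows "(\<lambda>n. (lam n / 2 * sqrt ((1 - P n) / (1 + 9 * P n))) / ln (real n)) \<longlonglongrightarrow> 1 / 2"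
proof -
  define b where "b n = (exp (- lam n) - exp (- (2 * lam n))) / 2" for n
  have lim: "(\<lambda>n. exp (- (real n * b n))) \<longlonglongrightarrow> 0"
    unfolding b_def lam_def by real_asymp
  have b01: "eventually (\<lambda>n. 0 \<le> b n \<and> b n \<le> 1) sequentially"
    unfolding b_def lam_def by (intro eventually_conj) real_asymp+
  have "P \<longlonglongrightarrow> 0"
  proof (rule tendsto_sandwich[OF _ _ tendsto_const lim])
    show "eventually (\<lambda>n. 0 \<le> P n) sequentially"
      using b01 by eventually_elim (auto simp: P_def b_def intro!: zero_le_power)
    show "eventually (\<lambda>n. P n \<le> exp (- (real n * b n))) sequentially"
      using b01
    proof eventually_elim
      case (elim n)
      have "(1 - b n) ^ n \<le> exp (- b n) ^ n"
        using elim exp_ge_add_one_self[of "- b n"] by (intro power_mono) auto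
      also have "\<dots> = exp (- (real n * b n))" by (simp add: exp_of_nat_mult[symmetric])
      finally show ?case by (simp add: P_def b_def)
    qed
  qed
  then have "(\<lambda>n. sqrt ((1 - P n) / (1 + 9 * P n))) \<longlonglongrightarrow> sqrt ((1 - 0) / (1 + 9 * 0))"
    by (intro tendsto_intros) auto
  moreover have "(\<lambda>n. lam n / 2 / ln (real n)) \<longlonglongrightarrow> 1 / 2"
    unfolding lam_def by real_asymp
  ultimately have "(\<lambda>n. lam n / 2 / ln (real n) * sqrt ((1 - P n) / (1 + 9 * P n))) \<longlonglongrightarrow> 1 / 2 * sqrt ((1 - 0) / (1 + 9 * 0))"
    by (intro tendsto_mult)
  then show ?thesis by simp
qed

theorem theorem1p3:
  shows "(\<lambda>n. sphere_const n / ln (real n)) \<longlonglongrightarrow> 1 / 2 \<and>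
    (\<lambda>n. ball_const n / ln (real n)) \<longlonglongrightarrow> 1 / 2 \<and>
    (\<forall>n::nat. n \<ge> 2 \<longrightarrow>
      sphere_const n \<le> ball_const n \<and>
      ball_const n \<le> 1 + arsinh (sqrt (real n - 1)) +
        (1 + real n / (2 * (real n - 1))) * sqrt (1 + arsinh (sqrt (real n - 1))))"
proof (intro conjI allI impI)
  have le: "sphere_const n \<le> ball_const n" if n: "n \<ge> 2" for n
  proof -
    obtain g where "Lipschitz_homeomorphism (linf_ball n) (l2_ball n) g"
      using ball_const_upper(1)[OF n] by blast
    then show ?thesis using n by (intro sphere_const_le_ball_const) auto
  qed
  then show "sphere_const n \<le> ball_const n" if "n \<ge> 2" for n using that .
  define up where "up n = 1 + arsinh (sqrt (real n - 1)) +
        (1 + real n / (2 * (real n - 1))) * sqrt (1 + arsinh (sqrt (real n - 1)))" for n :: nat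
  show upper: "ball_const n \<le> 1 + arsinh (sqrt (real n - 1)) +
        (1 + real n / (2 * (real n - 1))) * sqrt (1 + arsinh (sqrt (real n - 1)))" if "n \<ge> 2" for n
    using ball_const_upper(2)[OF that] .
  have up_le: "ball_const n \<le> up n" if "n \<ge> 2" for n
    unfolding up_def by (rule upper[OF that])
  define lam P where "lam n = ln (real n) - ln (ln (real n))"
    and "P n = (1 - (exp (- lam n) - exp (- (2 * lam n))) / 2) ^ n" for n :: nat
  define low where "low n = lam n / 2 * sqrt ((1 - P n) / (1 + 9 * P n))" for n
  have low: "(\<lambda>n. low n / ln (real n)) \<longlonglongrightarrow> 1 / 2"
    unfolding low_def P_def lam_def by (rule noise_bound_asymptotics)
  have up: "(\<lambda>n. up n / ln (real n)) \<longlonglongrightarrow> 1 / 2"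
    unfolding up_def arsinh_real_def by real_asymp
  \<comment> \<open>Together with ln n > 4 this makes \<open>low n\<close> exceed 1, so the maximum
    in \<open>sphere_const_ge\<close> must be \<open>sphere_const n\<close>.\<close>
  have "eventually (\<lambda>n. 1 / 4 < low n / ln (real n)) sequentially"
    using low by (rule order_tendstoD) simp
  moreover have "eventually (\<lambda>n. 4 < ln (real n)) sequentially" by real_asymp
  ultimately have "eventually (\<lambda>n. low n \<le> sphere_const n) sequentially"
    using eventually_ge_at_top[of 3]
  proof eventually_elim
    case (elim n)
    then obtain g where "Lipschitz_homeomorphism (linf_ball n) (l2_ball n) g"
      using ball_const_upper(1)[of n] by auto
    then have "Lipschitz_homeomorphism (linf_sphere n) (l2_sphere n) g"
      using elim by (intro Lipschitz_homeomorphism_sphere) auto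
    then have "low n \<le> max 1 (sphere_const n)"
      unfolding low_def P_def lam_def using elim by (intro sphere_const_ge)
    moreover have "ln (real n) / 4 < low n" using elim by (simp add: field_simps)
    ultimately show ?case using elim by simp
  qed
  then have lower: "eventually (\<lambda>n. low n / ln (real n) \<le> sphere_const n / ln (real n)) sequentially"
    using eventually_ge_at_top[of 1] by eventually_elim (simp add: divide_right_mono)
  have mid: "eventually (\<lambda>n. sphere_const n / ln (real n) \<le> ball_const n / ln (real n)) sequentially"
    using eventually_ge_at_top[of 2] by eventually_elim (simp add: divide_right_mono le)
  have top: "eventually (\<lambda>n. ball_const n / ln (real n) \<le> up n / ln (real n)) sequentially"
    using eventually_ge_at_top[of 2] by eventually_elim (simp add: divide_right_mono up_le)
  show "(\<lambda>n. sphere_const n / ln (real n)) \<longlonglongrightarrow> 1 / 2"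
  proof (rule tendsto_sandwich[OF lower _ low up])
    show "eventually (\<lambda>n. sphere_const n / ln (real n) \<le> up n / ln (real n)) sequentially"
      using mid top by eventually_elim linarith
  qed
  show "(\<lambda>n. ball_const n / ln (real n)) \<longlonglongrightarrow> 1 / 2"
  proof (rule tendsto_sandwich[OF _ top low up])
    show "eventually (\<lambda>n. low n / ln (real n) \<le> ball_const n / ln (real n)) sequentially"
      using lower mid by eventually_elim linarith
  qed
qed

end
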